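(* Let $d\ge1$, $t\in\mathbf R$, and let $b_{d,t}$ be the $t$-symbol of the inverse of the harmonic oscillator $H=-\Delta+|x|^2$ on $\mathbf R^d$. Then there is a constant $C>0$ such that $$|\partial^\alpha b_{d,t}(x,\xi)|\le C^{|\alpha|+1}(\alpha!)^{1/2}\langle(x,\xi)\rangle^{-2}$$ holds for every $(x,\xi)\in\mathbf R^{2d}$ and every $\alpha\in\mathbf N^{2d}$.
   Context: $\mathbf N=\{0,1,2,\dots\}$ and $\langle X\rangle=(1+|X|^2)^{1/2}$. For $t\in\mathbf R$ and a symbol $a$ on $\mathbf R^{2d}$, the pseudo-differential operator $\operatorname{Op}_t(a)$ is given by $$\operatorname{Op}_t(a)f(x)=(2\pi)^{-d}\iint_{\mathbf R^{2d}}a\big((1-t)x+ty,\xi\big)f(y)e^{i\langle x-y,\xi\rangle}\,dy\,d\xi,\qquad f\in\mathscr S(\mathbf R^d),$$ (interpreted as an oscillatory integral / by its distribution kernel when needed); $t=1/2$ is the Weyl quantization and $t=0$ is the Kohn–Nirenberg quantization. The harmonic oscillator $H=-\Delta+|x|^2$ on $\mathbf R^d$ is strictly positive on $L^2(\mathbf R^d)$ and invertible; its $t$-symbol $b_{d,t}$ of the inverse is the (unique, smooth) function on $\mathbf R^{2d}$ with $\operatorname{Op}_t(b_{d,t})=H^{-1}$. *)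

theory Defs
  imports "HOL-Analysis.Analysis"
begin

definition partial_deriv :: "'a::euclidean_space \<Rightarrow> ('a \<Rightarrow> complex) \<Rightarrow> 'a \<Rightarrow> complex" where
  "partial_deriv v f x = vector_derivative (\<lambda>s. f (x + s *\<^sub>R v)) (at 0)"

text \<open>Differentiability of every iterated partial derivative also gives continuity of each of
  them, so this is membership in the class of infinitely differentiable functions.\<close>

definition smooth :: "('a::euclidean_space \<Rightarrow> complex) \<Rightarrow> bool" where
  "smooth f \<longleftrightarrow> (\<forall>vs \<in> lists Basis. foldr partial_deriv vs f differentiable_on UNIV)"

text \<open>A multi-index is a function \<open>\<alpha> :: 'a \<Rightarrow> nat\<close> of which only the values on
  \<open>Basis\<close> are used. The order in which the coordinate directions are enumerated is arbitrary;
  it has no influence on \<open>mderiv \<alpha> f\<close> for smooth \<open>f\<close>.\<close>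

definition basis_enum :: "'a::euclidean_space list" where
  "basis_enum = (SOME vs. distinct vs \<and> set vs = Basis)"

definition mderiv :: "('a::euclidean_space \<Rightarrow> nat) \<Rightarrow> ('a \<Rightarrow> complex) \<Rightarrow> 'a \<Rightarrow> complex" where
  "mderiv \<alpha> f = foldr (\<lambda>i. partial_deriv i ^^ \<alpha> i) basis_enum f"

definition mindex_order :: "('a::euclidean_space \<Rightarrow> nat) \<Rightarrow> nat" where
  "mindex_order \<alpha> = (\<Sum>i\<in>Basis. \<alpha> i)"

definition mindex_fact :: "('a::euclidean_space \<Rightarrow> nat) \<Rightarrow> nat" where
  "mindex_fact \<alpha> = (\<Prod>i\<in>Basis. fact (\<alpha> i))"

definition jbracket :: "'a::real_normed_vector \<Rightarrow> real" where
  "jbracket X = sqrt (1 + (norm X)\<^sup>2)"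

definition schwartz :: "('a::euclidean_space \<Rightarrow> complex) set" where
  "schwartz = {f. smooth f \<and>
     (\<forall>k::nat. \<forall>\<alpha>. bounded (range (\<lambda>x. jbracket x ^ k * norm (mderiv \<alpha> f x))))}"

definition square_integrable :: "('a::euclidean_space \<Rightarrow> complex) \<Rightarrow> bool" where
  "square_integrable u \<longleftrightarrow>
     u \<in> borel_measurable lborel \<and> integrable lborel (\<lambda>x. (norm (u x))\<^sup>2)"

definition polynomial_growth :: "('a::euclidean_space \<Rightarrow> complex) \<Rightarrow> bool" where
  "polynomial_growth a \<longleftrightarrow> (\<exists>C::real. \<exists>N::nat. \<forall>X. norm (a X) \<le> C * jbracket X ^ N)"

text \<open>The distribution defined by a function, tested against \<open>\<phi>\<close> (bilinear pairing).\<close>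

definition distr_of :: "('a::euclidean_space \<Rightarrow> complex) \<Rightarrow> ('a \<Rightarrow> complex) \<Rightarrow> complex" where
  "distr_of u \<phi> = (LINT x|lborel. u x * \<phi> x)"

text \<open>The distribution \<open>Op t a f\<close>, tested against \<open>g\<close>; that is, the Schwartz kernel of the
  operator tested against \<open>g \<otimes> f\<close>. In the inner integral \<open>p = (x, y)\<close>. Integrating over
  \<open>(x, y)\<close> first gives the oscillatory integral its meaning: if \<open>a\<close> is measurable with
  \<open>polynomial_growth\<close> and \<open>f\<close>, \<open>g\<close> are in \<open>schwartz\<close>, the inner integral converges
  absolutely, and after substituting \<open>z = (1 - t) x + t y\<close>, \<open>w = x - y\<close> it becomes
  the integral over \<open>z\<close> of \<open>a (z, \<xi>)\<close> times a Schwartz function of \<open>(z, \<xi>)\<close> that does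
  not depend on \<open>a\<close>, so the outer integral converges absolutely as well.\<close>

definition Op :: "real \<Rightarrow> ('a::euclidean_space \<times> 'a \<Rightarrow> complex)
    \<Rightarrow> ('a \<Rightarrow> complex) \<Rightarrow> ('a \<Rightarrow> complex) \<Rightarrow> complex" where
  "Op t a f g = complex_of_real (1 / (2 * pi) ^ DIM('a)) *
     (LINT \<xi>|lborel. LINT p|lborel.
        a ((1 - t) *\<^sub>R fst p + t *\<^sub>R snd p, \<xi>) * f (snd p) * g (fst p)
          * exp (\<i> * complex_of_real ((fst p - snd p) \<bullet> \<xi>)))"

text \<open>\<open>a\<close> is a \<open>t\<close>-symbol of an operator \<open>T\<close> taking Schwartz functions to functions,
  in the sense \<open>Op t a = T\<close> as maps from Schwartz functions to tempered distributions.\<close>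

definition is_t_symbol :: "real \<Rightarrow> ('a::euclidean_space \<times> 'a \<Rightarrow> complex)
    \<Rightarrow> (('a \<Rightarrow> complex) \<Rightarrow> ('a \<Rightarrow> complex)) \<Rightarrow> bool" where
  "is_t_symbol t a T \<longleftrightarrow> smooth a \<and> polynomial_growth a \<and>
     (\<forall>f\<in>schwartz. \<forall>g\<in>schwartz. Op t a f g = distr_of (T f) g)"

definition laplacian :: "('a::euclidean_space \<Rightarrow> complex) \<Rightarrow> 'a \<Rightarrow> complex" where
  "laplacian f x = (\<Sum>i\<in>Basis. partial_deriv i (partial_deriv i f) x)"

definition harmonic_osc :: "('a::euclidean_space \<Rightarrow> complex) \<Rightarrow> 'a \<Rightarrow> complex" where
  "harmonic_osc f x = - laplacian f x + complex_of_real ((norm x)\<^sup>2) * f x"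

text \<open>Graph of the self-adjoint realization on square integrable functions: \<open>u\<close> and \<open>f\<close> are
  square integrable and applying \<open>harmonic_osc\<close> to \<open>u\<close> in the sense of distributions
  gives \<open>f\<close>. (The formal transpose of \<open>harmonic_osc\<close> is \<open>harmonic_osc\<close> itself.)\<close>

definition harmonic_L2 :: "('a::euclidean_space \<Rightarrow> complex) \<Rightarrow> ('a \<Rightarrow> complex) \<Rightarrow> bool" where
  "harmonic_L2 u f \<longleftrightarrow> square_integrable u \<and> square_integrable f \<and>
     (\<forall>\<phi>\<in>schwartz. distr_of u (harmonic_osc \<phi>) = distr_of f \<phi>)"

text \<open>The preimage is unique up to equality almost everywhere; \<open>SOME\<close> picks a representative.\<close>

definition harmonic_inverse :: "('a::euclidean_space \<Rightarrow> complex) \<Rightarrow> 'a \<Rightarrow> complex" where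
  "harmonic_inverse f = (SOME u. harmonic_L2 u f)"

definition harmonic_inverse_symbol :: "real \<Rightarrow> 'a::euclidean_space \<times> 'a \<Rightarrow> complex" where
  "harmonic_inverse_symbol t = (THE b. is_t_symbol t b harmonic_inverse)"

end

theory Submission
  imports Defs "HOL-Probability.Probability" "HOL-Complex_Analysis.Complex_Analysis"
begin

text \<open>
  Mehler's formula makes the inverse explicit. Put \<open>r = e\<^sup>-\<^sup>s\<close>. The operators \<open>e\<^sup>-\<^sup>s\<^sup>H\<close> have Gaussian
  kernels, and integrating them over \<open>0 < r < 1\<close> gives a kernel, bounded on \<open>L\<^sup>1\<close> and \<open>L\<^sup>\<infinity>\<close>, of an
  operator that inverts \<open>H\<close>. It maps Gaussian wave packets to explicit \<open>r\<close>-integrals of wave packets,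
  and a function orthogonal to all wave packets \<open>exp (- \<bar>x\<bar>\<^sup>2 / 2 + i k x)\<close> vanishes by uniqueness of
  the Fourier transform. This identifies every square integrable weak solution of \<open>H u = f\<close> when
  paired with Schwartz functions, without spectral theory.

  The \<open>t\<close>-symbol of \<open>e\<^sup>-\<^sup>s\<^sup>H\<close> is again a Gaussian, \<open>exp (- q r X)\<close> with a complex quadratic form \<open>q r\<close>.
  Hence the symbol \<open>b\<close> of \<open>1 / H\<close> is an integral of such Gaussians over \<open>0 < r < 1\<close>. It is unique,
  because \<open>Op t\<close> paired with wave packets is the Fourier transform of the symbol times a Gaussian.

  The function \<open>b\<close> extends to complex arguments, and \<open>\<bar>b (X + Z)\<bar> \<le> C exp (4 \<rho>\<^sup>2) / (1 + \<bar>X\<bar>\<^sup>2)\<close> whenever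
  the real and imaginary parts of \<open>Z\<close> have norm at most \<open>\<rho>\<close>. Cauchy's inequality on \<open>n\<close> successive circles
  of radius \<open>1 / \<surd>n\<close> (so \<open>\<rho> = \<surd>n\<close>) bounds a derivative of order \<open>n\<close> by \<open>C\<^sup>n n\<^sup>n\<^sup>/\<^sup>2 / (1 + \<bar>X\<bar>\<^sup>2)\<close>, and
  \<open>n\<^sup>n \<le> e\<^sup>n n!\<close> while \<open>n!\<close> is at most \<open>C\<^sup>n \<alpha>!\<close>.
\<close>

section \<open>Gaussian integrals\<close>

text \<open>The kernel of e^(-sH) concentrates on the diagonal as r tends to 1, but its symbol stays
  bounded and extends continuously to both ends of the interval; near r = 1 only its Gaussian
  degenerates, with rate of order 1 - r. Integrating exp (- c (1 - r) |X|^2) over r is what produces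
  the weight <X>^(-2). For t other than 1/2 the symbol also has a phase proportional to <x, \<xi>>.
  At complex arguments it becomes real growth of size \<open>sym_mu\<close> |X| |Y|, which could
  destroy the decay near r = 1. It is harmless because the square of \<open>sym_mu\<close> is at
  most \<open>sym_lam\<close>: half of the Gaussian absorbs it, and only a multiple of |Y|^2
  remains. This quadratic growth in imaginary directions is the source of the square root of
  \<alpha>!. \<open>Op\<close> integrates over \<xi> last, where the symbol offers no decay uniform
  in r. Exchanging the integrals over r and \<xi> therefore rests on the decay of the cross-Wigner
  function of the two test functions.\<close>

lemma lborel_integrable_shift:
  fixes f :: "'a::euclidean_space \<Rightarrow> 'b::{banach, second_countable_topology}"
  assumes "integrable lborel f"
  shows "integrable lborel (\<lambda>x. f (c + x))"
proof -
  have "integrable (distr lborel borel ((+) c)) f"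
    using assms by (simp add: lborel_distr_plus)
  then show ?thesis
    by (subst (asm) integrable_distr_eq) (use assms in auto)
qed

lemma lborel_integral_shift:
  fixes f :: "'a::euclidean_space \<Rightarrow> 'b::{banach, second_countable_topology}"
  assumes "f \<in> borel_measurable borel"
  shows "(LINT x|lborel. f (c + x)) = (LINT x|lborel. f x)"
proof -
  have "(LINT x|lborel. f x) = (LINT x|distr lborel borel ((+) c). f x)"
    by (simp add: lborel_distr_plus)
  also have "\<dots> = (LINT x|lborel. f (c + x))"
    by (rule integral_distr) (use assms in auto)
  finally show ?thesis ..
qed

lemma lborel_integral_scale:
  fixes f :: "'a::euclidean_space \<Rightarrow> 'b::{banach, second_countable_topology}"
  assumes [measurable]: "f \<in> borel_measurable borel" and c: "c \<noteq> 0"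
  shows "(LINT x|lborel. f x) = \<bar>c\<bar> ^ DIM('a) *\<^sub>R (LINT x|lborel. f (c *\<^sub>R x))"
proof -
  have "(LINT x|lborel. f x)
      = (LINT x|density (distr lborel borel (\<lambda>x. 0 + c *\<^sub>R x)) (\<lambda>_. \<bar>c\<bar>^DIM('a)). f x)"
    using lborel_affine[OF c, where t="0::'a"] by simp
  also have "\<dots> = \<bar>c\<bar>^DIM('a) *\<^sub>R (LINT x|lborel. f (c *\<^sub>R x))"
    by (subst integral_density) (auto simp: integral_distr)
  finally show ?thesis .
qed

text \<open>Lebesgue measure is the image of a product of one-dimensional Lebesgue measures over
  \<open>Basis\<close>, so integrals of product functions factor. This reduces Gaussians to the line
  and also gives an integrable majorant for inverse powers of \<open>jbracket\<close>.\<close>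

lemma lborel_integral_prod_Basis:
  fixes f :: "'a::euclidean_space \<Rightarrow> real \<Rightarrow> 'b::{real_normed_field, banach, second_countable_topology}"
  assumes int: "\<And>i. i \<in> Basis \<Longrightarrow> integrable lborel (f i)"
  shows "integrable lborel (\<lambda>x::'a. \<Prod>i\<in>Basis. f i (x \<bullet> i))"
    and "(LINT x|lborel. (\<Prod>i\<in>Basis. f i (x \<bullet> i))) = (\<Prod>i\<in>Basis. (LINT s|lborel. f i s))"
proof -
  interpret product_sigma_finite "\<lambda>_::'a. lborel :: real measure" by standard
  let ?h = "\<lambda>f. \<Sum>b\<in>Basis. f b *\<^sub>R (b::'a)"
  have m[measurable]: "?h \<in> measurable (\<Pi>\<^sub>M b\<in>Basis. lborel) borel"
    by measurable
  have [measurable]: "\<And>i. i \<in> Basis \<Longrightarrow> f i \<in> borel_measurable borel"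
    using int by (auto dest: borel_measurable_integrable)
  have meas[measurable]: "(\<lambda>x::'a. \<Prod>i\<in>Basis. f i (x \<bullet> i)) \<in> borel_measurable borel"
    by measurable
  have eq: "(\<Prod>i\<in>Basis. f i (?h x \<bullet> i)) = (\<Prod>i\<in>Basis. f i (x i))" for x
    by (intro prod.cong) auto
  show "integrable lborel (\<lambda>x::'a. \<Prod>i\<in>Basis. f i (x \<bullet> i))"
    using product_integrable_prod[OF finite_Basis int]
    by (subst lborel_eq) (simp add: integrable_distr_eq)
  show "(LINT x|lborel. (\<Prod>i\<in>Basis. f i (x \<bullet> i))) = (\<Prod>i\<in>Basis. (LINT s|lborel. f i s))"
    using product_integral_prod[OF finite_Basis int]
    by (subst lborel_eq) (simp add: integral_distr)
qed

text \<open>After scaling by \<open>sqrt (2 * c)\<close> this is the characteristic function of the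
  standard normal distribution. The other Gaussian integrals below are reduced to this one.\<close>

lemma gaussian_fourier_real:
  fixes c k :: real
  assumes c: "c > 0"
  shows "integrable lborel (\<lambda>x. exp (- c * x\<^sup>2) *\<^sub>R iexp (k * x))"
    and "(LINT x|lborel. exp (- c * x\<^sup>2) *\<^sub>R iexp (k * x))
           = complex_of_real (sqrt (pi / c) * exp (- k\<^sup>2 / (4 * c)))"
proof -
  define a where "a = sqrt (2 * c)"
  have a: "a > 0" "a\<^sup>2 = 2 * c" using c by (auto simp: a_def)
  let ?g = "\<lambda>x. std_normal_density x *\<^sub>R iexp ((k / a) * x)"
  interpret real_distribution std_normal_distribution by (rule real_dist_normal_dist)
  have int: "integrable lborel ?g"
    using integrable_std_normal_moment[of 0]
    by (intro Bochner_Integration.integrable_bound[OF integrable_normal_density[of 1 0]]) (auto)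
  have "(LINT x|lborel. ?g x) = char std_normal_distribution (k / a)"
    unfolding char_def
    by (subst integral_density) (auto simp: normal_density_nonneg)
  also have "\<dots> = complex_of_real (exp (- ((k / a)^2) / 2))"
    by (simp add: char_std_normal_distribution)
  finally have val: "(LINT x|lborel. ?g x) = complex_of_real (exp (- ((k / a)^2) / 2))" .
  have eq: "?g (0 + a * x) = (1 / sqrt (2 * pi)) *\<^sub>R (exp (- c * x\<^sup>2) *\<^sub>R iexp (k * x))" for x
    using a by (simp add: normal_density_def power_mult_distrib)
  have int2: "integrable lborel (\<lambda>x. (1 / sqrt (2 * pi)) *\<^sub>R (exp (- c * x\<^sup>2) *\<^sub>R iexp (k * x)))"
    using lborel_integrable_real_affine[OF int, of a 0] a unfolding eq by auto
  have "integrable lborel (\<lambda>x. sqrt (2 * pi) *\<^sub>R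
     ((1 / sqrt (2 * pi)) *\<^sub>R (exp (- c * x\<^sup>2) *\<^sub>R iexp (k * x))))"
    by (rule integrable_scaleR_right[OF int2])
  then show int3: "integrable lborel (\<lambda>x. exp (- c * x\<^sup>2) *\<^sub>R iexp (k * x))"
    by simp
  have "complex_of_real (exp (- ((k / a)^2) / 2))
      = a *\<^sub>R (LINT x|lborel. ?g (0 + a * x))"
    using lborel_integral_real_affine[of a ?g 0] a val by simp
  also have "\<dots> = (a / sqrt (2 * pi)) *\<^sub>R (LINT x|lborel. exp (- c * x\<^sup>2) *\<^sub>R iexp (k * x))"
    unfolding eq by (subst integral_scaleR_right) simp
  finally have *: "complex_of_real (exp (- ((k / a)^2) / 2)) =
    (a / sqrt (2 * pi)) *\<^sub>R (LINT x|lborel. exp (- c * x\<^sup>2) *\<^sub>R iexp (k * x))" .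
  have "(LINT x|lborel. exp (- c * x\<^sup>2) *\<^sub>R iexp (k * x))
     = (sqrt (2 * pi) / a) *\<^sub>R complex_of_real (exp (- ((k / a)^2) / 2))"
    unfolding * using a by simp
  also have "sqrt (2 * pi) / a = sqrt (pi / c)"
    using c by (simp add: a_def real_sqrt_divide real_sqrt_mult)
  also have "- ((k / a)^2) / 2 = - k\<^sup>2 / (4 * c)"
    using a by (simp add: power_divide)
  finally show "(LINT x|lborel. exp (- c * x\<^sup>2) *\<^sub>R iexp (k * x))
           = complex_of_real (sqrt (pi / c) * exp (- k\<^sup>2 / (4 * c)))"
    by (simp add: scaleR_conv_of_real)
qed

lemma norm_square_sum_Basis: "(norm (x::'a::euclidean_space))\<^sup>2 = (\<Sum>i\<in>Basis. (x \<bullet> i)\<^sup>2)"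
  unfolding power2_norm_eq_inner by (subst euclidean_inner) (simp add: power2_eq_square)

lemma gaussian_fourier:
  fixes k :: "'a::euclidean_space" and c :: real
  assumes c: "c > 0"
  shows "integrable lborel (\<lambda>x::'a. exp (- c * (norm x)\<^sup>2) *\<^sub>R iexp (k \<bullet> x))"
    and "(LINT x|lborel. exp (- c * (norm x)\<^sup>2) *\<^sub>R iexp (k \<bullet> x))
           = complex_of_real (sqrt (pi / c) ^ DIM('a) * exp (- (norm k)\<^sup>2 / (4 * c)))"
proof -
  have eq: "exp (- c * (norm x)\<^sup>2) *\<^sub>R iexp (k \<bullet> x)
      = (\<Prod>i\<in>Basis. exp (- c * (x \<bullet> i)\<^sup>2) *\<^sub>R iexp ((k \<bullet> i) * (x \<bullet> i)))" for x :: 'a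
  proof -
    have "iexp (k \<bullet> x) = (\<Prod>i\<in>Basis. iexp ((k \<bullet> i) * (x \<bullet> i)))"
      by (subst euclidean_inner) (simp add: sum_distrib_left exp_sum)
    moreover have "exp (- c * (norm x)\<^sup>2) = (\<Prod>i\<in>Basis. exp (- c * (x \<bullet> i)\<^sup>2))"
      by (simp add: norm_square_sum_Basis sum_distrib_left sum_negf[symmetric] exp_sum)
    ultimately show ?thesis
      by (simp add: scaleR_conv_of_real prod.distrib)
  qed
  show "integrable lborel (\<lambda>x::'a. exp (- c * (norm x)\<^sup>2) *\<^sub>R iexp (k \<bullet> x))"
    unfolding eq
    by (rule lborel_integral_prod_Basis(1)[of "\<lambda>i s. exp (- c * s\<^sup>2) *\<^sub>R iexp ((k \<bullet> i) * s)"])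
       (rule gaussian_fourier_real(1)[OF c])
  have "(LINT x|lborel. exp (- c * (norm x)\<^sup>2) *\<^sub>R iexp (k \<bullet> x))
     = (\<Prod>i\<in>(Basis::'a set). (LINT s|lborel. exp (- c * s\<^sup>2) *\<^sub>R iexp ((k \<bullet> i) * s)))"
    unfolding eq
    by (rule lborel_integral_prod_Basis(2)[of "\<lambda>i s. exp (- c * s\<^sup>2) *\<^sub>R iexp ((k \<bullet> i) * s)"])
       (rule gaussian_fourier_real(1)[OF c])
  also have "\<dots> = (\<Prod>i\<in>(Basis::'a set). complex_of_real (sqrt (pi / c) * exp (- (k \<bullet> i)\<^sup>2 / (4 * c))))"
    by (intro prod.cong refl gaussian_fourier_real(2)[OF c])
  also have "\<dots> = complex_of_real (sqrt (pi / c) ^ DIM('a) * exp (- (norm k)\<^sup>2 / (4 * c)))"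
    by (simp add: norm_square_sum_Basis prod.distrib sum_divide_distrib sum_negf[symmetric] exp_sum
             flip: of_real_prod)
  finally show "(LINT x|lborel. exp (- c * (norm x)\<^sup>2) *\<^sub>R iexp (k \<bullet> x))
           = complex_of_real (sqrt (pi / c) ^ DIM('a) * exp (- (norm k)\<^sup>2 / (4 * c)))" .
qed

lemma gaussian_integral:
  assumes c: "c > 0"
  shows "integrable lborel (\<lambda>x::'a::euclidean_space. exp (- c * (norm x)\<^sup>2))"
    and "(LINT x|lborel. exp (- c * (norm (x::'a::euclidean_space))\<^sup>2)) = sqrt (pi / c) ^ DIM('a)"
proof -
  have "integrable lborel (\<lambda>x::'a. complex_of_real (exp (- c * (norm x)\<^sup>2)))"
    using gaussian_fourier(1)[OF c, of "0::'a"] by (simp add: scaleR_conv_of_real)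
  then show "integrable lborel (\<lambda>x::'a::euclidean_space. exp (- c * (norm x)\<^sup>2))"
    by (simp only: complex_of_real_integrable_eq)
  have "complex_of_real (LINT x|lborel. exp (- c * (norm (x::'a::euclidean_space))\<^sup>2))
     = complex_of_real (sqrt (pi / c) ^ DIM('a))"
    using gaussian_fourier(2)[OF c, of "0::'a"] by (simp add: scaleR_conv_of_real)
  then show "(LINT x|lborel. exp (- c * (norm (x::'a::euclidean_space))\<^sup>2)) = sqrt (pi / c) ^ DIM('a)"
    by (simp only: of_real_eq_iff)
qed

text \<open>Completing the square moves the centre to m / (2c). The shift contributes exp (|m|^2 /
  (4c)) and turns the frequency \<open>k\<close> into the phase k . m / (2c); since \<open>m\<close>
  is real, translation invariance takes the place of a contour shift.\<close>

lemma gaussian_fourier_linear: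
  fixes k m :: "'a::euclidean_space" and c :: real
  assumes c: "c > 0"
  shows "integrable lborel (\<lambda>x::'a. exp (- c * (norm x)\<^sup>2 + m \<bullet> x) *\<^sub>R iexp (k \<bullet> x))"
    and "(LINT x|lborel. exp (- c * (norm x)\<^sup>2 + m \<bullet> x) *\<^sub>R iexp (k \<bullet> x))
           = complex_of_real (sqrt (pi / c) ^ DIM('a) * exp (((norm m)\<^sup>2 - (norm k)\<^sup>2) / (4 * c)))
             * iexp (k \<bullet> m / (2 * c))"
proof -
  define y where "y = - (1 / (2 * c)) *\<^sub>R m"
  let ?g = "\<lambda>x. exp (- c * (norm x)\<^sup>2) *\<^sub>R iexp (k \<bullet> x)"
  define K where "K = exp ((norm m)\<^sup>2 / (4 * c)) * iexp (k \<bullet> m / (2 * c))"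
  have eq: "exp (- c * (norm x)\<^sup>2 + m \<bullet> x) *\<^sub>R iexp (k \<bullet> x)
     = K * ?g (y + x)" for x
  proof -
    have "(norm (y + x))\<^sup>2 = (norm x)\<^sup>2 + (norm m)\<^sup>2 / (4 * c\<^sup>2) - (m \<bullet> x) / c"
      unfolding power2_norm_eq_inner y_def using c
      by (simp add: algebra_simps inner_add inner_commute divide_simps power2_eq_square)
    then have "- c * (norm x)\<^sup>2 + m \<bullet> x = (norm m)\<^sup>2 / (4 * c) + - c * (norm (y + x))\<^sup>2"
      using c by (simp add: divide_simps power2_eq_square) (simp add: algebra_simps)
    then have "exp (- c * (norm x)\<^sup>2 + m \<bullet> x) = exp ((norm m)\<^sup>2 / (4 * c)) * exp (- c * (norm (y + x))\<^sup>2)"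
      by (simp only: exp_add)
    moreover have "iexp (k \<bullet> x) = iexp (k \<bullet> m / (2 * c)) * iexp (k \<bullet> (y + x))"
      by (subst exp_add[symmetric]) (simp add: y_def inner_add_right algebra_simps)
    ultimately show ?thesis
      by (simp add: scaleR_conv_of_real K_def)
  qed
  show "integrable lborel (\<lambda>x::'a. exp (- c * (norm x)\<^sup>2 + m \<bullet> x) *\<^sub>R iexp (k \<bullet> x))"
    unfolding eq by (intro integrable_mult_right lborel_integrable_shift gaussian_fourier(1)[OF c])
  have "(LINT x|lborel. exp (- c * (norm x)\<^sup>2 + m \<bullet> x) *\<^sub>R iexp (k \<bullet> x))
    = K * (LINT x|lborel. ?g (y + x))"
    unfolding eq by (rule integral_mult_right_zero)
  also have "(LINT x|lborel. ?g (y + x)) = (LINT x|lborel. ?g x)"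
    by (rule lborel_integral_shift) measurable
  also have "\<dots> = complex_of_real (sqrt (pi / c) ^ DIM('a) * exp (- (norm k)\<^sup>2 / (4 * c)))"
    by (rule gaussian_fourier(2)[OF c])
  finally have "(LINT x|lborel. exp (- c * (norm x)\<^sup>2 + m \<bullet> x) *\<^sub>R iexp (k \<bullet> x))
      = K * complex_of_real (sqrt (pi / c) ^ DIM('a) * exp (- (norm k)\<^sup>2 / (4 * c)))" .
  moreover have "exp (((norm m)\<^sup>2 - (norm k)\<^sup>2) / (4 * c))
      = exp ((norm m)\<^sup>2 / (4 * c)) * exp (- (norm k)\<^sup>2 / (4 * c))"
    by (subst exp_add[symmetric]) (simp add: diff_divide_distrib)
  ultimately show "(LINT x|lborel. exp (- c * (norm x)\<^sup>2 + m \<bullet> x) *\<^sub>R iexp (k \<bullet> x))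
           = complex_of_real (sqrt (pi / c) ^ DIM('a) * exp (((norm m)\<^sup>2 - (norm k)\<^sup>2) / (4 * c)))
             * iexp (k \<bullet> m / (2 * c))"
    by (simp only: K_def of_real_mult mult_ac)
qed

section \<open>The weight \<open>jbracket\<close>: submultiplicativity and integrability\<close>

lemma jbracket_ge_1: "jbracket x \<ge> 1"
  by (simp add: jbracket_def)

lemma jbracket_pos: "jbracket x > 0"
  using jbracket_ge_1[of x] by linarith

lemma jbracket_sq: "(jbracket x)\<^sup>2 = 1 + (norm x)\<^sup>2"
  by (simp add: jbracket_def)

lemma norm_le_jbracket: "norm x \<le> jbracket x"
  by (rule power2_le_imp_le) (auto simp: jbracket_sq less_imp_le[OF jbracket_pos])

lemma jbracket_minus [simp]: "jbracket (- x) = jbracket x"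
  by (simp add: jbracket_def)

text \<open>A Peetre-type inequality with a crude constant: the weight of a sum or difference is
  shared between its two terms.\<close>

lemma jbracket_add_le: "jbracket (x + y) \<le> 2 * jbracket x * jbracket y"
proof (rule power2_le_imp_le)
  have "(norm (x + y))\<^sup>2 \<le> (norm x + norm y)\<^sup>2"
    by (intro power_mono norm_triangle_ineq) auto
  also have "\<dots> \<le> 2 * (norm x)\<^sup>2 + 2 * (norm y)\<^sup>2"
    using sum_squares_bound[of "norm x" "norm y"] by (simp add: power2_sum)
  finally have "1 + (norm (x + y))\<^sup>2 \<le> 4 * ((1 + (norm x)\<^sup>2) * (1 + (norm y)\<^sup>2))"
    using zero_le_power2[of "norm x * norm y"] by (simp add: algebra_simps power_mult_distrib)
       (smt (verit) zero_le_power2 mult_nonneg_nonneg)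
  moreover have "(2 * jbracket x * jbracket y)\<^sup>2 = 4 * ((1 + (norm x)\<^sup>2) * (1 + (norm y)\<^sup>2))"
    by (simp only: jbracket_sq power_mult_distrib mult.assoc) simp
  ultimately show "(jbracket (x + y))\<^sup>2 \<le> (2 * jbracket x * jbracket y)\<^sup>2"
    by (simp only: jbracket_sq)
qed (auto simp: less_imp_le[OF jbracket_pos])

text \<open>A displacement of norm at most 1 has weight at most \<open>sqrt 2\<close>, rounded up to
  2; the other factor 2 is that of \<open>jbracket_add_le\<close>.\<close>

lemma jbracket_le_near:
  assumes "norm (x' - x) \<le> 1"
  shows "jbracket x \<le> 4 * jbracket x'"
proof -
  have "(norm (x' - x))\<^sup>2 \<le> 1" using assms by (simp add: power_le_one)
  then have "jbracket (x - x') \<le> 2"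
    by (auto simp: jbracket_def norm_minus_commute intro!: real_le_lsqrt)
  then have j1: "2 * jbracket (x - x') * jbracket x' \<le> 4 * jbracket x'"
    using jbracket_pos[of x'] by (intro mult_right_mono) auto
  have j2: "jbracket x \<le> 2 * jbracket (x - x') * jbracket x'"
    using jbracket_add_le[of "x - x'" x'] by simp
  show ?thesis by (rule order_trans[OF j2 j1])
qed

lemma jbracket_scaleR_le: "jbracket (c *\<^sub>R x) \<le> (1 + \<bar>c\<bar>) * jbracket x"
proof (rule power2_le_imp_le)
  have "1 \<le> (1 + \<bar>c\<bar>)\<^sup>2" "c\<^sup>2 \<le> (1 + \<bar>c\<bar>)\<^sup>2"
    by (auto simp: power2_sum)
  then have "1 + c\<^sup>2 * (norm x)\<^sup>2 \<le> (1 + \<bar>c\<bar>)\<^sup>2 + (1 + \<bar>c\<bar>)\<^sup>2 * (norm x)\<^sup>2"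
    by (intro add_mono mult_right_mono) auto
  then show "(jbracket (c *\<^sub>R x))\<^sup>2 \<le> ((1 + \<bar>c\<bar>) * jbracket x)\<^sup>2"
    by (simp only: jbracket_sq power_mult_distrib real_norm_def norm_scaleR power2_abs) (simp add: algebra_simps)
qed (auto simp: less_imp_le[OF jbracket_pos])

lemma jbracket_measurable [measurable]: "jbracket \<in> borel_measurable borel"
  unfolding jbracket_def by measurable

lemma integrable_lborel_inverse_1_plus_square: "integrable lborel (\<lambda>x::real. inverse (1 + x\<^sup>2))"
proof -
  have 1: "(LBINT x=-\<infinity>..\<infinity>. inverse (1 + x\<^sup>2)) = pi"
    "set_integrable lborel (einterval (-\<infinity>) \<infinity>) (\<lambda>x. inverse (1 + x\<^sup>2))"
    using LBINT_inverse_1_plus_square integrable_inverse_1_plus_square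
    by auto
  then show ?thesis by (simp add: set_integrable_def)
qed

text \<open>The exponent \<open>2 * DIM('a)\<close> provides one factor
  \<open>(jbracket x)^2\<close> per coordinate, and each dominates
  \<open>1 + (x \<bullet> i)^2\<close>. Below, this power is the standard integrable weight.\<close>

lemma inverse_jbracket_power_le_prod:
  fixes x :: "'a::euclidean_space"
  shows "inverse (jbracket x ^ (2 * DIM('a))) \<le> (\<Prod>i\<in>Basis. inverse (1 + (x \<bullet> i)\<^sup>2))"
proof -
  have "inverse (jbracket x ^ (2 * DIM('a))) = (\<Prod>i\<in>(Basis::'a set). inverse ((jbracket x)\<^sup>2))"
    by (simp add: power_mult power_inverse)
  also have "\<dots> \<le> (\<Prod>i\<in>Basis. inverse (1 + (x \<bullet> i)\<^sup>2))"
  proof (rule prod_mono, safe)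
    fix i :: 'a assume "i \<in> Basis"
    have "\<bar>x \<bullet> i\<bar> \<le> norm x" using Basis_le_norm[OF \<open>i \<in> Basis\<close>] .
    then have "(x \<bullet> i)\<^sup>2 \<le> (norm x)\<^sup>2" by (metis abs_le_square_iff abs_norm_cancel)
    then show "inverse ((jbracket x)\<^sup>2) \<le> inverse (1 + (x \<bullet> i)\<^sup>2)"
      by (intro le_imp_inverse_le) (auto simp: jbracket_sq intro: add_pos_nonneg)
  qed auto
  finally show ?thesis .
qed

lemma integrable_prod_inverse:
  "integrable lborel (\<lambda>x::'a::euclidean_space. \<Prod>i\<in>Basis. inverse (1 + (x \<bullet> i)\<^sup>2))"
  by (rule lborel_integral_prod_Basis(1)) (rule integrable_lborel_inverse_1_plus_square)

lemma integrable_jbracket: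
  assumes "n \<ge> 2 * DIM('a)"
  shows "integrable lborel (\<lambda>x::'a::euclidean_space. inverse (jbracket x ^ n))"
proof (rule Bochner_Integration.integrable_bound[OF integrable_prod_inverse])
  show "AE x in lborel. norm (inverse (jbracket x ^ n)) \<le> norm (\<Prod>i\<in>Basis. inverse (1 + ((x::'a) \<bullet> i)\<^sup>2))"
  proof (rule AE_I2)
    fix x :: 'a
    have "inverse (jbracket x ^ n) \<le> inverse (jbracket x ^ (2 * DIM('a)))"
      using assms jbracket_ge_1[of x] jbracket_pos[of x] by (intro le_imp_inverse_le power_increasing) auto
    also note inverse_jbracket_power_le_prod[of x]
    finally show "norm (inverse (jbracket x ^ n)) \<le> norm (\<Prod>i\<in>Basis. inverse (1 + ((x::'a) \<bullet> i)\<^sup>2))"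
      using jbracket_pos[of x] by (simp add: prod_nonneg)
  qed
qed measurable

section \<open>Uniqueness of the Fourier transform\<close>

lemma borel_measurable_fst_euclidean [measurable (raw)]:
  fixes f :: "'c \<Rightarrow> 'a::euclidean_space \<times> 'b::euclidean_space"
  shows "f \<in> borel_measurable M \<Longrightarrow> (\<lambda>x. fst (f x)) \<in> borel_measurable M"
  by (rule measurable_compose[where N=borel])
     (auto intro!: borel_measurable_continuous_onI continuous_intros)

lemma borel_measurable_snd_euclidean [measurable (raw)]:
  fixes f :: "'c \<Rightarrow> 'a::euclidean_space \<times> 'b::euclidean_space"
  shows "f \<in> borel_measurable M \<Longrightarrow> (\<lambda>x. snd (f x)) \<in> borel_measurable M"
  by (rule measurable_compose[where N=borel])
     (auto intro!: borel_measurable_continuous_onI continuous_intros)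

lemma lborel_Fubini:
  fixes f :: "'a::euclidean_space \<times> 'b::euclidean_space \<Rightarrow> 'c::{banach, second_countable_topology}"
  assumes f: "integrable lborel f"
  shows "(LINT p|lborel. f p) = (LINT x|lborel. LINT y|lborel. f (x, y))"
    and "(LINT p|lborel. f p) = (LINT y|lborel. LINT x|lborel. f (x, y))"
    and "integrable lborel (\<lambda>x. LINT y|lborel. f (x, y))"
    and "integrable lborel (\<lambda>y. LINT x|lborel. f (x, y))"
proof -
  have f': "integrable (lborel \<Otimes>\<^sub>M lborel) (\<lambda>(x, y). f (x, y))"
    using f by (simp add: lborel_prod split_def)
  show "(LINT p|lborel. f p) = (LINT x|lborel. LINT y|lborel. f (x, y))"
    using lborel_pair.integral_fst'[of f] f by (simp add: lborel_prod)
  show "(LINT p|lborel. f p) = (LINT y|lborel. LINT x|lborel. f (x, y))"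
    using lborel_pair.integral_snd[OF f'] by (simp add: lborel_prod split_def)
  show "integrable lborel (\<lambda>x. LINT y|lborel. f (x, y))"
    using lborel_pair.integrable_fst'[of f] f by (simp add: lborel_prod)
  show "integrable lborel (\<lambda>y. LINT x|lborel. f (x, y))"
    using lborel_pair.integrable_snd[OF f'] by (simp add: lborel_prod split_def)
qed

text \<open>Tonelli's criterion with a majorant: the integrals of the norm over the fibres are
  bounded by an integrable function instead of being computed.\<close>

lemma lborel_integrable_fstI:
  fixes f :: "'a::euclidean_space \<times> 'b::euclidean_space \<Rightarrow> 'c::{banach, second_countable_topology}"
  assumes m: "f \<in> borel_measurable borel"
    and s: "\<And>x. integrable lborel (\<lambda>y. f (x, y))"
    and g: "integrable lborel g"
    and b: "\<And>x. (LINT y|lborel. norm (f (x, y))) \<le> g x"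
  shows "integrable lborel f"
proof -
  have m'[measurable]: "f \<in> borel_measurable (lborel \<Otimes>\<^sub>M lborel)"
    using m by (simp add: lborel_prod)
  have "integrable (lborel \<Otimes>\<^sub>M lborel) f"
  proof (rule lborel_pair.Fubini_integrable[OF m'])
    show "integrable lborel (\<lambda>x. LINT y|lborel. norm (f (x, y)))"
    proof (rule Bochner_Integration.integrable_bound[OF g])
      show "AE x in lborel. norm (LINT y|lborel. norm (f (x, y))) \<le> norm (g x)"
        by (rule AE_I2) (use b in \<open>simp add: order_trans[OF b abs_ge_self]\<close>)
    qed measurable
    show "AE x in lborel. integrable lborel (\<lambda>y. f (x, y))"
      using s by auto
  qed
  then show ?thesis by (simp add: lborel_prod)
qed

lemma integrable_tensor:
  fixes f :: "'a::euclidean_space \<Rightarrow> 'c::{real_normed_field, banach, second_countable_topology}"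
    and g :: "'b::euclidean_space \<Rightarrow> 'c"
  assumes f: "integrable lborel f" and g: "integrable lborel g"
  shows "integrable lborel (\<lambda>p. f (fst p) * g (snd p))"
proof (rule lborel_integrable_fstI)
  have [measurable]: "f \<in> borel_measurable borel" "g \<in> borel_measurable borel"
    using f g by (auto dest: borel_measurable_integrable)
  show "(\<lambda>p. f (fst p) * g (snd p)) \<in> borel_measurable borel" by measurable
  show "integrable lborel (\<lambda>x. norm (f x) * (LINT y|lborel. norm (g y)))"
    using f by simp
qed (use g in \<open>auto simp: norm_mult\<close>)

text \<open>Integrating against a Gaussian in \<open>k\<close> shows that all Gaussian mollifications of \<open>h\<close> vanish.\<close>

lemma fourier_uniqueness:
  fixes h \<psi> :: "'a::euclidean_space \<Rightarrow> complex"
  assumes h: "integrable lborel h"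
    and zero: "\<And>k. (LINT x|lborel. h x * iexp (k \<bullet> x)) = 0"
    and \<psi>: "continuous_on UNIV \<psi>" and B: "\<And>x. norm (\<psi> x) \<le> B"
  shows "(LINT x|lborel. h x * \<psi> x) = 0"
proof -
  have [measurable]: "h \<in> borel_measurable borel" "\<psi> \<in> borel_measurable borel"
    using h \<psi> by (auto dest: borel_measurable_integrable intro: borel_measurable_continuous_onI)
  have B0: "B \<ge> 0" using B[of 0] norm_ge_zero[of "\<psi> 0"] by linarith
  have gauss0: "(LINT x|lborel. h x * exp (- c * (norm (y - x))\<^sup>2)) = 0" if "c > 0" for c :: real and y
  proof -
    \<comment> \<open>\<open>gaussian_fourier\<close> sends the coefficient c' to 1 / (4c'), so this
      choice makes the transform of exp (- c' |k|^2) a multiple of exp (- c |x|^2).\<close>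
    define c' where "c' = 1 / (4 * c)"
    have c': "c' > 0" "4 * c' = 1 / c" using that by (auto simp: c'_def)
    let ?F = "\<lambda>p. (h (fst p)) * (exp (- c' * (norm (snd p))\<^sup>2) *\<^sub>R iexp ((fst p - y) \<bullet> (snd p)))"
    have "integrable lborel (\<lambda>p. h (fst p) * (exp (- c' * (norm (snd p))\<^sup>2) *\<^sub>R iexp (0 \<bullet> snd p)))"
      by (rule integrable_tensor[OF h gaussian_fourier(1)[OF c'(1)]])
    then have int: "integrable lborel ?F"
      by (rule Bochner_Integration.integrable_bound) (auto simp: norm_mult)
    have "(LINT x|lborel. LINT k|lborel. ?F (x, k)) = (LINT k|lborel. LINT x|lborel. ?F (x, k))"
      using lborel_Fubini(1,2)[OF int] by simp
    also have "\<dots> = (LINT k|lborel. (exp (- c' * (norm k)\<^sup>2) * iexp (- (y \<bullet> k))) * (LINT x|lborel. h x * iexp (k \<bullet> x)))"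
    proof (intro Bochner_Integration.integral_cong refl)
      fix k :: 'a
      have "?F (x, k) = (exp (- c' * (norm k)\<^sup>2) * iexp (- (y \<bullet> k))) * (h x * iexp (k \<bullet> x))" for x
        by (simp add: scaleR_conv_of_real inner_diff_left inner_commute algebra_simps exp_diff exp_minus divide_inverse)
      then show "(LINT x|lborel. ?F (x, k)) =
        (exp (- c' * (norm k)\<^sup>2) * iexp (- (y \<bullet> k))) * (LINT x|lborel. h x * iexp (k \<bullet> x))"
        by simp
    qed
    also have "\<dots> = 0" using zero by simp
    finally have 0: "(LINT x|lborel. LINT k|lborel. ?F (x, k)) = 0" .
    have "(LINT k|lborel. ?F (x, k)) = (sqrt (pi / c') ^ DIM('a)) * (h x * exp (- c * (norm (y - x))\<^sup>2))" for x
    proof -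
      have "(LINT k|lborel. ?F (x, k)) = h x * (LINT k|lborel. exp (- c' * (norm k)\<^sup>2) *\<^sub>R iexp ((x - y) \<bullet> k))"
        by (simp only: fst_conv snd_conv integral_mult_right_zero)
      also have "\<dots> = h x * (complex_of_real (sqrt (pi / c') ^ DIM('a) * exp (- (norm (x - y))\<^sup>2 / (4 * c'))))"
        by (subst gaussian_fourier(2)[OF c'(1)]) simp
      also have "- (norm (x - y))\<^sup>2 / (4 * c') = - c * (norm (y - x))\<^sup>2"
        using c' by (simp add: norm_minus_commute)
      finally show ?thesis by (simp only: of_real_mult mult_ac)
    qed
    with 0 have "(sqrt (pi / c') ^ DIM('a)) * (LINT x|lborel. h x * exp (- c * (norm (y - x))\<^sup>2)) = 0"
      by simp
    then show ?thesis using c' by simp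
  qed
  \<comment> \<open>Up to the factor \<open>sqrt pi ^ DIM('a)\<close>, \<open>?J s\<close> averages
    \<psi> over a Gaussian of width \<open>s\<close>. Integrating the vanishing mollifications of
    \<open>h\<close> against \<psi> moves the mollification onto \<psi>, where the width can tend to
    0.\<close>
  let ?J = "\<lambda>s x. LINT y|lborel. \<psi> (x + s *\<^sub>R y) * complex_of_real (exp (- (norm y)\<^sup>2))"
  have gi: "integrable lborel (\<lambda>x::'a. exp (- (norm x)\<^sup>2))"
    using gaussian_integral(1)[of 1, where 'a='a] by simp
  have J0: "(LINT x|lborel. h x * ?J s x) = 0" if s: "s > 0" for s :: real
  proof -
    let ?c = "1 / s\<^sup>2"
    let ?F = "\<lambda>p. h (fst p) * (\<psi> (snd p) * exp (- ?c * (norm (snd p - fst p))\<^sup>2))"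
    have g: "integrable lborel (\<lambda>y. exp (- ?c * (norm (y - x))\<^sup>2))"
        "(LINT y|lborel. exp (- ?c * (norm (y - x))\<^sup>2)) = sqrt (pi / ?c) ^ DIM('a)" for x :: 'a
      using lborel_integrable_shift[OF gaussian_integral(1)[of ?c], of "-x"]
            lborel_integral_shift[of "\<lambda>y. exp (- ?c * (norm y)\<^sup>2)" "-x"]
            gaussian_integral(2)[of ?c, where 'a='a] s by (auto simp: add.commute)
    have gb: "integrable lborel (\<lambda>y. B * exp (- ?c * (norm (y - x))\<^sup>2))" for x :: 'a
      using g by simp
    have int1: "integrable lborel (\<lambda>y. \<psi> y * complex_of_real (exp (- ?c * (norm (y - x))\<^sup>2)))" for x
      by (rule Bochner_Integration.integrable_bound[OF gb[of x]])
         (use B B0 in \<open>auto simp: norm_mult abs_mult intro!: mult_right_mono\<close>)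
    have int: "integrable lborel ?F"
    proof (rule lborel_integrable_fstI)
      show "?F \<in> borel_measurable borel" by measurable
      show "integrable lborel (\<lambda>y. ?F (x, y))" for x
        using int1 by simp
      show "integrable lborel (\<lambda>x. norm (h x) * (B * sqrt (pi / ?c) ^ DIM('a)))"
        using h by simp
      show "(LINT y|lborel. norm (?F (x, y))) \<le> norm (h x) * (B * sqrt (pi / ?c) ^ DIM('a))" for x
      proof -
        have "(LINT y|lborel. norm (?F (x, y))) \<le> (LINT y|lborel. norm (h x) * (B * exp (- ?c * (norm (y - x))\<^sup>2)))"
        proof (rule integral_mono)
          show "integrable lborel (\<lambda>y. norm (?F (x, y)))"
            using int1[of x] by (intro integrable_norm) simp
          show "integrable lborel (\<lambda>y. norm (h x) * (B * exp (- ?c * (norm (y - x))\<^sup>2)))"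
            using gb by simp
        qed (use B B0 in \<open>auto simp: norm_mult abs_mult intro!: mult_left_mono mult_right_mono\<close>)
        also have "\<dots> = norm (h x) * (B * sqrt (pi / ?c) ^ DIM('a))"
          using g(2)[of x] by simp
        finally show ?thesis .
      qed
    qed
    have "(LINT x|lborel. LINT y|lborel. ?F (x, y)) = (LINT y|lborel. LINT x|lborel. ?F (x, y))"
      using lborel_Fubini(1,2)[OF int] by simp
    also have "\<dots> = (LINT y|lborel. \<psi> y * (LINT x|lborel. h x * exp (- ?c * (norm (y - x))\<^sup>2)))"
    proof (intro Bochner_Integration.integral_cong refl)
      fix y :: 'a
      have "?F (x, y) = \<psi> y * (h x * exp (- ?c * (norm (y - x))\<^sup>2))" for x
        by simp
      then show "(LINT x|lborel. ?F (x, y)) = \<psi> y * (LINT x|lborel. h x * exp (- ?c * (norm (y - x))\<^sup>2))"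
        by (simp only: integral_mult_right_zero)
    qed
    also have "\<dots> = 0" using gauss0[of ?c] s by simp
    finally have 0: "(LINT x|lborel. LINT y|lborel. ?F (x, y)) = 0" .
    have inner: "(LINT y|lborel. ?F (x, y)) = s ^ DIM('a) * (h x * ?J s x)" for x
    proof -
      let ?f = "\<lambda>y. \<psi> y * complex_of_real (exp (- ?c * (norm (y - x))\<^sup>2))"
      have "(LINT y|lborel. ?f y) = (LINT y|lborel. ?f (x + y))"
        by (rule lborel_integral_shift[symmetric]) measurable
      also have "\<dots> = s ^ DIM('a) *\<^sub>R (LINT y|lborel. ?f (x + s *\<^sub>R y))"
        using s by (subst lborel_integral_scale[where c=s]) auto
      also have "(LINT y|lborel. ?f (x + s *\<^sub>R y)) = ?J s x"
        using s by (simp add: power_mult_distrib)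
      finally show ?thesis by (simp add: scaleR_conv_of_real)
    qed
    have "s ^ DIM('a) * (LINT x|lborel. h x * ?J s x) = 0"
      using 0 unfolding inner by (simp only: integral_mult_right_zero)
    then show ?thesis using s by simp
  qed
  have Jlim: "(\<lambda>n. ?J (1 / Suc n) x) \<longlonglongrightarrow> (LINT y|lborel. \<psi> x * complex_of_real (exp (- (norm (y::'a))\<^sup>2)))" for x
  proof (rule integral_dominated_convergence[where w="\<lambda>y::'a. B * exp (- (norm y)\<^sup>2)"
        and s="\<lambda>n y. \<psi> (x + (1 / Suc n) *\<^sub>R y) * complex_of_real (exp (- (norm y)\<^sup>2))" 
        and f="\<lambda>y. \<psi> x * complex_of_real (exp (- (norm y)\<^sup>2))"])
    show "integrable lborel (\<lambda>y::'a. B * exp (- (norm y)\<^sup>2))" using gi by simp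
    show "AE y in lborel. (\<lambda>n. \<psi> (x + (1 / Suc n) *\<^sub>R y) * complex_of_real (exp (- (norm y)\<^sup>2)))
             \<longlonglongrightarrow> \<psi> x * complex_of_real (exp (- (norm y)\<^sup>2))"
    proof (rule AE_I2)
      fix y :: 'a
      have "(\<lambda>n. x + (1 / Suc n) *\<^sub>R y) \<longlonglongrightarrow> x + 0 *\<^sub>R y"
        using LIMSEQ_inverse_real_of_nat by (intro tendsto_intros) (simp add: inverse_eq_divide)
      moreover have "isCont \<psi> x" using \<psi> by (simp add: continuous_on_eq_continuous_at)
      ultimately have "(\<lambda>n. \<psi> (x + (1 / Suc n) *\<^sub>R y)) \<longlonglongrightarrow> \<psi> x"
        using isCont_tendsto_compose by fastforce
      then show "(\<lambda>n. \<psi> (x + (1 / Suc n) *\<^sub>R y) * complex_of_real (exp (- (norm y)\<^sup>2)))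
             \<longlonglongrightarrow> \<psi> x * complex_of_real (exp (- (norm y)\<^sup>2))"
        by (intro tendsto_intros)
    qed
  qed (use B in \<open>auto simp: norm_mult intro!: mult_right_mono\<close>)
  have gv: "(LINT y|lborel. complex_of_real (exp (- (norm (y::'a))\<^sup>2))) = complex_of_real (sqrt pi ^ DIM('a))"
    using gaussian_integral(2)[of 1, where 'a='a] by simp
  have Jb: "norm (?J s x) \<le> B * sqrt pi ^ DIM('a)" for s x
  proof -
    have "norm (?J s x) \<le> (LINT y|lborel. B * exp (- (norm (y::'a))\<^sup>2))"
      by (rule Bochner_Integration.integral_norm_bound_integral)
         (use gi B B0 in \<open>auto simp: norm_mult intro!: mult_right_mono
           Bochner_Integration.integrable_bound[OF integrable_mult_right[OF gi, of B]]\<close>)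
    also have "\<dots> = B * sqrt pi ^ DIM('a)"
      using gaussian_integral(2)[of 1, where 'a='a] by simp
    finally show ?thesis .
  qed
  have "(\<lambda>n. LINT x|lborel. h x * ?J (1 / Suc n) x) \<longlonglongrightarrow> (LINT x|lborel. h x * (\<psi> x * complex_of_real (sqrt pi ^ DIM('a))))"
  proof (rule integral_dominated_convergence[where w="\<lambda>x. norm (h x) * (B * sqrt pi ^ DIM('a))"])
    show "AE x in lborel. (\<lambda>n. h x * ?J (1 / Suc n) x) \<longlonglongrightarrow> h x * (\<psi> x * complex_of_real (sqrt pi ^ DIM('a)))"
      using Jlim gv by (intro AE_I2 tendsto_intros) simp
    show "AE x in lborel. norm (h x * ?J (1 / Suc n) x) \<le> norm (h x) * (B * sqrt pi ^ DIM('a))" for n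
      by (intro AE_I2) (auto simp only: norm_mult intro!: mult_left_mono Jb norm_ge_zero)
    show "integrable lborel (\<lambda>x. norm (h x) * (B * sqrt pi ^ DIM('a)))" using h by simp
  qed measurable
  moreover have "(LINT x|lborel. h x * ?J (1 / Suc n) x) = 0" for n
    by (rule J0) simp
  ultimately have "(LINT x|lborel. h x * (\<psi> x * complex_of_real (sqrt pi ^ DIM('a)))) = 0"
    by (simp add: LIMSEQ_const_iff)
  then have "(LINT x|lborel. h x * \<psi> x) * complex_of_real (sqrt pi ^ DIM('a)) = 0"
    by (simp only: mult.assoc[symmetric] integral_mult_left_zero)
  then show ?thesis by simp
qed

section \<open>Entire extensions and Cauchy estimates\<close>

text \<open>The hypothesis at parameter 0 is available at every base point, in particular at
  \<open>x + t *\<^sub>R v\<close>; shifting the parameter transports it along the line.\<close>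

lemma has_vector_derivative_line:
  fixes f :: "'a::real_normed_vector \<Rightarrow> 'b::real_normed_vector"
  assumes d: "\<And>x. ((\<lambda>s. f (x + s *\<^sub>R v)) has_vector_derivative f' x) (at 0)"
  shows "((\<lambda>s. f (x + s *\<^sub>R v)) has_vector_derivative f' (x + t *\<^sub>R v)) (at t within S)"
proof -
  let ?g = "\<lambda>s. f ((x + t *\<^sub>R v) + s *\<^sub>R v)"
  have "((\<lambda>s. s - t) has_vector_derivative (1 - 0)) (at t)"
    by (intro has_vector_derivative_diff has_vector_derivative_id has_vector_derivative_const)
  moreover have "(?g has_vector_derivative f' (x + t *\<^sub>R v)) (at (t - t))"
    unfolding diff_self by (rule d)
  ultimately have A: "(?g \<circ> (\<lambda>s. s - t) has_vector_derivative (1 - 0) *\<^sub>R f' (x + t *\<^sub>R v)) (at t)"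
    by (rule vector_diff_chain_at)
  have "(x + t *\<^sub>R v) + (s - t) *\<^sub>R v = x + s *\<^sub>R v" for s
    unfolding scaleR_left_diff_distrib by simp
  then have B: "?g \<circ> (\<lambda>s. s - t) = (\<lambda>s. f (x + s *\<^sub>R v))"
    by (simp only: o_def)
  show ?thesis
    using A unfolding B diff_zero scaleR_one by (rule has_vector_derivative_at_within)
qed

text \<open>The point \<open>x\<close> is joined to \<open>x + h\<close> by changing one coordinate
  at a time, and on each segment the mean value inequality compares the increment with the partial
  derivative at \<open>x\<close>. Induction over subsets of \<open>Basis\<close> spares an
  enumeration of the coordinates.\<close>

lemma continuous_partials_imp_has_derivative:
  fixes f :: "'a::euclidean_space \<Rightarrow> 'b::real_normed_vector"
  assumes d: "\<And>i x. i \<in> Basis \<Longrightarrow> ((\<lambda>s. f (x + s *\<^sub>R i)) has_vector_derivative D i x) (at 0)"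
    and cont: "\<And>i. i \<in> Basis \<Longrightarrow> continuous_on UNIV (D i)"
  shows "(f has_derivative (\<lambda>h. \<Sum>i\<in>Basis. (h \<bullet> i) *\<^sub>R D i x)) (at x)"
proof -
  have d': "((\<lambda>s. f (x + s *\<^sub>R i)) has_vector_derivative D i (x + t *\<^sub>R i)) (at t within S)"
    if "i \<in> Basis" for i x t S
    by (rule has_vector_derivative_line[OF d[OF that]])
  show ?thesis
    unfolding has_derivative_within_alt
  proof (intro conjI allI impI)
    show "bounded_linear (\<lambda>h. \<Sum>i\<in>Basis. (h \<bullet> i) *\<^sub>R D i x)"
      by (intro bounded_linear_intros)
    fix e :: real assume e: "e > 0"
    \<comment> \<open>Each coordinate costs 2e' for the variation of \<open>D j\<close> along its
      segment and e' for replacing the value at the start of the segment by that at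
      \<open>x\<close>; there are \<open>DIM('a)\<close> coordinates.\<close>
    define e' where "e' = e / (3 * DIM('a))"
    have e': "e' > 0" using e by (simp add: e'_def)
    have "\<forall>i\<in>Basis. \<forall>\<^sub>F y in at x. dist (D i y) (D i x) < e'"
      using cont e' by (auto simp: continuous_on_eq_continuous_at isCont_def intro!: tendstoD)
    then have "\<forall>\<^sub>F y in at x. \<forall>i\<in>Basis. dist (D i y) (D i x) < e'"
      by (simp add: eventually_ball_finite)
    then obtain \<delta> where \<delta>: "\<delta> > 0" "\<And>y i. y \<noteq> x \<Longrightarrow> dist y x < \<delta> \<Longrightarrow> i \<in> Basis \<Longrightarrow> dist (D i y) (D i x) < e'"
      unfolding eventually_at by auto
    then have \<delta>': "norm (D i y - D i x) \<le> e'" if "norm (y - x) < \<delta>" "i \<in> Basis" for y i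
      using that e' by (cases "y = x") (auto simp: dist_norm less_imp_le)
    show "\<exists>\<delta>>0. \<forall>y\<in>UNIV. norm (y - x) < \<delta> \<longrightarrow>
       norm (f y - f x - (\<Sum>i\<in>Basis. ((y - x) \<bullet> i) *\<^sub>R D i x)) \<le> e * norm (y - x)"
    proof (intro exI[of _ \<delta>] conjI ballI impI \<delta>(1))
      fix y assume "norm (y - x) < \<delta>"
      define h where "h = y - x"
      have h: "norm h < \<delta>" unfolding h_def by fact
      let ?P = "\<lambda>S. \<Sum>i\<in>S. (h \<bullet> i) *\<^sub>R i"
      have "norm (f (x + ?P S) - f x - (\<Sum>i\<in>S. (h \<bullet> i) *\<^sub>R D i x)) \<le> card S * (3 * e' * norm h)"
        if "S \<subseteq> Basis" for S
        using finite_subset[OF that finite_Basis] that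
      proof (induction S rule: finite_induct)
        case (insert j S)
        have j: "j \<in> Basis" using insert by auto
        \<comment> \<open>The intermediate points stay within distance \<open>norm h\<close> of
          \<open>x\<close>: every coordinate of their displacement is that of \<open>h\<close>, a
          smaller one in direction \<open>j\<close>, or 0.\<close>
        have le: "norm (?P S + s *\<^sub>R j) \<le> norm h" if "\<bar>s\<bar> \<le> \<bar>h \<bullet> j\<bar>" for s
        proof (rule norm_le_componentwise)
          fix b :: 'a assume b: "b \<in> Basis"
          have "?P S \<bullet> b = (\<Sum>i\<in>S. if i = b then h \<bullet> b else 0)"
            unfolding inner_sum_left using insert.prems b
            by (intro sum.cong refl) (auto simp: inner_Basis)
          then have "?P S \<bullet> b = (if b \<in> S then h \<bullet> b else 0)"
            using insert.hyps(1) by simp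
          then show "\<bar>(?P S + s *\<^sub>R j) \<bullet> b\<bar> \<le> \<bar>h \<bullet> b\<bar>"
            using that insert.hyps(2) j b by (auto simp: inner_add_left inner_Basis)
        qed
        let ?z = "x + ?P S" and ?S = "closed_segment 0 (h \<bullet> j)"
        have S: "\<bar>s\<bar> \<le> \<bar>h \<bullet> j\<bar>" if "s \<in> ?S" for s
          using that by (auto simp: closed_segment_eq_real_ivl split: if_splits)
        have near: "norm (D j (?z + s *\<^sub>R j) - D j x) \<le> e'" if "\<bar>s\<bar> \<le> \<bar>h \<bullet> j\<bar>" for s
          by (rule \<delta>'[OF _ j]) (use le[OF that] h in \<open>simp add: add.assoc\<close>)
        have "norm (f (?z + (h \<bullet> j) *\<^sub>R j) - f (?z + 0 *\<^sub>R j) - (h \<bullet> j - 0) *\<^sub>R D j (?z + 0 *\<^sub>R j))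
            \<le> norm (h \<bullet> j - 0) * (2 * e')"
        proof (rule vector_differentiable_bound_linearization[where S = ?S and f = "\<lambda>s. f (?z + s *\<^sub>R j)"
              and f' = "\<lambda>s. D j (?z + s *\<^sub>R j)"])
          show "((\<lambda>s. f (?z + s *\<^sub>R j)) has_vector_derivative D j (?z + s *\<^sub>R j)) (at s within ?S)" for s
            by (rule d'[OF j])
          fix s assume s: "s \<in> ?S"
          show "norm (D j (?z + s *\<^sub>R j) - D j (?z + 0 *\<^sub>R j)) \<le> 2 * e'"
            using near[OF S[OF s]] near[of 0]
              norm_triangle_ineq4[of "D j (?z + s *\<^sub>R j) - D j x" "D j (?z + 0 *\<^sub>R j) - D j x"]
            by simp
        qed auto
        then have A: "norm (f (?z + (h \<bullet> j) *\<^sub>R j) - f ?z - (h \<bullet> j) *\<^sub>R D j ?z) \<le> \<bar>h \<bullet> j\<bar> * (2 * e')"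
          by simp
        have "norm (D j ?z - D j x) \<le> e'"
          using near[of 0] by simp
        then have B: "norm ((h \<bullet> j) *\<^sub>R D j ?z - (h \<bullet> j) *\<^sub>R D j x) \<le> \<bar>h \<bullet> j\<bar> * e'"
          unfolding scaleR_right_diff_distrib[symmetric] norm_scaleR by (intro mult_left_mono) auto
        have "norm (f (?z + (h \<bullet> j) *\<^sub>R j) - f ?z - (h \<bullet> j) *\<^sub>R D j x) \<le> \<bar>h \<bullet> j\<bar> * (2 * e') + \<bar>h \<bullet> j\<bar> * e'"
          by (rule norm_diff_triangle_le[OF A B])
        also have "\<dots> = \<bar>h \<bullet> j\<bar> * (3 * e')" by simp
        also have "\<dots> \<le> norm h * (3 * e')"
          using Basis_le_norm[OF j] e' by (intro mult_right_mono) auto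
        finally have 1: "norm (f (?z + (h \<bullet> j) *\<^sub>R j) - f ?z - (h \<bullet> j) *\<^sub>R D j x) \<le> norm h * (3 * e')" .
        have eq: "f (x + ?P (insert j S)) - f x - (\<Sum>i\<in>insert j S. (h \<bullet> i) *\<^sub>R D i x)
          = (f ?z - f x - (\<Sum>i\<in>S. (h \<bullet> i) *\<^sub>R D i x))
           + (f (?z + (h \<bullet> j) *\<^sub>R j) - f ?z - (h \<bullet> j) *\<^sub>R D j x)"
        proof -
          have "x + ?P (insert j S) = ?z + (h \<bullet> j) *\<^sub>R j"
            unfolding sum.insert[OF insert.hyps, of "\<lambda>i. (h \<bullet> i) *\<^sub>R i"]
            by (subst add.commute[of "(h \<bullet> j) *\<^sub>R j"]) (rule add.assoc[symmetric])
          then have fP: "f (x + ?P (insert j S)) = f (?z + (h \<bullet> j) *\<^sub>R j)"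
            by (rule arg_cong[where f = f])
          show ?thesis
            unfolding fP sum.insert[OF insert.hyps, of "\<lambda>i. (h \<bullet> i) *\<^sub>R D i x"] by simp
        qed
        have "norm (f ?z - f x - (\<Sum>i\<in>S. (h \<bullet> i) *\<^sub>R D i x)) \<le> card S * (3 * e' * norm h)"
          using insert by auto
        then show ?case
          unfolding eq card_insert_disjoint[OF insert.hyps] using 1
          by (intro norm_triangle_le) (simp add: algebra_simps)
      qed simp
      from this[of Basis] show "norm (f y - f x - (\<Sum>i\<in>Basis. ((y - x) \<bullet> i) *\<^sub>R D i x)) \<le> e * norm (y - x)"
        by (simp add: euclidean_representation e'_def) (simp add: h_def)
    qed
  qed
qed

text \<open>\<open>\<Phi> X Y\<close> stands for the value of an entire function at \<open>X + \<i> Y\<close>.\<close>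

definition entire_ext :: "('a::euclidean_space \<Rightarrow> 'a \<Rightarrow> complex) \<Rightarrow> bool" where
  "entire_ext \<Phi> \<longleftrightarrow> continuous_on UNIV (\<lambda>p. \<Phi> (fst p) (snd p)) \<and>
     (\<forall>v\<in>Basis. \<forall>X Y. (\<lambda>w. \<Phi> (X + Re w *\<^sub>R v) (Y + Im w *\<^sub>R v)) holomorphic_on UNIV)"

definition cderiv :: "'a::euclidean_space \<Rightarrow> ('a \<Rightarrow> 'a \<Rightarrow> complex) \<Rightarrow> 'a \<Rightarrow> 'a \<Rightarrow> complex" where
  "cderiv v \<Phi> X Y = deriv (\<lambda>w. \<Phi> (X + Re w *\<^sub>R v) (Y + Im w *\<^sub>R v)) 0"

lemma entire_ext_has_field_derivative:
  assumes "entire_ext \<Phi>" "v \<in> Basis"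
  shows "((\<lambda>w. \<Phi> (X + Re w *\<^sub>R v) (Y + Im w *\<^sub>R v)) has_field_derivative
     cderiv v \<Phi> (X + Re w *\<^sub>R v) (Y + Im w *\<^sub>R v)) (at w)"
proof -
  let ?g = "\<lambda>X Y w. \<Phi> (X + Re w *\<^sub>R v) (Y + Im w *\<^sub>R v)"
  let ?X = "X + Re w *\<^sub>R v" and ?Y = "Y + Im w *\<^sub>R v"
  have "?g ?X ?Y holomorphic_on UNIV"
    using assms by (auto simp: entire_ext_def)
  then have "(?g ?X ?Y has_field_derivative deriv (?g ?X ?Y) 0) (at 0)"
    by (simp add: holomorphic_derivI)
  then have "(?g ?X ?Y has_field_derivative deriv (?g ?X ?Y) 0) (at (w - w))" by simp
  then have "((?g ?X ?Y \<circ> (\<lambda>z. z - w)) has_field_derivative deriv (?g ?X ?Y) 0 * 1) (at w)"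
    by (intro DERIV_chain) (auto intro!: derivative_eq_intros)
  moreover have "?g ?X ?Y \<circ> (\<lambda>z. z - w) = ?g X Y"
    by (auto simp: fun_eq_iff algebra_simps)
  ultimately show ?thesis by (simp add: cderiv_def)
qed

text \<open>Cauchy's formula on the unit circle writes the complex partial derivative as an integral
  of \<Phi> over a compact parameter interval, through which continuity and holomorphy in other
  directions can pass.\<close>

lemma cderiv_eq_integral:
  assumes "entire_ext \<Phi>" "v \<in> Basis"
  shows "cderiv v \<Phi> X Y = integral (cbox 0 1) (\<lambda>s.
     \<Phi> (X + Re (iexp (2 * pi * s)) *\<^sub>R v) (Y + Im (iexp (2 * pi * s)) *\<^sub>R v) * iexp (- (2 * pi * s)))"
proof -
  let ?g = "\<lambda>w. \<Phi> (X + Re w *\<^sub>R v) (Y + Im w *\<^sub>R v)"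
  have hol: "?g holomorphic_on UNIV"
    using assms by (auto simp: entire_ext_def)
  have "((\<lambda>u. ?g u / (u - 0)^2) has_contour_integral (2 * of_real pi * \<i>) * deriv ?g 0) (circlepath 0 1)"
    using Cauchy_has_contour_integral_higher_derivative_circlepath[of 0 1 ?g 0 1] hol
    by (auto intro: holomorphic_on_subset holomorphic_on_imp_continuous_on simp: numeral_2_eq_2)
  then have "((\<lambda>s. ?g (circlepath 0 1 s) / (circlepath 0 1 s)^2 * vector_derivative (circlepath 0 1) (at s within {0..1}))
       has_integral (2 * of_real pi * \<i>) * deriv ?g 0) {0..1}"
    by (simp add: has_contour_integral_def)
  then have "((\<lambda>s. (2 * of_real pi * \<i>) * (?g (iexp (2 * pi * s)) * iexp (- (2 * pi * s))))
       has_integral (2 * of_real pi * \<i>) * deriv ?g 0) {0..1}"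
  proof (rule has_integral_eq[rotated])
    fix s :: real assume "s \<in> {0..1}"
    then have "vector_derivative (circlepath 0 1) (at s within {0..1}) = 2 * pi * \<i> * exp (2 * of_real pi * \<i> * s)"
      using vector_derivative_circlepath01[of s 0 1] by simp
    then show "?g (circlepath 0 1 s) / (circlepath 0 1 s)^2 * vector_derivative (circlepath 0 1) (at s within {0..1})
      = (2 * of_real pi * \<i>) * (?g (iexp (2 * pi * s)) * iexp (- (2 * pi * s)))"
      by (simp add: circlepath exp_minus power2_eq_square field_simps)
  qed
  note int = has_integral_mult_right[OF this, of "inverse (2 * of_real pi * \<i>)"]
  have "inverse (2 * of_real pi * \<i>) * ((2 * of_real pi * \<i>) * z) = z" for z
    by (subst mult.assoc[symmetric], subst left_inverse) auto
  with int have "((\<lambda>s. ?g (iexp (2 * pi * s)) * iexp (- (2 * pi * s))) has_integral deriv ?g 0) {0..1}"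
    by (simp only:)
  then show ?thesis
    unfolding cderiv_def by (simp add: integral_unique cbox_interval)
qed

lemma entire_ext_continuous:
  assumes "entire_ext \<Phi>" "continuous_on S f" "continuous_on S g"
  shows "continuous_on S (\<lambda>x. \<Phi> (f x) (g x))"
proof -
  have "continuous_on S ((\<lambda>p. \<Phi> (fst p) (snd p)) \<circ> (\<lambda>x. (f x, g x)))"
    using assms unfolding entire_ext_def
    by (intro continuous_on_compose continuous_intros) (auto intro: continuous_on_subset)
  then show ?thesis by (simp add: o_def)
qed

text \<open>Joint continuity together with separate holomorphy survives differentiation, as in
  Osgood's lemma: the Cauchy integral is differentiated under the integral sign in direction
  \<open>u\<close>. This closure property lets all later estimates be iterated.\<close>

lemma entire_ext_cderiv:
  assumes \<Phi>: "entire_ext \<Phi>" and v: "v \<in> Basis"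
  shows "entire_ext (cderiv v \<Phi>)"
proof -
  let ?f = "\<lambda>v X Y (s::real). \<Phi> (X + Re (iexp (2 * pi * s)) *\<^sub>R v) (Y + Im (iexp (2 * pi * s)) *\<^sub>R v)
       * iexp (- (2 * pi * s))"
  have cont: "continuous_on UNIV (\<lambda>p. cderiv v \<Phi> (fst p) (snd p))" if "v \<in> Basis" for v
    unfolding cderiv_eq_integral[OF \<Phi> that]
    by (rule integral_continuous_on_param)
       (auto simp: split_def intro!: continuous_intros entire_ext_continuous[OF \<Phi>])
  show ?thesis
    unfolding entire_ext_def
  proof (intro conjI ballI allI cont[OF v])
    fix u X Y :: 'a assume u: "u \<in> Basis"
    have cont': "continuous_on S (\<lambda>x. cderiv u \<Phi> (f x) (g x))"
      if "continuous_on S f" "continuous_on S g" for S and f g :: "complex \<times> real \<Rightarrow> 'a"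
    proof -
      have "continuous_on S ((\<lambda>p. cderiv u \<Phi> (fst p) (snd p)) \<circ> (\<lambda>x. (f x, g x)))"
        using that cont[OF u] by (intro continuous_on_compose continuous_intros) (auto intro: continuous_on_subset)
      then show ?thesis by (simp add: o_def)
    qed
    have "(\<lambda>w. integral (cbox 0 1) (?f v (X + Re w *\<^sub>R u) (Y + Im w *\<^sub>R u))) field_differentiable at w within UNIV" for w
    proof (rule leibniz_rule_field_differentiable)
      fix w :: complex and s :: real
      let ?X = "X + Re (iexp (2 * pi * s)) *\<^sub>R v" and ?Y = "Y + Im (iexp (2 * pi * s)) *\<^sub>R v"
      have "((\<lambda>w. \<Phi> (?X + Re w *\<^sub>R u) (?Y + Im w *\<^sub>R u) * iexp (- (2 * pi * s))) has_field_derivative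
        cderiv u \<Phi> (?X + Re w *\<^sub>R u) (?Y + Im w *\<^sub>R u) * iexp (- (2 * pi * s))) (at w)"
        by (intro DERIV_cmult_right entire_ext_has_field_derivative[OF \<Phi> u])
      then show "((\<lambda>w. ?f v (X + Re w *\<^sub>R u) (Y + Im w *\<^sub>R u) s) has_field_derivative
        cderiv u \<Phi> (X + Re (iexp (2 * pi * s)) *\<^sub>R v + Re w *\<^sub>R u) (Y + Im (iexp (2 * pi * s)) *\<^sub>R v + Im w *\<^sub>R u)
         * iexp (- (2 * pi * s))) (at w within UNIV)"
        by (simp add: add_ac)
    next
      fix w :: complex
      show "?f v (X + Re w *\<^sub>R u) (Y + Im w *\<^sub>R u) integrable_on cbox 0 1"
        by (intro integrable_continuous continuous_intros entire_ext_continuous[OF \<Phi>])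
    next
      show "continuous_on (UNIV \<times> cbox 0 1) (\<lambda>(w, s). cderiv u \<Phi> (X + Re (iexp (2 * pi * s)) *\<^sub>R v + Re w *\<^sub>R u)
         (Y + Im (iexp (2 * pi * s)) *\<^sub>R v + Im w *\<^sub>R u) * iexp (- (2 * pi * s)))"
        unfolding split_def by (intro continuous_intros cont')
    qed auto
    then show "(\<lambda>w. cderiv v \<Phi> (X + Re w *\<^sub>R u) (Y + Im w *\<^sub>R u)) holomorphic_on UNIV"
      unfolding cderiv_eq_integral[OF \<Phi> v] by (simp add: holomorphic_on_def)
  qed
qed

lemma entire_ext_foldr_cderiv:
  "entire_ext \<Phi> \<Longrightarrow> vs \<in> lists Basis \<Longrightarrow> entire_ext (foldr cderiv vs \<Phi>)"
  by (induction vs) (auto intro: entire_ext_cderiv)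

text \<open>The one-variable Cauchy inequality on a circle of radius \<open>r\<close>. Real and
  imaginary part of a point of the circle are at most \<open>r\<close> in modulus, so the two
  displacements are bounded separately.\<close>

lemma norm_cderiv_le:
  assumes \<Phi>: "entire_ext \<Phi>" and v: "v \<in> Basis" and r: "r > 0"
    and B: "\<And>X' Y'. norm (X' - X) \<le> r \<Longrightarrow> norm (Y' - Y) \<le> r \<Longrightarrow> norm (\<Phi> X' Y') \<le> M"
  shows "norm (cderiv v \<Phi> X Y) \<le> M / r"
proof -
  let ?g = "\<lambda>w. \<Phi> (X + Re w *\<^sub>R v) (Y + Im w *\<^sub>R v)"
  have hol: "?g holomorphic_on UNIV"
    using assms by (auto simp: entire_ext_def)
  have "norm ((deriv ^^ 1) ?g 0) \<le> fact 1 * M / r ^ 1"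
  proof (rule Cauchy_inequality)
    show "norm (?g x) \<le> M" if "norm (0 - x) = r" for x
      by (rule B) (use that v in \<open>auto intro: order_trans[OF abs_Re_le_cmod] order_trans[OF abs_Im_le_cmod]\<close>)
  qed (use r hol in \<open>auto intro: holomorphic_on_subset holomorphic_on_imp_continuous_on\<close>)
  then show ?thesis by (simp add: cderiv_def)
qed

text \<open>Iterating the one-variable inequality treats repeated directions like distinct ones.
  Each circle adds \<open>r\<close> to both displacements, which is why \<Phi> must be controlled up
  to \<open>length vs * r\<close>.\<close>

lemma norm_foldr_cderiv_le:
  fixes r :: real
  assumes \<Phi>: "entire_ext \<Phi>" and r: "r > 0" and vs: "vs \<in> lists Basis"
    and B: "\<And>X' Y'. norm (X' - X) \<le> length vs * r \<Longrightarrow> norm (Y' - Y) \<le> length vs * r \<Longrightarrow> norm (\<Phi> X' Y') \<le> M"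
  shows "norm (foldr cderiv vs \<Phi> X Y) \<le> M / r ^ length vs"
  using vs B
proof (induction vs arbitrary: X Y rule: list.induct)
  case (Cons v vs)
  have v: "v \<in> Basis" "vs \<in> lists Basis" using Cons.prems(1) by auto
  have "norm (cderiv v (foldr cderiv vs \<Phi>) X Y) \<le> (M / r ^ length vs) / r"
  proof (rule norm_cderiv_le[OF _ _ r])
    show "entire_ext (foldr cderiv vs \<Phi>)" "v \<in> Basis"
      using v \<Phi> by (auto intro: entire_ext_foldr_cderiv)
    fix X' Y' assume near: "norm (X' - X) \<le> r" "norm (Y' - Y) \<le> r"
    show "norm (foldr cderiv vs \<Phi> X' Y') \<le> M / r ^ length vs"
    proof (rule Cons.IH)
      fix X'' Y'' assume "norm (X'' - X') \<le> length vs * r" "norm (Y'' - Y') \<le> length vs * r"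
      then show "norm (\<Phi> X'' Y'') \<le> M"
        using near norm_triangle_ineq[of "X'' - X'" "X' - X"] norm_triangle_ineq[of "Y'' - Y'" "Y' - Y"]
        by (intro Cons.prems(2)) (auto simp: algebra_simps)
    qed (use v in auto)
  qed
  then show ?case by (simp add: field_simps)
qed simp

lemma entire_ext_has_vector_derivative:
  assumes "entire_ext \<Phi>" "v \<in> Basis"
  shows "((\<lambda>s. \<Phi> (X + s *\<^sub>R v) 0) has_vector_derivative cderiv v \<Phi> X 0) (at 0)"
  using has_vector_derivative_real_field[of "\<lambda>w. \<Phi> (X + Re w *\<^sub>R v) (0 + Im w *\<^sub>R v)" "cderiv v \<Phi> X 0" 0 UNIV]
    entire_ext_has_field_derivative[OF assms, of X 0 0]
  by (simp add: o_def)

lemma entire_ext_partial_deriv: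
  assumes "entire_ext \<Phi>" "v \<in> Basis"
  shows "partial_deriv v (\<lambda>X. \<Phi> X 0) = (\<lambda>X. cderiv v \<Phi> X 0)"
  unfolding partial_deriv_def using entire_ext_has_vector_derivative[OF assms]
  by (auto intro: vector_derivative_at)

lemma entire_ext_foldr_partial_deriv:
  assumes "entire_ext \<Phi>" "vs \<in> lists Basis"
  shows "foldr partial_deriv vs (\<lambda>X. \<Phi> X 0) = (\<lambda>X. foldr cderiv vs \<Phi> X 0)"
  using assms(2)
  by (induction vs) (auto simp: entire_ext_partial_deriv entire_ext_foldr_cderiv[OF assms(1)])

text \<open>\<open>smooth\<close> asks for total differentiability of every iterated partial
  derivative. Each of them is again the restriction of an \<open>entire_ext\<close> function, so its
  own partial derivatives exist and are continuous.\<close>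

lemma entire_ext_smooth:
  assumes \<Phi>: "entire_ext \<Phi>"
  shows "smooth (\<lambda>X. \<Phi> X 0)"
  unfolding smooth_def
proof
  fix vs :: "'a list" assume vs: "vs \<in> lists Basis"
  let ?\<Psi> = "foldr cderiv vs \<Phi>"
  have \<Psi>: "entire_ext ?\<Psi>" using \<Phi> vs by (rule entire_ext_foldr_cderiv)
  have "((\<lambda>X. ?\<Psi> X 0) has_derivative (\<lambda>h. \<Sum>i\<in>Basis. (h \<bullet> i) *\<^sub>R cderiv i ?\<Psi> X 0)) (at X)" for X
  proof (rule continuous_partials_imp_has_derivative)
    fix i :: 'a assume i: "i \<in> Basis"
    show "((\<lambda>s. ?\<Psi> (X + s *\<^sub>R i) 0) has_vector_derivative cderiv i ?\<Psi> X 0) (at 0)" for X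
      by (rule entire_ext_has_vector_derivative[OF \<Psi> i])
    show "continuous_on UNIV (\<lambda>X. cderiv i ?\<Psi> X 0)"
      by (rule entire_ext_continuous[OF entire_ext_cderiv[OF \<Psi> i]]) (rule continuous_on_id continuous_on_const)+
  qed
  then show "foldr partial_deriv vs (\<lambda>X. \<Phi> X 0) differentiable_on UNIV"
    unfolding entire_ext_foldr_partial_deriv[OF \<Phi> vs] differentiable_on_def differentiable_def
    by blast
qed

section \<open>Multi-index derivatives and the Schwartz class\<close>

lemma basis_enum: "distinct (basis_enum :: 'a::euclidean_space list)" "set (basis_enum :: 'a list) = Basis"
proof -
  have "\<exists>vs::'a list. distinct vs \<and> set vs = Basis"
    using finite_distinct_list[OF finite_Basis] by blast
  from someI_ex[OF this] show "distinct (basis_enum :: 'a list)" "set (basis_enum :: 'a list) = Basis"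
    by (auto simp: basis_enum_def)
qed

text \<open>Flattening a multi-index into a list of directions makes \<open>smooth\<close> and the
  Cauchy estimates for lists applicable to \<open>mderiv\<close>.\<close>

lemma mderiv_eq_foldr:
  fixes f :: "'a::euclidean_space \<Rightarrow> complex"
  obtains vs where "mderiv \<alpha> f = foldr partial_deriv vs f" "vs \<in> lists Basis" "length vs = mindex_order \<alpha>"
proof
  let ?vs = "concat (map (\<lambda>i. replicate (\<alpha> i) i) basis_enum) :: 'a list"
  have rep: "foldr partial_deriv (replicate n i) g = (partial_deriv i ^^ n) g" for n i and g :: "'a \<Rightarrow> complex"
    by (induction n) auto
  have "foldr (\<lambda>i. partial_deriv i ^^ \<alpha> i) bs f = foldr partial_deriv (concat (map (\<lambda>i. replicate (\<alpha> i) i) bs)) f" for bs :: "'a list"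
    by (induction bs) (auto simp: rep)
  then show "mderiv \<alpha> f = foldr partial_deriv ?vs f"
    by (simp add: mderiv_def)
  show "?vs \<in> lists Basis"
    using basis_enum(2) by (auto simp: in_lists_conv_set)
  have "length ?vs = (\<Sum>i\<leftarrow>basis_enum. \<alpha> i)"
    by (simp add: length_concat o_def)
  also have "\<dots> = mindex_order \<alpha>"
    using basis_enum[where 'a='a] by (simp add: mindex_order_def sum_list_distinct_conv_sum_set)
  finally show "length ?vs = mindex_order \<alpha>" .
qed

text \<open>Decay on a strip around the real space passes to all derivatives by Cauchy estimates, so
  membership in \<open>schwartz\<close> reduces to bounds on the function itself.\<close>

lemma entire_ext_schwartz:
  fixes \<Phi> :: "'a::euclidean_space \<Rightarrow> 'a \<Rightarrow> complex"
  assumes \<Phi>: "entire_ext \<Phi>"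
    and b: "\<And>k::nat. \<exists>C. \<forall>X Y. norm Y \<le> 1 \<longrightarrow> jbracket X ^ k * norm (\<Phi> X Y) \<le> C"
  shows "(\<lambda>X. \<Phi> X 0) \<in> schwartz"
  unfolding schwartz_def
proof (intro CollectI conjI allI entire_ext_smooth[OF \<Phi>])
  fix k :: nat and \<alpha> :: "'a \<Rightarrow> nat"
  obtain vs :: "'a list" where vs: "mderiv \<alpha> (\<lambda>X. \<Phi> X 0) = foldr partial_deriv vs (\<lambda>X. \<Phi> X 0)"
    "vs \<in> lists Basis" by (rule mderiv_eq_foldr)
  \<comment> \<open>All circles together stay within distance 1, hence in the strip; the summand 1
    covers the empty list.\<close>
  define r where "r = 1 / (length vs + 1)"
  have r: "r > 0" "length vs * r \<le> 1" by (auto simp: r_def field_simps)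
  obtain C where C: "\<And>X Y. norm Y \<le> 1 \<Longrightarrow> jbracket X ^ k * norm (\<Phi> X Y) \<le> C"
    using b[of k] by blast
  have "jbracket X ^ k * norm (mderiv \<alpha> (\<lambda>X. \<Phi> X 0) X) \<le> 4 ^ k * C / r ^ length vs" for X
  proof -
    have "norm (foldr cderiv vs \<Phi> X 0) \<le> (4 ^ k * C / jbracket X ^ k) / r ^ length vs"
    proof (rule norm_foldr_cderiv_le[OF \<Phi> r(1) vs(2)])
      fix X' Y' :: 'a assume "norm (X' - X) \<le> length vs * r" "norm (Y' - 0) \<le> length vs * r"
      then have near: "norm (X' - X) \<le> 1" "norm Y' \<le> 1" using r by auto
      have "jbracket X \<le> 4 * jbracket X'"
        by (rule jbracket_le_near[OF near(1)])
      then have "jbracket X ^ k \<le> 4 ^ k * jbracket X' ^ k"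
        using power_mono[of "jbracket X" "4 * jbracket X'" k] jbracket_pos[of X]
        unfolding power_mult_distrib by simp
      then have "jbracket X ^ k * norm (\<Phi> X' Y') \<le> 4 ^ k * (jbracket X' ^ k * norm (\<Phi> X' Y'))"
        unfolding mult.assoc[symmetric] by (rule mult_right_mono[OF _ norm_ge_zero])
      also have "\<dots> \<le> 4 ^ k * C"
        using C[OF near(2)] by simp
      finally show "norm (\<Phi> X' Y') \<le> 4 ^ k * C / jbracket X ^ k"
        using jbracket_pos[of X] by (simp add: field_simps)
    qed
    then have "jbracket X ^ k * norm (foldr cderiv vs \<Phi> X 0)
        \<le> jbracket X ^ k * ((4 ^ k * C / jbracket X ^ k) / r ^ length vs)"
      using jbracket_pos[of X] by (intro mult_left_mono) auto
    also have "\<dots> = 4 ^ k * C / r ^ length vs"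
      using jbracket_pos[of X] by simp
    finally show ?thesis
      unfolding vs(1) entire_ext_foldr_partial_deriv[OF \<Phi> vs(2)] .
  qed
  moreover have "0 \<le> jbracket X ^ k * norm (mderiv \<alpha> (\<lambda>X. \<Phi> X 0) X)" for X
    using jbracket_pos[of X] by simp
  ultimately show "bounded (range (\<lambda>x. jbracket x ^ k * norm (mderiv \<alpha> (\<lambda>X. \<Phi> X 0) x)))"
    unfolding bounded_iff by (metis (no_types, lifting) rangeE real_norm_def abs_of_nonneg)
qed

section \<open>Rapidly decreasing functions and integration by parts\<close>

text \<open>Only the size is recorded. The class is therefore stable under products with functions
  of polynomial growth, while measurability is supplied separately.\<close>

definition rapidly_decreasing :: "('a::euclidean_space \<Rightarrow> complex) \<Rightarrow> bool" where
  "rapidly_decreasing f \<longleftrightarrow> (\<forall>n. \<exists>C\<ge>0. \<forall>x. norm (f x) \<le> C * inverse (jbracket x ^ n))"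

lemma rapidly_decreasingE:
  assumes "rapidly_decreasing f"
  obtains C where "C \<ge> 0" "\<And>x. norm (f x) \<le> C * inverse (jbracket x ^ n)"
  using assms by (auto simp: rapidly_decreasing_def)

lemma rapidly_decreasing_bounded:
  assumes "rapidly_decreasing f"
  obtains C where "C \<ge> 0" "\<And>x. norm (f x) \<le> C"
  using rapidly_decreasingE[OF assms, of 0] by auto

lemma rapidly_decreasing_mult:
  assumes f: "rapidly_decreasing f" and g: "\<And>x. norm (g x) \<le> B * jbracket x ^ N"
  shows "rapidly_decreasing (\<lambda>x. f x * g x)"
  unfolding rapidly_decreasing_def
proof
  fix n
  obtain C where C: "C \<ge> 0" "\<And>x. norm (f x) \<le> C * inverse (jbracket x ^ (n + N))"
    using rapidly_decreasingE[OF f] by blast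
  have B: "B \<ge> 0"
    using order_trans[OF norm_ge_zero g[of 0]] by (simp add: jbracket_def)
  have "norm (f x * g x) \<le> (C * B) * inverse (jbracket x ^ n)" for x
  proof -
    have "norm (f x * g x) \<le> (C * inverse (jbracket x ^ (n + N))) * (B * jbracket x ^ N)"
      unfolding norm_mult by (rule mult_mono[OF C(2) g]) (use C(1) jbracket_pos[of x] in auto)
    also have "\<dots> = (C * B) * inverse (jbracket x ^ n)"
      using jbracket_pos[of x] by (simp add: power_add field_simps)
    finally show ?thesis .
  qed
  then show "\<exists>C\<ge>0. \<forall>x. norm (f x * g x) \<le> C * inverse (jbracket x ^ n)"
    using C(1) B by (intro exI[of _ "C * B"]) auto
qed

lemma rapidly_decreasing_mult_bounded:
  assumes f: "rapidly_decreasing f" and g: "\<And>x. norm (g x) \<le> B"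
  shows "rapidly_decreasing (\<lambda>x. f x * g x)"
  using rapidly_decreasing_mult[OF f, of g B 0] g by simp

lemma rapidly_decreasing_add:
  assumes f: "rapidly_decreasing f" and g: "rapidly_decreasing g"
  shows "rapidly_decreasing (\<lambda>x. f x + g x)"
  unfolding rapidly_decreasing_def
proof
  fix n
  obtain C D where C: "C \<ge> 0" "\<And>x. norm (f x) \<le> C * inverse (jbracket x ^ n)"
     and D: "D \<ge> 0" "\<And>x. norm (g x) \<le> D * inverse (jbracket x ^ n)"
    using rapidly_decreasingE[OF f, of n] rapidly_decreasingE[OF g, of n] by metis
  have "norm (f x + g x) \<le> (C + D) * inverse (jbracket x ^ n)" for x
    unfolding distrib_right by (rule norm_triangle_mono[OF C(2) D(2)])
  then show "\<exists>C\<ge>0. \<forall>x. norm (f x + g x) \<le> C * inverse (jbracket x ^ n)"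
    using C(1) D(1) by (intro exI[of _ "C + D"]) auto
qed

lemma rapidly_decreasing_zero: "rapidly_decreasing (\<lambda>_. 0)"
  unfolding rapidly_decreasing_def by (auto intro!: exI[of _ 0])

lemma rapidly_decreasing_sum:
  "finite A \<Longrightarrow> (\<And>i. i \<in> A \<Longrightarrow> rapidly_decreasing (f i)) \<Longrightarrow> rapidly_decreasing (\<lambda>x. \<Sum>i\<in>A. f i x)"
  by (induction A rule: finite_induct) (auto intro: rapidly_decreasing_zero rapidly_decreasing_add)

lemma rapidly_decreasing_integrable:
  fixes f :: "'a::euclidean_space \<Rightarrow> complex"
  assumes f: "rapidly_decreasing f" and [measurable]: "f \<in> borel_measurable borel"
  shows "integrable lborel f"
proof -
  obtain C where C: "C \<ge> 0" "\<And>x. norm (f x) \<le> C * inverse (jbracket x ^ (2 * DIM('a)))"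
    using rapidly_decreasingE[OF f] by blast
  have "integrable lborel (\<lambda>x::'a. C * inverse (jbracket x ^ (2 * DIM('a))))"
    by (intro integrable_mult_right integrable_jbracket) auto
  then show ?thesis
    by (rule Bochner_Integration.integrable_bound) (use C jbracket_pos in \<open>auto intro!: AE_I2 simp: less_imp_le\<close>)
qed

lemma schwartz_mderiv_rapidly_decreasing:
  assumes "f \<in> schwartz"
  shows "rapidly_decreasing (mderiv \<alpha> f)"
  unfolding rapidly_decreasing_def
proof
  fix n
  have "bounded (range (\<lambda>x. jbracket x ^ n * norm (mderiv \<alpha> f x)))"
    using assms by (auto simp: schwartz_def)
  then obtain C where C: "\<And>x. norm (jbracket x ^ n * norm (mderiv \<alpha> f x)) \<le> C"
    unfolding bounded_iff by blast
  have "norm (mderiv \<alpha> f x) \<le> C * inverse (jbracket x ^ n)" for x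
    using C[of x] jbracket_pos[of x] by (simp add: abs_mult field_simps)
  moreover have "C \<ge> 0" using order_trans[OF norm_ge_zero C] .
  ultimately show "\<exists>C\<ge>0. \<forall>x. norm (mderiv \<alpha> f x) \<le> C * inverse (jbracket x ^ n)" by blast
qed

text \<open>The Schwartz seminorms are stated for \<open>mderiv\<close>, which differentiates in a
  fixed order of directions. Powers of a single partial derivative are instances that do not depend
  on this order, and they are all that the Laplacian requires.\<close>

lemma mderiv_single:
  assumes "i \<in> Basis"
  shows "mderiv (\<lambda>j. if j = i then n else 0) f = (partial_deriv i ^^ n) f"
proof -
  have "foldr (\<lambda>j. partial_deriv j ^^ (if j = i then n else 0)) bs f
      = (if i \<in> set bs then (partial_deriv i ^^ n) f else f)" if "distinct bs" for bs
    using that by (induction bs) auto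
  from this[OF basis_enum(1)] show ?thesis
    using assms by (simp add: mderiv_def basis_enum(2))
qed

lemma mderiv_0: "mderiv (\<lambda>_. 0) f = f"
proof -
  have "foldr (\<lambda>j. partial_deriv j ^^ 0) bs f = f" for bs
    by (induction bs) auto
  then show ?thesis by (simp add: mderiv_def)
qed

lemma smooth_foldr_differentiable:
  "smooth f \<Longrightarrow> vs \<in> lists Basis \<Longrightarrow> foldr partial_deriv vs f differentiable_on UNIV"
  by (auto simp: smooth_def)

lemma differentiable_partial_deriv:
  assumes "f differentiable_on UNIV"
  shows "((\<lambda>s. f (x + s *\<^sub>R v)) has_vector_derivative partial_deriv v f x) (at 0)"
proof -
  have "f differentiable (at (x + 0 *\<^sub>R v))"
    using assms by (auto simp: differentiable_on_def)
  then have "(f \<circ> (\<lambda>s. x + s *\<^sub>R v)) differentiable (at 0)"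
    by (intro differentiable_chain_at) (auto intro!: derivative_intros)
  then show ?thesis
    by (simp add: partial_deriv_def vector_derivative_works o_def)
qed

lemma
  fixes f :: "'a::euclidean_space \<Rightarrow> complex"
  assumes f: "f \<in> schwartz"
  shows schwartz_continuous: "continuous_on UNIV f"
    and schwartz_measurable: "f \<in> borel_measurable borel"
    and schwartz_rapid: "rapidly_decreasing f"
    and schwartz_integrable: "integrable lborel f"
proof -
  have sm: "smooth f" using f by (simp add: schwartz_def)
  show "continuous_on UNIV f"
    using smooth_foldr_differentiable[OF sm, of "[]"] by (simp add: differentiable_imp_continuous_on)
  then show "f \<in> borel_measurable borel" by (rule borel_measurable_continuous_onI)
  moreover show "rapidly_decreasing f"
    using schwartz_mderiv_rapidly_decreasing[OF f, of "\<lambda>_. 0"] by (simp add: mderiv_0)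
  ultimately show "integrable lborel f"
    by (intro rapidly_decreasing_integrable)
qed

text \<open>Translation invariance makes the integral of every difference quotient vanish.\<close>

lemma integral_partial_deriv_eq_0:
  fixes h h' :: "'a::euclidean_space \<Rightarrow> complex"
  assumes d: "\<And>x. ((\<lambda>s. h (x + s *\<^sub>R i)) has_vector_derivative h' x) (at 0)"
    and h: "integrable lborel h"
    and b: "\<And>x. norm (h' x) \<le> C * inverse (jbracket x ^ (2 * DIM('a)))"
    and i: "norm i = 1"
  shows "(LINT x|lborel. h' x) = 0"
proof -
  let ?q = "\<lambda>n x. Suc n *\<^sub>R (h (x + (1 / Suc n) *\<^sub>R i) - h x)"
  \<comment> \<open>The power of 4 is the cost of comparing \<open>jbracket\<close> at points of
    distance at most 1. The factor 3 is 2 from the linearization error plus 1 from the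
    derivative.\<close>
  let ?w = "\<lambda>x::'a. 3 * (4 ^ (2 * DIM('a)) * (C * inverse (jbracket x ^ (2 * DIM('a)))))"
  have [measurable]: "h \<in> borel_measurable borel" using h by (auto dest: borel_measurable_integrable)
  have C: "C \<ge> 0"
    using order_trans[OF norm_ge_zero b[of 0]] by (simp add: jbracket_def)
  have lim: "(\<lambda>n. ?q n x) \<longlonglongrightarrow> h' x" for x
  proof -
    have "((\<lambda>s. (1 / norm (s - 0)) *\<^sub>R (h (x + s *\<^sub>R i) - (h (x + 0 *\<^sub>R i) + (s - 0) *\<^sub>R h' x))) \<longlongrightarrow> 0) (at 0)"
      using d[of x] unfolding has_vector_derivative_def has_derivative_within by blast
    moreover have "filterlim (\<lambda>n. 1 / real (Suc n)) (at 0) sequentially"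
      using LIMSEQ_inverse_real_of_nat by (intro filterlim_atI) (auto simp: inverse_eq_divide)
    ultimately have "(\<lambda>n. (1 / norm (1 / real (Suc n) - 0)) *\<^sub>R (h (x + (1 / Suc n) *\<^sub>R i)
        - (h (x + 0 *\<^sub>R i) + (1 / Suc n - 0) *\<^sub>R h' x))) \<longlonglongrightarrow> 0"
      by (rule filterlim_compose)
    also have "(\<lambda>n. (1 / norm (1 / real (Suc n) - 0)) *\<^sub>R (h (x + (1 / Suc n) *\<^sub>R i)
        - (h (x + 0 *\<^sub>R i) + (1 / Suc n - 0) *\<^sub>R h' x))) = (\<lambda>n. ?q n x - h' x)"
    proof
      fix n
      have *: "(1 / norm (1 / a - 0)) *\<^sub>R (y - (z + (1 / a - 0) *\<^sub>R w)) = a *\<^sub>R (y - z) - w"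
        if "a > 0" for a :: real and y z w :: complex
        using that by (simp add: scaleR_right_diff_distrib scaleR_right_distrib)
      show "(1 / norm (1 / real (Suc n) - 0)) *\<^sub>R (h (x + (1 / Suc n) *\<^sub>R i)
        - (h (x + 0 *\<^sub>R i) + (1 / Suc n - 0) *\<^sub>R h' x)) = ?q n x - h' x"
        by (subst *) auto
    qed
    finally show ?thesis
      by (simp only: LIM_zero_iff)
  qed
  have lim': "AE x in lborel. (\<lambda>n. ?q n x) \<longlonglongrightarrow> h' x"
    using lim by simp
  have meas: "h' \<in> borel_measurable borel"
    by (rule borel_measurable_LIMSEQ_metric[OF _ lim]) measurable
  have bound: "norm (?q n x) \<le> ?w x" for n x
  proof -
    let ?s = "1 / real (Suc n)" and ?M = "4 ^ (2 * DIM('a)) * (C * inverse (jbracket x ^ (2 * DIM('a))))"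
    have M: "norm (h' (x + t *\<^sub>R i)) \<le> ?M" if "t \<in> {0..?s}" for t
    proof -
      have "t \<le> 1" using that by (auto intro: order_trans)
      then have "jbracket x \<le> 4 * jbracket (x + t *\<^sub>R i)"
        using that i by (intro jbracket_le_near) auto
      then have "jbracket x ^ (2 * DIM('a)) \<le> (4 * jbracket (x + t *\<^sub>R i)) ^ (2 * DIM('a))"
        using jbracket_pos[of x] by (intro power_mono) auto
      then have "inverse (jbracket (x + t *\<^sub>R i) ^ (2 * DIM('a))) \<le> 4 ^ (2 * DIM('a)) * inverse (jbracket x ^ (2 * DIM('a)))"
        using jbracket_pos[of x] jbracket_pos[of "x + t *\<^sub>R i"]
        unfolding power_mult_distrib by (simp add: field_simps)
      then have "C * inverse (jbracket (x + t *\<^sub>R i) ^ (2 * DIM('a))) \<le> C * (4 ^ (2 * DIM('a)) * inverse (jbracket x ^ (2 * DIM('a))))"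
        using C by (rule mult_left_mono)
      with b[of "x + t *\<^sub>R i"] show ?thesis by (simp add: mult_ac)
    qed
    have "norm (h (x + ?s *\<^sub>R i) - h (x + 0 *\<^sub>R i) - (?s - 0) *\<^sub>R h' (x + 0 *\<^sub>R i)) \<le> norm (?s - 0) * (2 * ?M)"
    proof (rule vector_differentiable_bound_linearization[where S = "{0..?s}" and f = "\<lambda>s. h (x + s *\<^sub>R i)"
            and f' = "\<lambda>s. h' (x + s *\<^sub>R i)"])
      show "((\<lambda>s. h (x + s *\<^sub>R i)) has_vector_derivative h' (x + t *\<^sub>R i)) (at t within {0..?s})" for t
        by (rule has_vector_derivative_line[OF d])
      show "closed_segment 0 ?s \<subseteq> {0..?s}"
        by (simp add: closed_segment_eq_real_ivl)
      show "norm (h' (x + t *\<^sub>R i) - h' (x + 0 *\<^sub>R i)) \<le> 2 * ?M" if "t \<in> {0..?s}" for t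
        using norm_triangle_ineq4[of "h' (x + t *\<^sub>R i)" "h' (x + 0 *\<^sub>R i)"] M[OF that] M[of 0]
        by simp
    qed simp
    then have "norm (h (x + ?s *\<^sub>R i) - h x - ?s *\<^sub>R h' x) \<le> ?s * (2 * ?M)"
      by simp
    moreover have "norm (?s *\<^sub>R h' x) \<le> ?s * ?M"
      using M[of 0] unfolding norm_scaleR by (intro mult_mono) auto
    moreover have "norm (h (x + ?s *\<^sub>R i) - h x) \<le> norm (h (x + ?s *\<^sub>R i) - h x - ?s *\<^sub>R h' x) + norm (?s *\<^sub>R h' x)"
      using norm_triangle_ineq[of "h (x + ?s *\<^sub>R i) - h x - ?s *\<^sub>R h' x" "?s *\<^sub>R h' x"] by simp
    ultimately have "norm (h (x + ?s *\<^sub>R i) - h x) \<le> ?s * (2 * ?M) + ?s * ?M"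
      by (blast intro: order_trans add_mono)
    also have "\<dots> = ?s * (3 * ?M)"
      by (simp only: distrib_left[symmetric]) simp
    finally have "norm (h (x + ?s *\<^sub>R i) - h x) \<le> ?s * (3 * ?M)" .
    then have "Suc n * norm (h (x + ?s *\<^sub>R i) - h x) \<le> Suc n * (?s * (3 * ?M))"
      by (intro mult_left_mono) auto
    then show ?thesis by simp
  qed
  have intw: "integrable lborel ?w"
    by (intro integrable_mult_right integrable_jbracket) auto
  have "(\<lambda>n. LINT x|lborel. ?q n x) \<longlonglongrightarrow> (LINT x|lborel. h' x)"
    by (rule integral_dominated_convergence[OF _ _ intw lim'])
       (use meas bound in auto)
  moreover have "(LINT x|lborel. ?q n x) = 0" for n
  proof -
    have "integrable lborel (\<lambda>x. h (x + (1 / Suc n) *\<^sub>R i))"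
      using lborel_integrable_shift[OF h, of "(1 / Suc n) *\<^sub>R i"] by (simp add: add.commute)
    moreover have "(LINT x|lborel. h (x + (1 / Suc n) *\<^sub>R i)) = (LINT x|lborel. h x)"
      using lborel_integral_shift[of h "(1 / Suc n) *\<^sub>R i"] by (simp add: add.commute)
    ultimately show ?thesis
      using h by (simp add: Bochner_Integration.integral_diff)
  qed
  ultimately show ?thesis
    by (simp add: LIMSEQ_const_iff)
qed

text \<open>The product rule and \<open>integral_partial_deriv_eq_0\<close>. Decay is imposed on the
  three products instead of on the factors, so that one factor may be merely bounded, such as an
  exponential, or grow.\<close>

lemma integral_by_parts_partial:
  fixes f g f' g' :: "'a::euclidean_space \<Rightarrow> complex"
  assumes df: "\<And>x. ((\<lambda>s. f (x + s *\<^sub>R i)) has_vector_derivative f' x) (at 0)"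
    and dg: "\<And>x. ((\<lambda>s. g (x + s *\<^sub>R i)) has_vector_derivative g' x) (at 0)"
    and i: "norm i = 1"
    and meas: "f \<in> borel_measurable borel" "g \<in> borel_measurable borel"
       "f' \<in> borel_measurable borel" "g' \<in> borel_measurable borel"
    and b: "\<And>x. norm (f x * g x) \<le> C * inverse (jbracket x ^ (2 * DIM('a)))"
      "\<And>x. norm (f' x * g x) \<le> C * inverse (jbracket x ^ (2 * DIM('a)))"
      "\<And>x. norm (f x * g' x) \<le> C * inverse (jbracket x ^ (2 * DIM('a)))"
  shows "integrable lborel (\<lambda>x. f' x * g x)" "integrable lborel (\<lambda>x. f x * g' x)"
    and "(LINT x|lborel. f' x * g x) = - (LINT x|lborel. f x * g' x)"
proof -
  note [measurable] = meas
  have C: "C \<ge> 0"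
    using order_trans[OF norm_ge_zero b(1)[of 0]] by (simp add: jbracket_def)
  have int: "integrable lborel h" if "h \<in> borel_measurable borel"
    "\<And>x. norm (h x) \<le> C * inverse (jbracket x ^ (2 * DIM('a)))" for h :: "'a \<Rightarrow> complex"
  proof (rule Bochner_Integration.integrable_bound)
    show "integrable lborel (\<lambda>x::'a. C * inverse (jbracket x ^ (2 * DIM('a))))"
      by (intro integrable_mult_right integrable_jbracket) auto
    show "AE x in lborel. norm (h x) \<le> norm (C * inverse (jbracket x ^ (2 * DIM('a))))"
      using that(2) C jbracket_pos by (intro AE_I2) (auto simp: less_imp_le)
  qed (use that in simp)
  show 1: "integrable lborel (\<lambda>x. f' x * g x)" by (rule int[OF _ b(2)]) measurable
  show 2: "integrable lborel (\<lambda>x. f x * g' x)" by (rule int[OF _ b(3)]) measurable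
  have "(LINT x|lborel. f x * g' x + f' x * g x) = 0"
  proof (rule integral_partial_deriv_eq_0[of "\<lambda>x. f x * g x" i, OF _ _ _ i])
    show "((\<lambda>s. f (x + s *\<^sub>R i) * g (x + s *\<^sub>R i)) has_vector_derivative f x * g' x + f' x * g x) (at 0)" for x
      using has_vector_derivative_mult[OF df[of x] dg[of x]] by simp
    show "integrable lborel (\<lambda>x. f x * g x)" by (rule int[OF _ b(1)]) measurable
    show "norm (f x * g' x + f' x * g x) \<le> (2 * C) * inverse (jbracket x ^ (2 * DIM('a)))" for x
      using norm_triangle_mono[OF b(3)[of x] b(2)[of x]] by simp
  qed
  then show "(LINT x|lborel. f' x * g x) = - (LINT x|lborel. f x * g' x)"
    using 1 2 by (simp add: eq_neg_iff_add_eq_0 add.commute)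
qed

lemma integral_by_parts_rapid:
  fixes f g f' g' :: "'a::euclidean_space \<Rightarrow> complex"
  assumes df: "\<And>x. ((\<lambda>s. f (x + s *\<^sub>R i)) has_vector_derivative f' x) (at 0)"
    and dg: "\<And>x. ((\<lambda>s. g (x + s *\<^sub>R i)) has_vector_derivative g' x) (at 0)"
    and i: "norm i = 1"
    and meas: "f \<in> borel_measurable borel" "g \<in> borel_measurable borel"
       "f' \<in> borel_measurable borel" "g' \<in> borel_measurable borel"
    and b: "rapidly_decreasing (\<lambda>x. f x * g x)" "rapidly_decreasing (\<lambda>x. f' x * g x)"
      "rapidly_decreasing (\<lambda>x. f x * g' x)"
  shows "(LINT x|lborel. f' x * g x) = - (LINT x|lborel. f x * g' x)"
proof -
  let ?I = "\<lambda>x::'a. inverse (jbracket x ^ (2 * DIM('a)))"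
  obtain A where A: "\<And>x. norm (f x * g x) \<le> A * ?I x" using rapidly_decreasingE[OF b(1)] by blast
  obtain B where B: "\<And>x. norm (f' x * g x) \<le> B * ?I x" using rapidly_decreasingE[OF b(2)] by blast
  obtain C where C: "\<And>x. norm (f x * g' x) \<le> C * ?I x" using rapidly_decreasingE[OF b(3)] by blast
  let ?M = "max A (max B C)"
  have I: "?I x \<ge> 0" for x using jbracket_pos[of x] by simp
  have "A * ?I x \<le> ?M * ?I x" "B * ?I x \<le> ?M * ?I x" "C * ?I x \<le> ?M * ?I x" for x
    using I by (intro mult_right_mono; simp)+
  then show ?thesis
    by (intro integral_by_parts_partial(3)[OF df dg i meas, of ?M] order_trans[OF A] order_trans[OF B] order_trans[OF C])
qed

section \<open>Gaussian wave packets\<close>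

text \<open>Up to the constant exp (|m|^2 / 2) this is a Gaussian of unit width centred at
  \<open>m\<close> with frequency \<open>k\<close>. The inverse of H is identified with the packets
  \<open>m = 0\<close>; other centres enter when symbols are tested.\<close>

definition gwave :: "'a::euclidean_space \<Rightarrow> 'a \<Rightarrow> 'a \<Rightarrow> complex" where
  "gwave m k x = complex_of_real (exp (m \<bullet> x - (norm x)\<^sup>2 / 2)) * iexp (k \<bullet> x)"

text \<open>The packet is the restriction of exp (m . Z + i k . Z - Z . Z / 2) with Z = X + i Y;
  \<open>?E\<close> collects the real and imaginary parts of that exponent. On a strip, - |X|^2 / 2
  beats the linear terms and the weight.\<close>

lemma gwave_schwartz: "gwave m k \<in> schwartz"
proof -
  let ?E = "\<lambda>X Y. complex_of_real (m \<bullet> X - k \<bullet> Y - (X \<bullet> X - Y \<bullet> Y) / 2) + \<i> * complex_of_real (m \<bullet> Y + k \<bullet> X - X \<bullet> Y)"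
  let ?\<Phi> = "\<lambda>X Y. exp (?E X Y)"
  have "entire_ext ?\<Phi>"
    unfolding entire_ext_def
  proof (intro conjI ballI allI)
    show "continuous_on UNIV (\<lambda>p. ?\<Phi> (fst p) (snd p))"
      by (intro continuous_intros) auto
    fix v X Y :: 'a
    define c0 c1 c2 where "c0 = ?E X Y" and "c1 = Complex (m \<bullet> v - X \<bullet> v) (k \<bullet> v - Y \<bullet> v)"
      and "c2 = complex_of_real (v \<bullet> v / 2)"
    have "?E (X + Re w *\<^sub>R v) (Y + Im w *\<^sub>R v) = c0 + c1 * w - c2 * w\<^sup>2" for w
      by (simp add: c0_def c1_def c2_def complex_eq_iff power2_eq_square inner_add_left inner_add_right
        inner_commute algebra_simps add_divide_distrib diff_divide_distrib)
    then have eq: "(\<lambda>w. ?\<Phi> (X + Re w *\<^sub>R v) (Y + Im w *\<^sub>R v)) = (\<lambda>w. exp (c0 + c1 * w - c2 * w\<^sup>2))"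
      by simp
    show "(\<lambda>w. ?\<Phi> (X + Re w *\<^sub>R v) (Y + Im w *\<^sub>R v)) holomorphic_on UNIV"
      unfolding eq by (intro holomorphic_intros)
  qed
  moreover have "\<exists>C. \<forall>X Y. norm Y \<le> 1 \<longrightarrow> jbracket X ^ n * norm (?\<Phi> X Y) \<le> C" for n
  proof (intro exI allI impI)
    fix X Y :: 'a assume Y: "norm Y \<le> 1"
    define r where "r = norm X"
    have "jbracket X ^ n \<le> exp (1 + r) ^ n"
    proof (rule power_mono)
      have "jbracket X \<le> 1 + r"
        by (rule power2_le_imp_le) (auto simp: jbracket_sq power2_sum r_def)
      also have "\<dots> \<le> exp (1 + r)"
        using exp_ge_add_one_self[of "1 + r"] by linarith
      finally show "jbracket X \<le> exp (1 + r)" .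
    qed (simp add: less_imp_le jbracket_pos)
    then have 1: "jbracket X ^ n \<le> exp (n * (1 + r))"
      by (simp add: exp_of_nat_mult[symmetric])
    have "m \<bullet> X \<le> norm m * r" "- (k \<bullet> Y) \<le> norm k * 1" "Y \<bullet> Y \<le> 1"
      using norm_cauchy_schwarz[of m X] norm_cauchy_schwarz[of "-k" Y] Y mult_left_mono[OF Y norm_ge_zero[of k]]
        power_le_one[OF norm_ge_zero Y, of 2]
      by (auto simp: r_def power2_norm_eq_inner[symmetric])
    then have "m \<bullet> X - k \<bullet> Y - (X \<bullet> X - Y \<bullet> Y) / 2 \<le> norm m * r + norm k + 1 - r\<^sup>2 / 2"
      by (simp add: r_def power2_norm_eq_inner[symmetric] diff_divide_distrib)
    then have 2: "norm (?\<Phi> X Y) \<le> exp (norm m * r + norm k + 1 - r\<^sup>2 / 2)"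
      by simp
    have "jbracket X ^ n * norm (?\<Phi> X Y) \<le> exp (n * (1 + r)) * exp (norm m * r + norm k + 1 - r\<^sup>2 / 2)"
      by (rule mult_mono[OF 1 2]) auto
    also have "\<dots> = exp (n * (1 + r) + (norm m * r + norm k + 1 - r\<^sup>2 / 2))"
      by (simp only: exp_add)
    \<comment> \<open>Completion of the square in \<open>r\<close>, whose linear coefficient is
      \<open>n + norm m\<close>.\<close>
    also have "\<dots> \<le> exp (n + norm k + 1 + (n + norm m)\<^sup>2 / 2)"
      using zero_le_power2[of "r - (n + norm m)"]
      by (simp add: power2_diff algebra_simps add_divide_distrib)
    finally show "jbracket X ^ n * norm (?\<Phi> X Y) \<le> exp (n + norm k + 1 + (n + norm m)\<^sup>2 / 2)" .
  qed
  ultimately have "(\<lambda>X. ?\<Phi> X 0) \<in> schwartz"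
    by (rule entire_ext_schwartz)
  moreover have "(\<lambda>X. ?\<Phi> X 0) = gwave m k"
    by (auto simp: gwave_def fun_eq_iff exp_add power2_norm_eq_inner simp flip: exp_of_real)
  ultimately show ?thesis by simp
qed

text \<open>The factor by which H acts on \<open>gwave 0 k\<close>: the potential cancels the
  quadratic part of the Laplacian, and a polynomial of degree at most one remains.\<close>

definition gwave_pol :: "'a::euclidean_space \<Rightarrow> 'a \<Rightarrow> complex" where
  "gwave_pol k x = complex_of_real (DIM('a) + (norm k)\<^sup>2) + 2 * \<i> * complex_of_real (k \<bullet> x)"

lemma gwave_measurable [measurable]: "gwave m k \<in> borel_measurable borel"
  by (rule schwartz_measurable[OF gwave_schwartz])

lemma gwave_pol_measurable [measurable]: "gwave_pol k \<in> borel_measurable borel"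
  unfolding gwave_pol_def by measurable

lemma norm_gwave_0: "norm (gwave 0 k x) = exp (- (norm x)\<^sup>2 / 2)"
  by (simp add: gwave_def norm_mult)

lemma gwave_has_vector_derivative:
  "((\<lambda>s. gwave 0 k (x + s *\<^sub>R i)) has_vector_derivative
     (complex_of_real (- (x \<bullet> i)) + \<i> * complex_of_real (k \<bullet> i)) * gwave 0 k x) (at 0)"
proof -
  let ?E = "\<lambda>s. complex_of_real (- (x \<bullet> x + 2 * s * (x \<bullet> i) + s\<^sup>2 * (i \<bullet> i)) / 2) + \<i> * complex_of_real (k \<bullet> x + s * (k \<bullet> i))"
  have eq: "gwave 0 k (x + s *\<^sub>R i) = (exp \<circ> ?E) s" for s
  proof -
    have "- (norm (x + s *\<^sub>R i))\<^sup>2 / 2 = - (x \<bullet> x + 2 * s * (x \<bullet> i) + s\<^sup>2 * (i \<bullet> i)) / 2"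
      unfolding power2_norm_eq_inner by (simp add: inner_add_left inner_add_right inner_commute power2_eq_square algebra_simps)
    moreover have "gwave 0 k y = exp (complex_of_real (- (norm y)\<^sup>2 / 2) + \<i> * complex_of_real (k \<bullet> y))" for y
      unfolding gwave_def exp_add exp_of_real by simp
    ultimately show ?thesis
      by (simp only: o_def inner_add_right inner_scaleR_right)
  qed
  have "(?E has_vector_derivative (complex_of_real (- (x \<bullet> i)) + \<i> * complex_of_real (k \<bullet> i))) (at 0)"
  proof (intro has_vector_derivative_add has_vector_derivative_mult_right has_vector_derivative_of_real)
    show "((\<lambda>s. - (x \<bullet> x + 2 * s * (x \<bullet> i) + s\<^sup>2 * (i \<bullet> i)) / 2) has_real_derivative - (x \<bullet> i)) (at 0)"
      by (auto intro!: derivative_eq_intros)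
    show "((\<lambda>s. k \<bullet> x + s * (k \<bullet> i)) has_real_derivative k \<bullet> i) (at 0)"
      by (auto intro!: derivative_eq_intros)
  qed
  then have "((exp \<circ> ?E) has_vector_derivative (complex_of_real (- (x \<bullet> i)) + \<i> * complex_of_real (k \<bullet> i)) * exp (?E 0)) (at 0)"
    by (rule field_vector_diff_chain_at) (rule DERIV_exp)
  moreover have "exp (?E 0) = gwave 0 k x"
    using eq[of 0] by simp
  ultimately show ?thesis
    unfolding eq by (simp add: o_def)
qed

lemma gwave_has_vector_derivative2:
  assumes i: "i \<in> Basis"
  shows "((\<lambda>s. (complex_of_real (- ((x + s *\<^sub>R i) \<bullet> i)) + \<i> * complex_of_real (k \<bullet> i)) * gwave 0 k (x + s *\<^sub>R i))
    has_vector_derivative ((complex_of_real (- (x \<bullet> i)) + \<i> * complex_of_real (k \<bullet> i))\<^sup>2 - 1) * gwave 0 k x) (at 0)"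
proof -
  have "((\<lambda>s. complex_of_real (- ((x + s *\<^sub>R i) \<bullet> i)) + \<i> * complex_of_real (k \<bullet> i)) has_vector_derivative - 1) (at 0)"
    using i by (auto intro!: derivative_eq_intros simp: inner_add_left)
  from has_vector_derivative_mult[OF this gwave_has_vector_derivative[of k x i]]
  show ?thesis by (simp add: algebra_simps power2_eq_square)
qed

lemma gwave_pol_eq_sum:
  "- (\<Sum>i\<in>Basis. (complex_of_real (- (x \<bullet> i)) + \<i> * complex_of_real (k \<bullet> i))\<^sup>2 - 1) + complex_of_real ((norm x)\<^sup>2)
    = gwave_pol k x"
proof -
  have "(\<Sum>i\<in>Basis. (complex_of_real (- (x \<bullet> i)) + \<i> * complex_of_real (k \<bullet> i))\<^sup>2 - 1)
    = (\<Sum>i\<in>(Basis::'a set). complex_of_real ((x \<bullet> i)\<^sup>2) - 2 * \<i> * complex_of_real ((k \<bullet> i) * (x \<bullet> i)) - complex_of_real ((k \<bullet> i)\<^sup>2) - 1)"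
    by (intro sum.cong refl) (simp add: power2_eq_square algebra_simps)
  also have "\<dots> = complex_of_real ((norm x)\<^sup>2) - 2 * \<i> * complex_of_real (k \<bullet> x) - complex_of_real ((norm k)\<^sup>2) - DIM('a)"
    unfolding norm_square_sum_Basis euclidean_inner[of k x]
    by (simp add: sum_subtractf sum_distrib_left)
  finally show ?thesis by (simp add: gwave_pol_def)
qed

lemma harmonic_osc_gwave: "harmonic_osc (gwave 0 k) x = gwave_pol k x * gwave 0 k x"
proof -
  have 1: "partial_deriv i (gwave 0 k) = (\<lambda>x. (complex_of_real (- (x \<bullet> i)) + \<i> * complex_of_real (k \<bullet> i)) * gwave 0 k x)" for i
    unfolding partial_deriv_def by (rule ext, rule vector_derivative_at) (rule gwave_has_vector_derivative)
  have 2: "partial_deriv i (partial_deriv i (gwave 0 k)) x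
      = ((complex_of_real (- (x \<bullet> i)) + \<i> * complex_of_real (k \<bullet> i))\<^sup>2 - 1) * gwave 0 k x" if "i \<in> Basis" for i
    unfolding 1 using gwave_has_vector_derivative2[OF that]
    by (subst partial_deriv_def) (rule vector_derivative_at)
  have "laplacian (gwave 0 k) x = (\<Sum>i\<in>Basis. (complex_of_real (- (x \<bullet> i)) + \<i> * complex_of_real (k \<bullet> i))\<^sup>2 - 1) * gwave 0 k x"
    unfolding laplacian_def sum_distrib_right by (intro sum.cong refl 2)
  then show ?thesis
    unfolding harmonic_osc_def gwave_pol_eq_sum[symmetric] by (simp add: algebra_simps)
qed

section \<open>Transposing H onto wave packets\<close>

lemma schwartz_partial_derivs:
  assumes \<phi>: "\<phi> \<in> schwartz" and i: "i \<in> Basis"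
  shows "rapidly_decreasing (partial_deriv i \<phi>)" "rapidly_decreasing (partial_deriv i (partial_deriv i \<phi>))"
    "partial_deriv i \<phi> \<in> borel_measurable borel" "partial_deriv i (partial_deriv i \<phi>) \<in> borel_measurable borel"
    "((\<lambda>s. \<phi> (x + s *\<^sub>R i)) has_vector_derivative partial_deriv i \<phi> x) (at 0)"
    "((\<lambda>s. partial_deriv i \<phi> (x + s *\<^sub>R i)) has_vector_derivative partial_deriv i (partial_deriv i \<phi>) x) (at 0)"
proof -
  have sm: "smooth \<phi>" using \<phi> by (simp add: schwartz_def)
  show "rapidly_decreasing (partial_deriv i \<phi>)" "rapidly_decreasing (partial_deriv i (partial_deriv i \<phi>))"
    using schwartz_mderiv_rapidly_decreasing[OF \<phi>, of "\<lambda>j. if j = i then 1 else 0"]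
      schwartz_mderiv_rapidly_decreasing[OF \<phi>, of "\<lambda>j. if j = i then 2 else 0"]
    unfolding mderiv_single[OF i] by (simp_all add: numeral_2_eq_2)
  have d: "\<phi> differentiable_on UNIV" "partial_deriv i \<phi> differentiable_on UNIV"
     "partial_deriv i (partial_deriv i \<phi>) differentiable_on UNIV"
    using smooth_foldr_differentiable[OF sm, of "[]"] smooth_foldr_differentiable[OF sm, of "[i]"]
      smooth_foldr_differentiable[OF sm, of "[i, i]"] i by auto
  show "partial_deriv i \<phi> \<in> borel_measurable borel" "partial_deriv i (partial_deriv i \<phi>) \<in> borel_measurable borel"
    using d by (auto intro!: borel_measurable_continuous_onI differentiable_imp_continuous_on)
  show "((\<lambda>s. \<phi> (x + s *\<^sub>R i)) has_vector_derivative partial_deriv i \<phi> x) (at 0)"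
    "((\<lambda>s. partial_deriv i \<phi> (x + s *\<^sub>R i)) has_vector_derivative partial_deriv i (partial_deriv i \<phi>) x) (at 0)"
    using d by (auto intro: differentiable_partial_deriv)
qed

lemma harmonic_osc_rapid:
  assumes \<phi>: "\<phi> \<in> schwartz"
  shows "rapidly_decreasing (harmonic_osc \<phi>)" "harmonic_osc \<phi> \<in> borel_measurable borel"
    "integrable lborel (harmonic_osc \<phi>)"
proof -
  note [measurable] = schwartz_measurable[OF \<phi>] schwartz_partial_derivs(3,4)[OF \<phi>]
  have eq: "harmonic_osc \<phi> = (\<lambda>x. (\<Sum>i\<in>Basis. partial_deriv i (partial_deriv i \<phi>) x * (-1)) + \<phi> x * complex_of_real ((norm x)\<^sup>2))"
    by (simp add: fun_eq_iff harmonic_osc_def laplacian_def sum_negf)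
  have nb: "norm (complex_of_real ((norm x)\<^sup>2)) \<le> 1 * jbracket x ^ 2" for x :: 'a
    by (simp add: jbracket_sq norm_power)
  show r: "rapidly_decreasing (harmonic_osc \<phi>)" unfolding eq
    by (intro rapidly_decreasing_add rapidly_decreasing_sum rapidly_decreasing_mult[OF schwartz_rapid[OF \<phi>] nb]
        rapidly_decreasing_mult_bounded[of _ _ 1] schwartz_partial_derivs(2)[OF \<phi>]) auto
  show m: "harmonic_osc \<phi> \<in> borel_measurable borel" unfolding eq by measurable
  show "integrable lborel (harmonic_osc \<phi>)" by (rule rapidly_decreasing_integrable[OF r m])
qed

lemma norm_gwave_factor_le:
  assumes "i \<in> Basis"
  shows "norm (complex_of_real (- (x \<bullet> i)) + \<i> * complex_of_real (k \<bullet> i)) \<le> (1 + norm k) * jbracket x"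
proof -
  have "norm (complex_of_real (- (x \<bullet> i)) + \<i> * complex_of_real (k \<bullet> i)) \<le> \<bar>x \<bullet> i\<bar> + \<bar>k \<bullet> i\<bar>"
    by (rule norm_triangle_le) (simp add: norm_mult)
  also have "\<dots> \<le> norm x + norm k"
    using Basis_le_norm[OF assms] by (intro add_mono) auto
  also have "\<dots> \<le> jbracket x + norm k * jbracket x"
    using norm_le_jbracket[of x] mult_left_mono[OF jbracket_ge_1[of x] norm_ge_zero[of k]] by simp
  finally show ?thesis by (simp add: algebra_simps)
qed

text \<open>Two integrations by parts in each coordinate. The rapid decay of \<phi> and its
  derivatives compensates the polynomial factors that appear when the packet is
  differentiated.\<close>

lemma integral_harmonic_osc_gwave:
  assumes \<phi>: "\<phi> \<in> schwartz"
  shows "(LINT x|lborel. harmonic_osc \<phi> x * gwave 0 k x) = (LINT x|lborel. \<phi> x * (gwave_pol k x * gwave 0 k x))"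
proof -
  let ?l = "\<lambda>i x. complex_of_real (- (x \<bullet> i)) + \<i> * complex_of_real (k \<bullet> i)"
  let ?g = "gwave 0 k"
  note [measurable] = schwartz_measurable[OF \<phi>] schwartz_partial_derivs(3,4)[OF \<phi>]
  have gb: "norm (?g x) \<le> 1" for x by (simp add: norm_gwave_0)
  have gb1: "norm (?l i x * ?g x) \<le> (1 + norm k) * jbracket x ^ 1" if "i \<in> Basis" for i x
    using mult_mono[OF norm_gwave_factor_le[OF that, of x k] gb[of x]] less_imp_le[OF jbracket_pos[of x]]
    by (simp add: norm_mult)
  have gb2: "norm (((?l i x)\<^sup>2 - 1) * ?g x) \<le> ((1 + norm k)\<^sup>2 + 1) * jbracket x ^ 2" if "i \<in> Basis" for i x
  proof -
    have "norm ((?l i x)\<^sup>2 - 1) \<le> ((1 + norm k) * jbracket x)\<^sup>2 + 1"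
      by (rule norm_triangle_le_diff) (simp only: norm_power norm_one, intro add_right_mono power_mono norm_gwave_factor_le that norm_ge_zero)
    also have "\<dots> \<le> (1 + norm k)\<^sup>2 * jbracket x ^ 2 + jbracket x ^ 2"
      using one_le_power[OF jbracket_ge_1[of x], of 2] by (simp add: power_mult_distrib)
    also have "\<dots> = ((1 + norm k)\<^sup>2 + 1) * jbracket x ^ 2"
      by (simp add: algebra_simps)
    finally show ?thesis
      using mult_mono[OF _ gb[of x], of "norm ((?l i x)\<^sup>2 - 1)" "((1 + norm k)\<^sup>2 + 1) * jbracket x ^ 2"]
      unfolding norm_mult by simp
  qed
  note rm = rapidly_decreasing_mult_bounded[OF _ gb]
  have key: "(LINT x|lborel. partial_deriv i (partial_deriv i \<phi>) x * ?g x) = (LINT x|lborel. \<phi> x * (((?l i x)\<^sup>2 - 1) * ?g x))"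
    if i: "i \<in> Basis" for i
  proof -
    have ni: "norm i = 1" using i by simp
    have "(LINT x|lborel. partial_deriv i (partial_deriv i \<phi>) x * ?g x) = - (LINT x|lborel. partial_deriv i \<phi> x * (?l i x * ?g x))"
      by (rule integral_by_parts_rapid[OF schwartz_partial_derivs(6)[OF \<phi> i] gwave_has_vector_derivative ni _ _ _ _
            rm[OF schwartz_partial_derivs(1)[OF \<phi> i]] rm[OF schwartz_partial_derivs(2)[OF \<phi> i]]
            rapidly_decreasing_mult[OF schwartz_partial_derivs(1)[OF \<phi> i] gb1[OF i]]])
         (use i in measurable)
    also have "(LINT x|lborel. partial_deriv i \<phi> x * (?l i x * ?g x)) = - (LINT x|lborel. \<phi> x * (((?l i x)\<^sup>2 - 1) * ?g x))"
      by (rule integral_by_parts_rapid[OF schwartz_partial_derivs(5)[OF \<phi> i] gwave_has_vector_derivative2[OF i] ni _ _ _ _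
            rapidly_decreasing_mult[OF schwartz_rapid[OF \<phi>] gb1[OF i]]
            rapidly_decreasing_mult[OF schwartz_partial_derivs(1)[OF \<phi> i] gb1[OF i]]
            rapidly_decreasing_mult[OF schwartz_rapid[OF \<phi>] gb2[OF i]]])
         (use i in measurable)
    finally show ?thesis by simp
  qed
  have int1: "integrable lborel (\<lambda>x. partial_deriv i (partial_deriv i \<phi>) x * ?g x)" if i: "i \<in> Basis" for i
    by (intro rapidly_decreasing_integrable rm schwartz_partial_derivs(2)[OF \<phi> i]) (use i in measurable)
  have int2: "integrable lborel (\<lambda>x. \<phi> x * (((?l i x)\<^sup>2 - 1) * ?g x))" if i: "i \<in> Basis" for i
    by (intro rapidly_decreasing_integrable rapidly_decreasing_mult[OF schwartz_rapid[OF \<phi>] gb2[OF i]]) measurable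
  have nb: "norm (complex_of_real ((norm x)\<^sup>2)) \<le> 1 * jbracket x ^ 2" for x :: 'a
    by (simp add: jbracket_sq norm_power)
  have int3: "integrable lborel (\<lambda>x. (\<phi> x * complex_of_real ((norm x)\<^sup>2)) * ?g x)"
    by (intro rapidly_decreasing_integrable rm rapidly_decreasing_mult[OF schwartz_rapid[OF \<phi>] nb]) measurable
  have "(LINT x|lborel. harmonic_osc \<phi> x * ?g x)
     = (LINT x|lborel. - (\<Sum>i\<in>Basis. partial_deriv i (partial_deriv i \<phi>) x * ?g x) + (\<phi> x * complex_of_real ((norm x)\<^sup>2)) * ?g x)"
    by (simp add: harmonic_osc_def laplacian_def algebra_simps sum_distrib_right sum_distrib_left)
  also have "\<dots> = - (\<Sum>i\<in>Basis. (LINT x|lborel. partial_deriv i (partial_deriv i \<phi>) x * ?g x)) + (LINT x|lborel. (\<phi> x * complex_of_real ((norm x)\<^sup>2)) * ?g x)"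
    by (subst Bochner_Integration.integral_add)
       (use int1 int3 in \<open>simp_all add: Bochner_Integration.integral_sum\<close>)
  also have "\<dots> = - (\<Sum>i\<in>Basis. (LINT x|lborel. \<phi> x * (((?l i x)\<^sup>2 - 1) * ?g x))) + (LINT x|lborel. (\<phi> x * complex_of_real ((norm x)\<^sup>2)) * ?g x)"
    using key by simp
  also have "\<dots> = (LINT x|lborel. - (\<Sum>i\<in>Basis. \<phi> x * (((?l i x)\<^sup>2 - 1) * ?g x)) + (\<phi> x * complex_of_real ((norm x)\<^sup>2)) * ?g x)"
    by (subst Bochner_Integration.integral_add)
       (use int2 int3 in \<open>simp_all add: Bochner_Integration.integral_sum\<close>)
  also have "\<dots> = (LINT x|lborel. \<phi> x * (gwave_pol k x * ?g x))"
  proof (intro Bochner_Integration.integral_cong refl)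
    fix x
    have "(\<Sum>i\<in>Basis. \<phi> x * (((?l i x)\<^sup>2 - 1) * ?g x)) = \<phi> x * ((\<Sum>i\<in>Basis. (?l i x)\<^sup>2 - 1) * ?g x)"
      by (simp only: sum_distrib_left sum_distrib_right)
    then show "- (\<Sum>i\<in>Basis. \<phi> x * (((?l i x)\<^sup>2 - 1) * ?g x)) + (\<phi> x * complex_of_real ((norm x)\<^sup>2)) * ?g x
        = \<phi> x * (gwave_pol k x * ?g x)"
      unfolding gwave_pol_eq_sum[symmetric] by (simp add: algebra_simps)
  qed
  finally show ?thesis .
qed

section \<open>The Mehler kernel and the inverse of the harmonic oscillator\<close>

text \<open>With \<open>r = e\<^sup>-\<^sup>s\<close> this is the Mehler kernel of \<open>e\<^sup>-\<^sup>s\<^sup>H\<close> times \<open>ds/dr\<close> up to sign.\<close>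

definition mehler :: "real \<Rightarrow> 'a::euclidean_space \<Rightarrow> 'a \<Rightarrow> real" where
  "mehler r x y = indicator {0<..<1} r * r ^ (DIM('a) - 1) * (1 / sqrt (pi * (1 - r^4))) ^ DIM('a)
     * exp (- ((1 + r^4) * ((norm x)\<^sup>2 + (norm y)\<^sup>2) - 4 * r\<^sup>2 * (x \<bullet> y)) / (2 * (1 - r^4)))"

lemma mehler_sym: "mehler r x y = mehler r y x"
  by (simp add: mehler_def inner_commute add.commute)

lemma mehler_nonneg: "mehler r x y \<ge> 0"
proof (cases "r \<in> {0<..<1}")
  case True
  then have "r ^ 4 \<le> 1" by (intro power_le_one) auto
  with True show ?thesis by (auto simp: mehler_def)
qed (simp add: mehler_def)

lemma mehler_measurable [measurable (raw)]:
  assumes [measurable]: "r \<in> borel_measurable M" "x \<in> borel_measurable M" "y \<in> borel_measurable M"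
  shows "(\<lambda>p. mehler (r p) (x p) (y p)) \<in> borel_measurable M"
  unfolding mehler_def by measurable

text \<open>As a function of \<open>y\<close> the kernel is a Gaussian with linear term m . y. The
  parameter \<open>a\<close> serves two purposes: \<open>a = 0\<close> with \<open>k = 0\<close>
  gives the mass of the kernel, and \<open>a = 1 / 2\<close> its action on a packet.\<close>

lemma mehler_gaussian:
  fixes x k :: "'a::euclidean_space"
  assumes r: "0 < r" "r < 1" and a: "a \<ge> 0"
  defines "c \<equiv> (1 + r^4) / (2 * (1 - r^4)) + a" and "m \<equiv> (2 * r\<^sup>2 / (1 - r^4)) *\<^sub>R x"
  shows "integrable lborel (\<lambda>y. complex_of_real (mehler r x y * exp (- a * (norm y)\<^sup>2)) * iexp (k \<bullet> y))"
    and "(LINT y|lborel. complex_of_real (mehler r x y * exp (- a * (norm y)\<^sup>2)) * iexp (k \<bullet> y))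
      = complex_of_real (r ^ (DIM('a) - 1) * sqrt (1 / (c * (1 - r^4))) ^ DIM('a)
         * exp (((norm m)\<^sup>2 - (norm k)\<^sup>2) / (4 * c) - (1 + r^4) * (norm x)\<^sup>2 / (2 * (1 - r^4))))
        * iexp (k \<bullet> m / (2 * c))"
proof -
  have r4: "r ^ 4 < 1" using r power_strict_mono[of r 1 4] by simp
  have c: "c > 0" using r r4 a by (auto simp: c_def intro!: add_pos_nonneg divide_pos_pos)
  define K where "K = r ^ (DIM('a) - 1) * (1 / sqrt (pi * (1 - r^4))) ^ DIM('a)
     * exp (- (1 + r^4) * (norm x)\<^sup>2 / (2 * (1 - r^4)))"
  have e: "- ((1 + r^4) * ((norm x)\<^sup>2 + (norm y)\<^sup>2) - 4 * r\<^sup>2 * (x \<bullet> y)) / (2 * (1 - r^4)) + - a * (norm y)\<^sup>2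
     = - (1 + r^4) * (norm x)\<^sup>2 / (2 * (1 - r^4)) + (- c * (norm y)\<^sup>2 + m \<bullet> y)" for y
    using r4 by (simp add: c_def m_def divide_simps) (simp add: algebra_simps)
  have eq: "complex_of_real (mehler r x y * exp (- a * (norm y)\<^sup>2)) * iexp (k \<bullet> y)
      = complex_of_real K * (exp (- c * (norm y)\<^sup>2 + m \<bullet> y) *\<^sub>R iexp (k \<bullet> y))" for y
  proof -
    have "exp (- ((1 + r^4) * ((norm x)\<^sup>2 + (norm y)\<^sup>2) - 4 * r\<^sup>2 * (x \<bullet> y)) / (2 * (1 - r^4))) * exp (- a * (norm y)\<^sup>2)
       = exp (- (1 + r^4) * (norm x)\<^sup>2 / (2 * (1 - r^4))) * exp (- c * (norm y)\<^sup>2 + m \<bullet> y)"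
      unfolding exp_add[symmetric] e ..
    then have "mehler r x y * exp (- a * (norm y)\<^sup>2) = K * exp (- c * (norm y)\<^sup>2 + m \<bullet> y)"
      using r by (simp add: mehler_def K_def mult.assoc)
    then show ?thesis
      by (simp only: of_real_mult scaleR_conv_of_real mult.assoc)
  qed
  show "integrable lborel (\<lambda>y. complex_of_real (mehler r x y * exp (- a * (norm y)\<^sup>2)) * iexp (k \<bullet> y))"
    unfolding eq by (intro integrable_mult_right gaussian_fourier_linear(1)[OF c])
  have s: "(1 / sqrt (pi * (1 - r^4))) * sqrt (pi / c) = sqrt (1 / (c * (1 - r^4)))"
    using c r4 by (simp add: real_sqrt_divide real_sqrt_mult)
  have "(LINT y|lborel. complex_of_real (mehler r x y * exp (- a * (norm y)\<^sup>2)) * iexp (k \<bullet> y))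
     = complex_of_real K * (LINT y|lborel. exp (- c * (norm y)\<^sup>2 + m \<bullet> y) *\<^sub>R iexp (k \<bullet> y))"
    unfolding eq by (rule integral_mult_right_zero)
  also have "\<dots> = complex_of_real K * (complex_of_real (sqrt (pi / c) ^ DIM('a) * exp (((norm m)\<^sup>2 - (norm k)\<^sup>2) / (4 * c)))
       * iexp (k \<bullet> m / (2 * c)))"
    by (simp only: gaussian_fourier_linear(2)[OF c])
  also have "\<dots> = complex_of_real (K * (sqrt (pi / c) ^ DIM('a) * exp (((norm m)\<^sup>2 - (norm k)\<^sup>2) / (4 * c))))
       * iexp (k \<bullet> m / (2 * c))"
    by (simp only: of_real_mult mult.assoc)
  also have "K * (sqrt (pi / c) ^ DIM('a) * exp (((norm m)\<^sup>2 - (norm k)\<^sup>2) / (4 * c)))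
     = r ^ (DIM('a) - 1) * ((1 / sqrt (pi * (1 - r^4))) * sqrt (pi / c)) ^ DIM('a) *
        (exp (((norm m)\<^sup>2 - (norm k)\<^sup>2) / (4 * c)) * exp (- (1 + r^4) * (norm x)\<^sup>2 / (2 * (1 - r^4))))"
    unfolding K_def power_mult_distrib by (simp only: mult_ac)
  also have "exp (((norm m)\<^sup>2 - (norm k)\<^sup>2) / (4 * c)) * exp (- (1 + r^4) * (norm x)\<^sup>2 / (2 * (1 - r^4)))
     = exp (((norm m)\<^sup>2 - (norm k)\<^sup>2) / (4 * c) - (1 + r^4) * (norm x)\<^sup>2 / (2 * (1 - r^4)))"
    unfolding exp_add[symmetric] minus_mult_left[symmetric] minus_divide_left[symmetric] by simp
  finally show "(LINT y|lborel. complex_of_real (mehler r x y * exp (- a * (norm y)\<^sup>2)) * iexp (k \<bullet> y))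
      = complex_of_real (r ^ (DIM('a) - 1) * sqrt (1 / (c * (1 - r^4))) ^ DIM('a)
         * exp (((norm m)\<^sup>2 - (norm k)\<^sup>2) / (4 * c) - (1 + r^4) * (norm x)\<^sup>2 / (2 * (1 - r^4))))
        * iexp (k \<bullet> m / (2 * c))"
    unfolding s .
qed

text \<open>The prefactor is controlled by 1 / (c (1 - r^4)) = 2 / (1 + r^4) \<le> 2, and the
  exponent in \<open>x\<close> is nonpositive since 4 r^4 \<le> (1 + r^4)^2. The bound is uniform in
  \<open>x\<close> and, the kernel being symmetric, serves for both variables as in Schur's
  test.\<close>

lemma mehler_integral:
  fixes x :: "'a::euclidean_space"
  shows "integrable lborel (mehler r x)"
    and "(LINT y|lborel. mehler r x y) \<le> indicator {0<..<1} r * sqrt 2 ^ DIM('a)"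
proof -
  have *: "integrable lborel (mehler r x) \<and> (LINT y|lborel. mehler r x y) \<le> sqrt 2 ^ DIM('a)" if r: "0 < r" "r < 1"
  proof -
    have r4: "r ^ 4 < 1" "r ^ 4 > 0" using r power_strict_mono[of r 1 4] by auto
    define c where "c = (1 + r^4) / (2 * (1 - r^4))"
    define m where "m = (2 * r\<^sup>2 / (1 - r^4)) *\<^sub>R x"
    have c: "c > 0" using r4 by (auto simp: c_def intro!: divide_pos_pos add_pos_pos)
    note G = mehler_gaussian[OF r order_refl[of 0], of x "0::'a"]
    have "integrable lborel (\<lambda>y. complex_of_real (mehler r x y))"
      using G(1) by simp
    then have int: "integrable lborel (mehler r x)"
      by (simp only: complex_of_real_integrable_eq)
    have "complex_of_real (LINT y|lborel. mehler r x y) = (LINT y|lborel. complex_of_real (mehler r x y))"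
      by (rule integral_complex_of_real[symmetric])
    also have "\<dots> = complex_of_real (r ^ (DIM('a) - 1) * sqrt (1 / (c * (1 - r^4))) ^ DIM('a)
         * exp ((norm m)\<^sup>2 / (4 * c) - (1 + r^4) * (norm x)\<^sup>2 / (2 * (1 - r^4))))"
      using G(2) by (simp add: c_def m_def)
    finally have "(LINT y|lborel. mehler r x y) = r ^ (DIM('a) - 1) * sqrt (1 / (c * (1 - r^4))) ^ DIM('a)
         * exp ((norm m)\<^sup>2 / (4 * c) - (1 + r^4) * (norm x)\<^sup>2 / (2 * (1 - r^4)))"
      by (simp only: of_real_eq_iff)
    also have "\<dots> \<le> 1 * sqrt 2 ^ DIM('a) * 1"
    proof (intro mult_mono)
      show "r ^ (DIM('a) - 1) \<le> 1" using r by (intro power_le_one) auto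
      show "sqrt (1 / (c * (1 - r^4))) ^ DIM('a) \<le> sqrt 2 ^ DIM('a)"
      proof (rule power_mono)
        have "p / (2 * q) * q = p / 2" if "q \<noteq> 0" for p q :: real using that by simp
        from this[of "1 - r^4" "1 + r^4"] have e: "c * (1 - r^4) = (1 + r^4) / 2"
          using r4 by (simp only: c_def)
        have "1 / (c * (1 - r^4)) = 2 / (1 + r^4)" unfolding e by simp
        also have "\<dots> \<le> 2 / 1" by (rule frac_le) (use r4(2) in linarith)+
        also have "\<dots> = 2" by simp
        finally show "sqrt (1 / (c * (1 - r^4))) \<le> sqrt 2" by (rule real_sqrt_le_mono)
        show "0 \<le> sqrt (1 / (c * (1 - r^4)))" using c r4 by simp
      qed
      have aux: "(4 * p * N / q\<^sup>2) / (4 * (s / (2 * q))) \<le> s * N / (2 * q)"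
        if "q > 0" "s > 0" "4 * p \<le> s\<^sup>2" "N \<ge> 0" for p q s N :: real
      proof -
        have "(4 * p * N / q\<^sup>2) / (4 * (s / (2 * q))) = (4 * p * N) / (2 * q * s)"
          using that by (simp add: power2_eq_square)
        also have "\<dots> \<le> (s\<^sup>2 * N) / (2 * q * s)"
          using that by (intro divide_right_mono mult_right_mono) auto
        also have "\<dots> = s * N / (2 * q)"
          using that by (simp add: power2_eq_square)
        finally show ?thesis .
      qed
      have m2: "(norm m)\<^sup>2 = 4 * r^4 * (norm x)\<^sup>2 / (1 - r^4)\<^sup>2"
        unfolding m_def norm_scaleR power_mult_distrib power2_abs
        by (simp add: power_divide power_mult_distrib flip: power_mult)
      have p4: "4 * r^4 \<le> (1 + r^4)\<^sup>2"
        using zero_le_power2[of "1 - r^4"] by (simp add: power2_sum power2_diff)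
      have p0: "0 < 1 - r^4" "0 < 1 + r^4" using r4 by linarith+
      have "(norm m)\<^sup>2 / (4 * c) \<le> (1 + r^4) * (norm x)\<^sup>2 / (2 * (1 - r^4))"
        unfolding m2 c_def by (rule aux[OF p0 p4 zero_le_power2])
      then show "exp ((norm m)\<^sup>2 / (4 * c) - (1 + r^4) * (norm x)\<^sup>2 / (2 * (1 - r^4))) \<le> 1" by simp
    qed (use r c r4 in auto)
    finally show ?thesis using int by simp
  qed
  show "integrable lborel (mehler r x)"
  proof (cases "0 < r \<and> r < 1")
    case False
    then have "mehler r x = (\<lambda>_. 0)" by (auto simp: mehler_def fun_eq_iff)
    then show ?thesis by simp
  qed (use * in simp)
  show "(LINT y|lborel. mehler r x y) \<le> indicator {0<..<1} r * sqrt 2 ^ DIM('a)"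
  proof (cases "0 < r \<and> r < 1")
    case False
    then have "mehler r x = (\<lambda>_. 0)" by (auto simp: mehler_def fun_eq_iff)
    then show ?thesis by simp
  qed (use * in simp)
qed

text \<open>The scalar that accompanies the action of the kernel on a packet. Its power of
  \<open>r\<close> combines e^(-sd), where d is the lowest eigenvalue of H, with ds/dr.\<close>

definition damp :: "'a::euclidean_space \<Rightarrow> real \<Rightarrow> real" where
  "damp k r = indicator {0<..<1} r * r ^ (DIM('a) - 1) * exp (- ((norm k)\<^sup>2 * (1 - r^4) / 4))"

lemma damp_measurable [measurable]: "damp k \<in> borel_measurable borel"
  unfolding damp_def by measurable

lemma damp_bounds: "0 \<le> damp k r" "damp k r \<le> indicator {0<..<1} r"
proof -
  show "0 \<le> damp k r" by (auto simp: damp_def indicator_def)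
  show "damp k r \<le> indicator {0<..<1} r"
  proof (cases "r \<in> {0<..<1}")
    case True
    then have "r ^ 4 \<le> 1" by (intro power_le_one) auto
    then have "exp (- ((norm k)\<^sup>2 * (1 - r^4) / 4)) \<le> 1" by simp
    moreover have "r ^ (DIM('a) - 1) \<le> 1" using True by (intro power_le_one) auto
    ultimately show ?thesis using True mult_mono[of "r ^ (DIM('a) - 1)" 1 "exp (- ((norm k)\<^sup>2 * (1 - r^4) / 4))" 1]
      by (simp add: damp_def)
  qed (simp add: damp_def)
qed

text \<open>The semigroup e^(-sH) preserves packets of unit width centred at 0: the frequency
  contracts by r^2 and only a scalar appears. With \<open>a = 1 / 2\<close> the coefficient in
  \<open>mehler_gaussian\<close> is 1 / (1 - r^4), which cancels the normalizing root.\<close>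

lemma mehler_gwave:
  "(LINT y|lborel. complex_of_real (mehler r x y) * gwave 0 k y) = complex_of_real (damp k r) * gwave 0 (r\<^sup>2 *\<^sub>R k) x"
proof (cases "0 < r \<and> r < 1")
  case True
  then have r: "0 < r" "r < 1" by auto
  have r4: "r ^ 4 < 1" using r power_strict_mono[of r 1 4] by simp
  let ?m = "(2 * r\<^sup>2 / (1 - r^4)) *\<^sub>R x"
  have c: "(1 + r^4) / (2 * (1 - r^4)) + 1 / 2 = 1 / (1 - r^4)"
    using r4 by (simp add: field_simps)
  have "(LINT y|lborel. complex_of_real (mehler r x y) * gwave 0 k y)
     = (LINT y|lborel. complex_of_real (mehler r x y * exp (- (1/2) * (norm y)\<^sup>2)) * iexp (k \<bullet> y))"
    by (simp add: gwave_def mult.assoc)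
  also have "\<dots> = complex_of_real (r ^ (DIM('a) - 1) * sqrt (1 / (1 / (1 - r^4) * (1 - r^4))) ^ DIM('a)
         * exp (((norm ?m)\<^sup>2 - (norm k)\<^sup>2) / (4 * (1 / (1 - r^4))) - (1 + r^4) * (norm x)\<^sup>2 / (2 * (1 - r^4))))
        * iexp (k \<bullet> ?m / (2 * (1 / (1 - r^4))))"
    using mehler_gaussian(2)[OF r, of "1/2" x k] unfolding c by simp
  also have "sqrt (1 / (1 / (1 - r^4) * (1 - r^4))) = 1" using r4 by simp
  also have "((norm ?m)\<^sup>2 - (norm k)\<^sup>2) / (4 * (1 / (1 - r^4))) - (1 + r^4) * (norm x)\<^sup>2 / (2 * (1 - r^4))
     = - ((norm k)\<^sup>2 * (1 - r^4) / 4) + - (norm x)\<^sup>2 / 2"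
  proof -
    define q where "q = 1 - r^4"
    have q: "q > 0" "r ^ 4 = 1 - q" using r4 by (auto simp: q_def)
    have "(norm ?m)\<^sup>2 = 4 * (1 - q) * (norm x)\<^sup>2 / q\<^sup>2"
    proof -
      have "(2 * r\<^sup>2 / q)\<^sup>2 = 4 * (1 - q) / q\<^sup>2"
        unfolding q(2)[symmetric] by (simp add: power_mult_distrib power_divide flip: power_mult)
      then show ?thesis
        unfolding q_def[symmetric] norm_scaleR power_mult_distrib power2_abs by simp
    qed
    moreover have "(4 * (1 - q) * N / q\<^sup>2 - K) / (4 * (1 / q)) - (1 + (1 - q)) * N / (2 * q) = - (K * q / 4) + - N / 2" for N K
      using q(1) by (simp add: field_simps power2_eq_square)
    ultimately show ?thesis
      unfolding q_def[symmetric] unfolding q(2) by simp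
  qed
  also have "k \<bullet> ?m / (2 * (1 / (1 - r^4))) = (r\<^sup>2 *\<^sub>R k) \<bullet> x"
    using r4 by (simp add: field_simps)
  finally show ?thesis
    using r unfolding exp_add by (simp add: damp_def gwave_def mult.assoc)
qed (simp add: mehler_def damp_def)

text \<open>The integrand is the derivative of \<open>r ^ d * exp (- \<bar>k\<bar>\<^sup>2 (1 - r ^ 4) / 4) * gwave 0 (r\<^sup>2 k) x\<close>.\<close>

lemma integral_damp_gwave_pol:
  "(LINT r|lborel. complex_of_real (damp k r) * (gwave_pol (r\<^sup>2 *\<^sub>R k) x * gwave 0 (r\<^sup>2 *\<^sub>R k) x)) = gwave 0 k x"
proof -
  let ?d = "DIM('a)" and ?K = "(norm k)\<^sup>2" and ?g = "complex_of_real (exp (- (norm x)\<^sup>2 / 2))"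
  define E :: "real \<Rightarrow> complex" where "E r = complex_of_real (- (?K * (1 - r^4) / 4)) + \<i> * complex_of_real (r\<^sup>2 * (k \<bullet> x))" for r
  define E' :: "real \<Rightarrow> complex" where "E' r = complex_of_real (?K * r^3) + \<i> * complex_of_real (2 * r * (k \<bullet> x))" for r
  define F :: "real \<Rightarrow> complex" where "F r = complex_of_real (r ^ ?d) * exp (E r) * ?g" for r
  define f :: "real \<Rightarrow> complex" where "f r = (complex_of_real (r ^ ?d) * (E' r * exp (E r)) + complex_of_real (real ?d * r ^ (?d - 1)) * exp (E r)) * ?g" for r
  have dE: "(E has_vector_derivative E' r) (at r within S)" for r S
    unfolding E_def E'_def has_vector_derivative_complex_iff
    by (auto intro!: derivative_eq_intros simp: field_simps)
  have dexp: "((\<lambda>r. exp (E r)) has_vector_derivative E' r * exp (E r)) (at r)" for r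
    using field_vector_diff_chain_at[OF dE[of r UNIV] DERIV_exp] by (simp add: o_def)
  have dr: "((\<lambda>r. complex_of_real (r ^ ?d)) has_vector_derivative complex_of_real (real ?d * r ^ (?d - 1))) (at r)" for r :: real
    unfolding has_vector_derivative_complex_iff by (auto intro!: derivative_eq_intros)
  have dF: "(F has_vector_derivative f r) (at r within {0..1})" for r
    unfolding F_def f_def
    by (rule has_vector_derivative_at_within)
       (rule has_vector_derivative_mult_left[OF has_vector_derivative_mult[OF dr dexp]])
  have cont: "continuous_on {0..1} f"
    unfolding f_def E_def E'_def by (intro continuous_intros) auto
  have "(LINT r|lborel. indicator {0..1} r *\<^sub>R f r) = F 1 - F 0"
    by (rule integral_FTC_atLeastAtMost) (use dF cont in auto)
  \<comment> \<open>\<open>F 0\<close> vanishes because the dimension is positive. At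
    \<open>r = 1\<close> the damping exponent is 0 and the frequency is \<open>k\<close>, so
    \<open>F 1\<close> is the packet.\<close>
  also have "\<dots> = gwave 0 k x"
    by (simp add: F_def E_def gwave_def)
  finally have "(LINT r|lborel. indicator {0..1} r *\<^sub>R f r) = gwave 0 k x" .
  moreover have "(LINT r|lborel. complex_of_real (damp k r) * (gwave_pol (r\<^sup>2 *\<^sub>R k) x * gwave 0 (r\<^sup>2 *\<^sub>R k) x))
     = (LINT r|lborel. indicator {0..1} r *\<^sub>R f r)"
  proof (rule integral_cong_AE)
    have "AE r in lborel. r \<noteq> (0::real)" "AE r in lborel. r \<noteq> (1::real)"
      by (rule AE_lborel_singleton)+
    then show "AE r in lborel. complex_of_real (damp k r) * (gwave_pol (r\<^sup>2 *\<^sub>R k) x * gwave 0 (r\<^sup>2 *\<^sub>R k) x)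
      = indicator {0..1} r *\<^sub>R f r"
    proof eventually_elim
      case (elim r)
      show ?case
      proof (cases "0 < r \<and> r < 1")
        case True
        have r: "r ^ ?d = r ^ (?d - 1) * r"
          using DIM_positive[where 'a='a] by (simp add: power_eq_if mult.commute)
        have pol: "gwave_pol (r\<^sup>2 *\<^sub>R k) x = complex_of_real ?d + complex_of_real r * E' r"
          by (simp add: gwave_pol_def E'_def power_mult_distrib algebra_simps flip: power_mult)
             (simp add: power2_eq_square power3_eq_cube power4_eq_xxxx)
        have ex: "complex_of_real (exp (- (?K * (1 - r^4) / 4))) * gwave 0 (r\<^sup>2 *\<^sub>R k) x = exp (E r) * ?g"
          unfolding E_def exp_add exp_of_real by (simp add: gwave_def)
        have "complex_of_real (damp k r) * (gwave_pol (r\<^sup>2 *\<^sub>R k) x * gwave 0 (r\<^sup>2 *\<^sub>R k) x)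
          = complex_of_real (r ^ (?d - 1)) * gwave_pol (r\<^sup>2 *\<^sub>R k) x * (complex_of_real (exp (- (?K * (1 - r^4) / 4))) * gwave 0 (r\<^sup>2 *\<^sub>R k) x)"
          using True by (simp add: damp_def)
        also have "\<dots> = f r"
          unfolding ex pol f_def r by (simp add: algebra_simps)
        finally show ?thesis using True by simp
      qed (use elim in \<open>auto simp: damp_def indicator_def\<close>)
    qed
    show "(\<lambda>r. complex_of_real (damp k r) * (gwave_pol (r\<^sup>2 *\<^sub>R k) x * gwave 0 (r\<^sup>2 *\<^sub>R k) x)) \<in> borel_measurable lborel"
      unfolding gwave_pol_def gwave_def by measurable
    show "(\<lambda>r. indicator {0..1} r *\<^sub>R f r) \<in> borel_measurable lborel"
      unfolding f_def E_def E'_def by measurable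
  qed
  ultimately show ?thesis by simp
qed

section \<open>The Green operator of H\<close>

text \<open>The inverse of H as the integral of e^(-sH) over s > 0. Time and space are integrated
  jointly, so one integrability statement covers the different orders of integration.\<close>

definition green :: "('a::euclidean_space \<Rightarrow> complex) \<Rightarrow> 'a \<Rightarrow> complex" where
  "green f x = (LINT q|lborel. complex_of_real (mehler (fst q) x (snd q)) * f (snd q))"

lemma integrable_indicator_unit: "integrable lborel (indicator {0<..<1::real} :: real \<Rightarrow> real)"
  by (rule integrable_real_indicator) auto

text \<open>Integrating over \<open>x\<close> first removes the kernel by
  \<open>mehler_integral\<close>; what is left is a multiple of the indicator in \<open>r\<close>
  times the norm of \<open>f\<close>.\<close>

lemma mehler_triple_integrable:
  fixes f g :: "'a::euclidean_space \<Rightarrow> complex"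
  assumes f: "integrable lborel f" and [measurable]: "g \<in> borel_measurable borel"
    and B: "\<And>x. norm (g x) \<le> B"
  shows "integrable lborel (\<lambda>p. complex_of_real (mehler (fst (fst p)) (snd p) (snd (fst p))) * f (snd (fst p)) * g (snd p))"
    (is "integrable lborel ?F")
proof (rule lborel_integrable_fstI)
  have [measurable]: "f \<in> borel_measurable borel" using f by (auto dest: borel_measurable_integrable)
  show "?F \<in> borel_measurable borel" by measurable
  have B0: "B \<ge> 0" using order_trans[OF norm_ge_zero B] .
  show "integrable lborel (\<lambda>q :: real \<times> 'a. B * sqrt 2 ^ DIM('a) * (indicator {0<..<1} (fst q) * norm (f (snd q))))"
    by (intro integrable_mult_right integrable_tensor integrable_indicator_unit integrable_norm f)
  fix q :: "real \<times> 'a"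
  have b: "norm (?F (q, x)) \<le> (norm (f (snd q)) * B) * mehler (fst q) (snd q) x" for x
  proof -
    have "norm (?F (q, x)) = (norm (f (snd q)) * norm (g x)) * mehler (fst q) (snd q) x"
      by (simp add: norm_mult mehler_nonneg mehler_sym[of _ x])
    also have "\<dots> \<le> (norm (f (snd q)) * B) * mehler (fst q) (snd q) x"
      by (intro mult_right_mono mult_left_mono B norm_ge_zero mehler_nonneg)
    finally show ?thesis .
  qed
  have i: "integrable lborel (\<lambda>x. (norm (f (snd q)) * B) * mehler (fst q) (snd q) x)"
    by (intro integrable_mult_right mehler_integral(1))
  show i2: "integrable lborel (\<lambda>x. ?F (q, x))"
  proof (rule Bochner_Integration.integrable_bound[OF i])
    show "AE x in lborel. norm (?F (q, x)) \<le> norm ((norm (f (snd q)) * B) * mehler (fst q) (snd q) x)"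
      using order_trans[OF b abs_ge_self] by simp
  qed simp
  have "(LINT x|lborel. norm (?F (q, x))) \<le> (LINT x|lborel. (norm (f (snd q)) * B) * mehler (fst q) (snd q) x)"
    by (rule integral_mono[OF integrable_norm[OF i2] i b])
  also have "\<dots> = (norm (f (snd q)) * B) * (LINT x|lborel. mehler (fst q) (snd q) x)" by simp
  also have "\<dots> \<le> (norm (f (snd q)) * B) * (indicator {0<..<1} (fst q) * sqrt 2 ^ DIM('a))"
    by (intro mult_left_mono mehler_integral(2)) (use B0 in simp)
  finally show "(LINT x|lborel. norm (?F (q, x))) \<le> B * sqrt 2 ^ DIM('a) * (indicator {0<..<1} (fst q) * norm (f (snd q)))"
    by (simp add: mult_ac)
qed

text \<open>Moves the kernel from \<open>f\<close> to the test function. The first claim,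
  integrability against any bounded measurable function, later gives square integrability of
  \<open>green f\<close>.\<close>

lemma integral_green:
  fixes f g :: "'a::euclidean_space \<Rightarrow> complex"
  assumes f: "integrable lborel f" and g: "g \<in> borel_measurable borel" and B: "\<And>x. norm (g x) \<le> B"
  shows "integrable lborel (\<lambda>x. green f x * g x)"
    and "(LINT x|lborel. green f x * g x) = (LINT q|lborel. f (snd q) * (LINT x|lborel. complex_of_real (mehler (fst q) x (snd q)) * g x))"
    and "integrable lborel (\<lambda>q. f (snd q) * (LINT x|lborel. complex_of_real (mehler (fst q) x (snd q)) * g x))"
proof -
  note F = lborel_Fubini[OF mehler_triple_integrable[OF f g B], unfolded fst_conv snd_conv]
  have 1: "(LINT q|lborel. complex_of_real (mehler (fst q) x (snd q)) * f (snd q) * g x) = green f x * g x" for x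
    unfolding green_def by (rule integral_mult_left_zero)
  have 2: "(LINT x|lborel. complex_of_real (mehler (fst q) x (snd q)) * f (snd q) * g x)
     = f (snd q) * (LINT x|lborel. complex_of_real (mehler (fst q) x (snd q)) * g x)" for q :: "real \<times> 'a"
    by (subst integral_mult_right_zero[symmetric]) (simp add: mult_ac)
  show "integrable lborel (\<lambda>x. green f x * g x)" using F(4) unfolding 1 .
  show "(LINT x|lborel. green f x * g x) = (LINT q|lborel. f (snd q) * (LINT x|lborel. complex_of_real (mehler (fst q) x (snd q)) * g x))"
    using F(1,2) unfolding 1 2 by simp
  show "integrable lborel (\<lambda>q. f (snd q) * (LINT x|lborel. complex_of_real (mehler (fst q) x (snd q)) * g x))"
    using F(3) unfolding 2 .
qed

lemma green_measurable:
  assumes [measurable]: "f \<in> borel_measurable borel"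
  shows "green f \<in> borel_measurable borel"
proof -
  have "(\<lambda>x. LINT q|lborel. complex_of_real (mehler (fst q) x (snd q)) * f (snd q)) \<in> borel_measurable borel"
  proof (rule lborel.borel_measurable_lebesgue_integral)
    have "(\<lambda>p. complex_of_real (mehler (fst (snd p)) (fst p) (snd (snd p))) * f (snd (snd p))) \<in> borel_measurable borel"
      by measurable
    then have "(\<lambda>p. complex_of_real (mehler (fst (snd p)) (fst p) (snd (snd p))) * f (snd (snd p))) \<in> borel_measurable (lborel \<Otimes>\<^sub>M lborel)"
      by (simp add: lborel_prod)
    then show "(\<lambda>(x, q). complex_of_real (mehler (fst q) x (snd q)) * f (snd q)) \<in> borel_measurable (borel \<Otimes>\<^sub>M lborel)"
      by (simp add: split_def cong: measurable_cong_sets sets_pair_measure_cong)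
  qed
  then show ?thesis by (simp add: green_def[abs_def])
qed

text \<open>Supremum norm counterpart of the preceding estimates: here the kernel is integrated over
  \<open>y\<close>, with the same mass bound.\<close>

lemma green_bounded:
  fixes f :: "'a::euclidean_space \<Rightarrow> complex"
  assumes [measurable]: "f \<in> borel_measurable borel" and B: "\<And>x. norm (f x) \<le> B"
  shows "norm (green f x) \<le> B * sqrt 2 ^ DIM('a)"
proof -
  let ?F = "\<lambda>q. complex_of_real (mehler (fst q) x (snd q)) * f (snd q)"
  have B0: "B \<ge> 0" using order_trans[OF norm_ge_zero B] .
  let ?w = "\<lambda>r::real. indicator {0<..<1} r * (B * sqrt 2 ^ DIM('a))"
  have b: "norm (?F (r, y)) \<le> B * mehler r x y" for r y
    using B[of y] mehler_nonneg[of r x y] mult_left_mono[OF B[of y] mehler_nonneg[of r x y]]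
    by (simp add: norm_mult abs_mult mult.commute)
  have i: "integrable lborel (\<lambda>y. B * mehler r x y)" for r
    by (intro integrable_mult_right mehler_integral(1))
  have i2: "integrable lborel (\<lambda>y. ?F (r, y))" for r
  proof (rule Bochner_Integration.integrable_bound[OF i])
    show "AE y in lborel. norm (?F (r, y)) \<le> norm (B * mehler r x y)"
      using order_trans[OF b abs_ge_self] by simp
  qed simp
  have le: "(LINT y|lborel. norm (?F (r, y))) \<le> ?w r" for r
  proof -
    have "(LINT y|lborel. norm (?F (r, y))) \<le> (LINT y|lborel. B * mehler r x y)"
      by (rule integral_mono[OF integrable_norm[OF i2] i b])
    also have "\<dots> \<le> B * (indicator {0<..<1} r * sqrt 2 ^ DIM('a))"
      using mult_left_mono[OF mehler_integral(2) B0] by simp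
    finally show ?thesis by (simp add: mult_ac)
  qed
  have iw: "integrable lborel ?w"
    by (intro integrable_mult_left integrable_indicator_unit)
  have int: "integrable lborel ?F"
    by (rule lborel_integrable_fstI[OF _ i2 iw le]) measurable
  have "norm (green f x) \<le> (LINT q|lborel. norm (?F q))"
    unfolding green_def by (rule integral_norm_bound)
  also have "\<dots> = (LINT r|lborel. LINT y|lborel. norm (?F (r, y)))"
    by (rule lborel_Fubini(1)[OF integrable_norm[OF int]])
  also have "\<dots> \<le> (LINT r|lborel. ?w r)"
    by (rule integral_mono[OF lborel_Fubini(3)[OF integrable_norm[OF int]] iw le])
  also have "\<dots> = B * sqrt 2 ^ DIM('a)" by simp
  finally show ?thesis .
qed

text \<open>Follows from the symmetry of the kernel. The exchange of \<open>x\<close> and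
  \<open>y\<close> is made at fixed \<open>r\<close>, and both sides are then integrated over
  \<open>r\<close>.\<close>

lemma green_symmetric:
  fixes f g :: "'a::euclidean_space \<Rightarrow> complex"
  assumes f: "integrable lborel f" "\<And>x. norm (f x) \<le> A" and g: "integrable lborel g" "\<And>x. norm (g x) \<le> B"
  shows "(LINT x|lborel. green f x * g x) = (LINT x|lborel. f x * green g x)"
proof -
  have [measurable]: "f \<in> borel_measurable borel" "g \<in> borel_measurable borel"
    using f g by (auto dest: borel_measurable_integrable)
  let ?M = "\<lambda>r x y. complex_of_real (mehler r x y)"
  have swap: "(LINT y|lborel. f y * (LINT x|lborel. ?M r x y * g x)) = (LINT x|lborel. g x * (LINT y|lborel. ?M r y x * f y))" for r
  proof -
    let ?F = "\<lambda>p. ?M r (snd p) (fst p) * f (fst p) * g (snd p)"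
    have A0: "A \<ge> 0" using order_trans[OF norm_ge_zero f(2)] .
    have B0: "B \<ge> 0" using order_trans[OF norm_ge_zero g(2)] .
    have b: "norm (?F (y, x)) \<le> (norm (f y) * B) * mehler r y x" for x y
    proof -
      have "norm (?F (y, x)) = (norm (f y) * norm (g x)) * mehler r y x"
        by (simp add: norm_mult mehler_nonneg mehler_sym[of _ x])
      also have "\<dots> \<le> (norm (f y) * B) * mehler r y x"
        by (intro mult_right_mono mult_left_mono g(2) norm_ge_zero mehler_nonneg)
      finally show ?thesis .
    qed
    have i: "integrable lborel (\<lambda>x. (norm (f y) * B) * mehler r y x)" for y
      by (intro integrable_mult_right mehler_integral(1))
    have i2: "integrable lborel (\<lambda>x. ?F (y, x))" for y
    proof (rule Bochner_Integration.integrable_bound[OF i])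
      show "AE x in lborel. norm (?F (y, x)) \<le> norm ((norm (f y) * B) * mehler r y x)"
        using order_trans[OF b abs_ge_self] by simp
    qed simp
    have "integrable lborel ?F"
    proof (rule lborel_integrable_fstI[OF _ i2])
      show "integrable lborel (\<lambda>y. norm (f y) * B * (indicator {0<..<1} r * sqrt 2 ^ DIM('a)))"
        by (intro integrable_mult_left integrable_norm f)
      fix y
      have "(LINT x|lborel. norm (?F (y, x))) \<le> (LINT x|lborel. (norm (f y) * B) * mehler r y x)"
        by (rule integral_mono[OF integrable_norm[OF i2] i b])
      also have "\<dots> \<le> norm (f y) * B * (indicator {0<..<1} r * sqrt 2 ^ DIM('a))"
        using mult_left_mono[OF mehler_integral(2), of "norm (f y) * B" r y] B0 by simp
      finally show "(LINT x|lborel. norm (?F (y, x))) \<le> norm (f y) * B * (indicator {0<..<1} r * sqrt 2 ^ DIM('a))" .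
    qed measurable
    from lborel_Fubini(1,2)[OF this, unfolded fst_conv snd_conv]
    have "(LINT y|lborel. LINT x|lborel. ?M r x y * f y * g x) = (LINT x|lborel. LINT y|lborel. ?M r x y * f y * g x)"
      by simp
    moreover have "(LINT x|lborel. ?M r x y * f y * g x) = f y * (LINT x|lborel. ?M r x y * g x)" for y
      by (subst integral_mult_right_zero[symmetric]) (simp add: mult_ac)
    moreover have "(LINT y|lborel. ?M r x y * f y * g x) = g x * (LINT y|lborel. ?M r y x * f y)" for x
      by (subst integral_mult_right_zero[symmetric]) (simp add: mult_ac mehler_sym[of _ x])
    ultimately show ?thesis by (simp only:)
  qed
  have "(LINT x|lborel. green f x * g x) = (LINT r|lborel. LINT y|lborel. f y * (LINT x|lborel. ?M r x y * g x))"
    using lborel_Fubini(1)[OF integral_green(3)[OF f(1) _ g(2)]] integral_green(2)[OF f(1) _ g(2)] by simp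
  also have "\<dots> = (LINT r|lborel. LINT x|lborel. g x * (LINT y|lborel. ?M r y x * f y))"
    unfolding swap ..
  also have "\<dots> = (LINT x|lborel. green g x * f x)"
    using lborel_Fubini(1)[OF integral_green(3)[OF g(1) _ f(2)]] integral_green(2)[OF g(1) _ f(2)] by simp
  finally show ?thesis by (simp add: mult.commute)
qed

lemma norm_gwave_pol_le: "norm (gwave_pol k (x::'a::euclidean_space)) \<le> (DIM('a) + (norm k)\<^sup>2 + 2 * norm k) * jbracket x"
proof -
  have "norm (gwave_pol k x) \<le> (DIM('a) + (norm k)\<^sup>2) + 2 * \<bar>k \<bullet> x\<bar>"
  proof -
    have "norm (gwave_pol k x) \<le> norm (complex_of_real (DIM('a) + (norm k)\<^sup>2)) + norm (2 * \<i> * complex_of_real (k \<bullet> x))"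
      unfolding gwave_pol_def by (rule norm_triangle_ineq)
    also have "norm (complex_of_real (DIM('a) + (norm k)\<^sup>2)) = DIM('a) + (norm k)\<^sup>2"
      by (simp only: norm_of_real) simp
    also have "norm (2 * \<i> * complex_of_real (k \<bullet> x)) = 2 * \<bar>k \<bullet> x\<bar>"
      by (simp add: norm_mult)
    finally show ?thesis .
  qed
  also have "\<dots> \<le> (DIM('a) + (norm k)\<^sup>2) * jbracket x + 2 * (norm k * jbracket x)"
    using Cauchy_Schwarz_ineq2[of k x] mult_left_mono[OF norm_le_jbracket[of x] norm_ge_zero[of k]]
      mult_left_mono[OF jbracket_ge_1[of x], of "DIM('a) + (norm k)\<^sup>2"] by simp
  finally show ?thesis by (simp add: algebra_simps)
qed

text \<open>\<open>integral_damp_gwave_pol\<close> writes the packet as an \<open>r\<close>-integral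
  of H applied to packets of frequency r^2 k. The hypothesis at all these frequencies replaces
  \<open>u\<close> by \<open>f\<close>, and \<open>mehler_gwave\<close> reassembles the result as
  \<open>green f\<close>. Only measurability and weighted integrability of \<open>u\<close> enter,
  so the lemma serves Schwartz functions and abstract weak solutions alike.\<close>

lemma gwave_moment_eq_green:
  fixes u f :: "'a::euclidean_space \<Rightarrow> complex"
  assumes um[measurable]: "u \<in> borel_measurable borel"
    and ui: "integrable lborel (\<lambda>x. norm (u x) * (jbracket x * exp (- (norm x)\<^sup>2 / 2)))"
    and f: "integrable lborel f"
    and eq: "\<And>k. (LINT x|lborel. u x * (gwave_pol k x * gwave 0 k x)) = (LINT x|lborel. f x * gwave 0 k x)"
  shows "(LINT x|lborel. u x * gwave 0 k x) = (LINT x|lborel. green f x * gwave 0 k x)"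
proof -
  have [measurable]: "f \<in> borel_measurable borel" using f by (auto dest: borel_measurable_integrable)
  let ?G = "\<lambda>r x. gwave 0 (r\<^sup>2 *\<^sub>R k) x" and ?P = "\<lambda>r x. gwave_pol (r\<^sup>2 *\<^sub>R k) x" and ?d = "\<lambda>r. complex_of_real (damp k r)"
  let ?F = "\<lambda>p. ?d (fst p) * (u (snd p) * (?P (fst p) (snd p) * ?G (fst p) (snd p)))"
  let ?C = "DIM('a) + (norm k)\<^sup>2 + 2 * norm k"
  have G1: "norm (?G r x) \<le> 1" for r x by (simp add: norm_gwave_0)
  have int: "integrable lborel ?F"
  proof (rule Bochner_Integration.integrable_bound)
    show "integrable lborel (\<lambda>p :: real \<times> 'a. ?C * (indicator {0<..<1} (fst p) * (norm (u (snd p)) * (jbracket (snd p) * exp (- (norm (snd p))\<^sup>2 / 2)))))"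
      by (intro integrable_mult_right integrable_tensor integrable_indicator_unit ui)
    show "?F \<in> borel_measurable lborel" unfolding gwave_pol_def gwave_def by measurable
    show "AE p in lborel. norm (?F p) \<le> norm (?C * (indicator {0<..<1} (fst p) * (norm (u (snd p)) * (jbracket (snd p) * exp (- (norm (snd p))\<^sup>2 / 2)))))"
    proof (rule AE_I2)
      fix p :: "real \<times> 'a"
      obtain r x where p: "p = (r, x)" by (cases p)
      show "norm (?F p) \<le> norm (?C * (indicator {0<..<1} (fst p) * (norm (u (snd p)) * (jbracket (snd p) * exp (- (norm (snd p))\<^sup>2 / 2)))))"
      proof (cases "r \<in> {0<..<1}")
        case True
        then have r2: "r\<^sup>2 \<le> 1" by (intro power_le_one) auto
        then have nk: "norm (r\<^sup>2 *\<^sub>R k) \<le> norm k" by (simp add: mult_left_le_one_le)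
        then have "(norm (r\<^sup>2 *\<^sub>R k))\<^sup>2 \<le> (norm k)\<^sup>2" by (intro power_mono) auto
        with nk have "DIM('a) + (norm (r\<^sup>2 *\<^sub>R k))\<^sup>2 + 2 * norm (r\<^sup>2 *\<^sub>R k) \<le> ?C" by linarith
        from mult_right_mono[OF this less_imp_le[OF jbracket_pos[of x]]]
        have "norm (?P r x) \<le> ?C * jbracket x"
          by (rule order_trans[OF norm_gwave_pol_le])
        then have "damp k r * (norm (u x) * (norm (?P r x) * norm (?G r x)))
            \<le> 1 * (norm (u x) * ((?C * jbracket x) * exp (- (norm x)\<^sup>2 / 2)))"
          using damp_bounds[of k r] True jbracket_pos[of x]
          by (intro mult_mono) (auto simp: norm_gwave_0)
        also have "\<dots> = ?C * (norm (u x) * (jbracket x * exp (- (norm x)\<^sup>2 / 2)))"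
          by (simp only: mult_ac mult_1)
        finally show ?thesis using True p damp_bounds(1)[of k r] jbracket_pos[of x]
          by (simp add: norm_mult abs_mult)
      qed (simp add: p damp_def)
    qed
  qed
  have int2: "integrable lborel (\<lambda>q. f (snd q) * (?d (fst q) * ?G (fst q) (snd q)))"
  proof (rule Bochner_Integration.integrable_bound)
    show "integrable lborel (\<lambda>q. indicator {0<..<1::real} (fst q) * norm (f (snd q)))"
      by (intro integrable_tensor integrable_indicator_unit integrable_norm f)
    show "(\<lambda>q. f (snd q) * (?d (fst q) * ?G (fst q) (snd q))) \<in> borel_measurable lborel"
      unfolding gwave_def by measurable
    show "AE q in lborel. norm (f (snd q) * (?d (fst q) * ?G (fst q) (snd q))) \<le> norm (indicator {0<..<1::real} (fst q) * norm (f (snd q)))"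
    proof (rule AE_I2)
      fix q :: "real \<times> 'a"
      have "norm (f (snd q)) * (damp k (fst q) * norm (?G (fst q) (snd q))) \<le> norm (f (snd q)) * (indicator {0<..<1::real} (fst q) * 1)"
        by (intro mult_left_mono mult_mono damp_bounds G1) auto
      then show "norm (f (snd q) * (?d (fst q) * ?G (fst q) (snd q))) \<le> norm (indicator {0<..<1::real} (fst q) * norm (f (snd q)))"
        using damp_bounds(1)[of k "fst q"] by (simp add: norm_mult abs_mult mult_ac)
    qed
  qed
  have "(LINT x|lborel. u x * gwave 0 k x) = (LINT x|lborel. LINT r|lborel. ?F (r, x))"
  proof (intro Bochner_Integration.integral_cong refl)
    fix x
    have "(LINT r|lborel. ?F (r, x)) = u x * (LINT r|lborel. ?d r * (?P r x * ?G r x))"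
      by (subst integral_mult_right_zero[symmetric]) (simp add: mult_ac)
    then show "u x * gwave 0 k x = (LINT r|lborel. ?F (r, x))"
      by (simp only: integral_damp_gwave_pol)
  qed
  also have "\<dots> = (LINT r|lborel. LINT x|lborel. ?F (r, x))"
    using lborel_Fubini(1,2)[OF int] by simp
  also have "\<dots> = (LINT r|lborel. LINT x|lborel. f x * (?d r * ?G r x))"
  proof (rule Bochner_Integration.integral_cong[OF refl])
    fix r
    have "(LINT x|lborel. ?F (r, x)) = ?d r * (LINT x|lborel. u x * (?P r x * ?G r x))"
      unfolding fst_conv snd_conv by (rule integral_mult_right_zero)
    also have "\<dots> = ?d r * (LINT x|lborel. f x * ?G r x)" unfolding eq ..
    also have "\<dots> = (LINT x|lborel. f x * (?d r * ?G r x))"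
      by (subst integral_mult_right_zero[symmetric]) (simp add: mult_ac)
    finally show "(LINT x|lborel. ?F (r, x)) = (LINT x|lborel. f x * (?d r * ?G r x))" .
  qed
  also have "\<dots> = (LINT q|lborel. f (snd q) * (?d (fst q) * ?G (fst q) (snd q)))"
    using lborel_Fubini(1)[OF int2] by simp
  also have "\<dots> = (LINT q|lborel. f (snd q) * (LINT x|lborel. complex_of_real (mehler (fst q) x (snd q)) * gwave 0 k x))"
    by (simp add: mehler_gwave mehler_sym[of _ _ "snd _"])
  also have "\<dots> = (LINT x|lborel. green f x * gwave 0 k x)"
    by (rule integral_green(2)[OF f gwave_measurable, symmetric, of 0 k 1]) (simp add: norm_gwave_0)
  finally show ?thesis .
qed

section \<open>Completeness of wave packets and weak solutions\<close>

text \<open>Fourier uniqueness is applied to \<open>D\<close> times a Gaussian, as \<open>D\<close>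
  itself may fail to be integrable. The Gaussian is undone by exp (|x|^2 / 2), truncated at level n
  + 1 to keep the test function bounded; dominated convergence removes the truncation.\<close>

lemma gwave_complete:
  fixes D f :: "'a::euclidean_space \<Rightarrow> complex"
  assumes Dm[measurable]: "D \<in> borel_measurable borel"
    and Di: "integrable lborel (\<lambda>x. D x * complex_of_real (exp (- (norm x)\<^sup>2 / 2)))"
    and f: "continuous_on UNIV f" and B: "\<And>x. norm (f x) \<le> B"
    and Df: "integrable lborel (\<lambda>x. D x * f x)"
    and zero: "\<And>k. (LINT x|lborel. D x * gwave 0 k x) = 0"
  shows "(LINT x|lborel. D x * f x) = 0"
proof -
  have [measurable]: "f \<in> borel_measurable borel" using f by (rule borel_measurable_continuous_onI)
  let ?e = "\<lambda>x::'a. exp (- (norm x)\<^sup>2 / 2)" and ?m = "\<lambda>n x::'a. min (exp ((norm x)\<^sup>2 / 2)) (real (Suc n))"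
  have B0: "B \<ge> 0" using order_trans[OF norm_ge_zero B] .
  have 0: "(LINT x|lborel. (D x * complex_of_real (?e x)) * (f x * complex_of_real (?m n x))) = 0" for n
  proof (rule fourier_uniqueness[OF Di])
    show "(LINT x|lborel. D x * complex_of_real (?e x) * iexp (k \<bullet> x)) = 0" for k
      using zero[of k] by (simp add: gwave_def mult.assoc)
    show "continuous_on UNIV (\<lambda>x. f x * complex_of_real (?m n x))"
      by (intro continuous_intros f) auto
    show "norm (f x * complex_of_real (?m n x)) \<le> B * Suc n" for x
      unfolding norm_mult by (intro mult_mono B B0) auto
  qed
  have "(\<lambda>n. LINT x|lborel. (D x * complex_of_real (?e x)) * (f x * complex_of_real (?m n x))) \<longlonglongrightarrow> (LINT x|lborel. D x * f x)"
  proof (rule integral_dominated_convergence[OF _ _ integrable_norm[OF Df]])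
    have e1: "?e x * ?m n x \<le> 1" "0 \<le> ?e x * ?m n x" for n x
    proof -
      have "?e x * ?m n x \<le> ?e x * exp ((norm x)\<^sup>2 / 2)" by (intro mult_left_mono) auto
      also have "\<dots> = 1" by (simp flip: exp_add)
      finally show "?e x * ?m n x \<le> 1" .
    qed simp
    have rw: "(D x * complex_of_real (?e x)) * (f x * complex_of_real (?m n x)) = complex_of_real (?e x * ?m n x) * (D x * f x)" for n x
      by simp
    show "AE x in lborel. norm ((D x * complex_of_real (?e x)) * (f x * complex_of_real (?m n x))) \<le> norm (D x * f x)" for n
    proof (rule AE_I2)
      fix x
      have "norm (complex_of_real (?e x * ?m n x) * (D x * f x)) = \<bar>?e x * ?m n x\<bar> * norm (D x * f x)"
        unfolding norm_mult[of "complex_of_real (?e x * ?m n x)"] norm_of_real ..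
      also have "\<dots> \<le> 1 * norm (D x * f x)"
        using e1 by (intro mult_right_mono) auto
      finally show "norm ((D x * complex_of_real (?e x)) * (f x * complex_of_real (?m n x))) \<le> norm (D x * f x)"
        unfolding rw by simp
    qed
    show "AE x in lborel. (\<lambda>n. (D x * complex_of_real (?e x)) * (f x * complex_of_real (?m n x))) \<longlonglongrightarrow> D x * f x"
    proof (rule AE_I2)
      fix x :: 'a
      obtain N :: nat where N: "exp ((norm x)\<^sup>2 / 2) \<le> real N"
        using real_arch_simple by blast
      have "(D x * complex_of_real (?e x)) * (f x * complex_of_real (?m n x)) = D x * f x" if "n \<ge> N" for n
      proof -
        have "?m n x = exp ((norm x)\<^sup>2 / 2)" using N that by simp
        then have "?e x * ?m n x = 1" by (simp flip: exp_add)
        then show ?thesis unfolding rw by simp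
      qed
      then show "(\<lambda>n. (D x * complex_of_real (?e x)) * (f x * complex_of_real (?m n x))) \<longlonglongrightarrow> D x * f x"
        by (intro tendsto_eventually) (auto simp: eventually_sequentially)
    qed
  qed measurable
  then show ?thesis unfolding 0 by (simp add: LIMSEQ_const_iff)
qed

lemma square_integrable_mult_integrable:
  fixes f g :: "'a::euclidean_space \<Rightarrow> complex"
  assumes f: "square_integrable f" and g: "square_integrable g"
  shows "integrable lborel (\<lambda>x. f x * g x)"
proof (rule Bochner_Integration.integrable_bound)
  show "integrable lborel (\<lambda>x. (norm (f x))\<^sup>2 + (norm (g x))\<^sup>2)"
    using f g by (auto simp: square_integrable_def)
  show "(\<lambda>x. f x * g x) \<in> borel_measurable lborel"
    using f g by (auto simp: square_integrable_def)
  have "norm (f x * g x) \<le> (norm (f x))\<^sup>2 + (norm (g x))\<^sup>2" for x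
    using sum_squares_bound[of "norm (f x)" "norm (g x)"] mult_nonneg_nonneg[OF norm_ge_zero[of "f x"] norm_ge_zero[of "g x"]]
    unfolding norm_mult by linarith
  then show "AE x in lborel. norm (f x * g x) \<le> norm ((norm (f x))\<^sup>2 + (norm (g x))\<^sup>2)"
    by (auto intro: order_trans[OF _ abs_ge_self])
qed

lemma rapidly_decreasing_square_integrable:
  assumes f: "rapidly_decreasing f" and m[measurable]: "f \<in> borel_measurable borel"
  shows "square_integrable f"
proof -
  obtain B where "\<And>x. norm (f x) \<le> B" by (rule rapidly_decreasing_bounded[OF f]) blast
  then have "integrable lborel (\<lambda>x. f x * f x)"
    by (intro rapidly_decreasing_integrable rapidly_decreasing_mult_bounded[OF f]) auto
  from integrable_norm[OF this] show ?thesis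
    by (simp add: square_integrable_def norm_mult power2_eq_square)
qed

lemma integrable_jbracket_gauss:
  fixes u :: "'a::euclidean_space \<Rightarrow> complex"
  assumes u: "square_integrable u"
  shows "integrable lborel (\<lambda>x. norm (u x) * (jbracket x * exp (- (norm x)\<^sup>2 / 2)))"
    "integrable lborel (\<lambda>x. u x * complex_of_real (exp (- (norm x)\<^sup>2 / 2)))"
proof -
  have jb: "norm (complex_of_real (jbracket x)) \<le> 1 * jbracket x ^ 1" for x :: 'a
    using jbracket_pos[of x] by simp
  have "square_integrable (\<lambda>x::'a. gwave 0 0 x * complex_of_real (jbracket x))"
    by (intro rapidly_decreasing_square_integrable rapidly_decreasing_mult[OF schwartz_rapid[OF gwave_schwartz] jb]) measurable
  from integrable_norm[OF square_integrable_mult_integrable[OF u this]]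
  show "integrable lborel (\<lambda>x. norm (u x) * (jbracket x * exp (- (norm x)\<^sup>2 / 2)))"
    by (simp add: norm_mult norm_gwave_0 less_imp_le[OF jbracket_pos] mult.commute)
  have "square_integrable (gwave 0 (0::'a))"
    by (intro rapidly_decreasing_square_integrable schwartz_rapid[OF gwave_schwartz]) measurable
  from square_integrable_mult_integrable[OF u this]
  show "integrable lborel (\<lambda>x. u x * complex_of_real (exp (- (norm x)\<^sup>2 / 2)))"
    by (simp add: gwave_def)
qed

lemma schwartz_square_integrable: "f \<in> schwartz \<Longrightarrow> square_integrable f"
  by (intro rapidly_decreasing_square_integrable schwartz_rapid schwartz_measurable)

text \<open>\<open>green f\<close> is bounded and integrable against bounded functions, so it may be
  tested against itself.\<close>

lemma green_square_integrable:
  assumes f: "integrable lborel f" "\<And>x. norm (f x) \<le> B"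
  shows "square_integrable (green f)"
proof -
  have fm[measurable]: "f \<in> borel_measurable borel" using f by (auto dest: borel_measurable_integrable)
  note gm[measurable] = green_measurable[OF fm]
  have "integrable lborel (\<lambda>x. green f x * green f x)"
    by (rule integral_green(1)[OF f(1) gm green_bounded[OF fm f(2)]])
  from integrable_norm[OF this] show ?thesis
    by (simp add: square_integrable_def norm_mult power2_eq_square)
qed

text \<open>Comparing packet moments shows that \<open>green\<close> undoes H: \<phi> and
  \<open>green (harmonic_osc \<phi>)\<close> have the same pairing with \<open>f\<close>. Symmetry
  of \<open>green\<close> then moves it to \<open>f\<close>, so a left inverse becomes a weak right
  inverse by duality.\<close>

lemma weak_green:
  assumes f: "f \<in> schwartz" and \<phi>: "\<phi> \<in> schwartz"
  shows "(LINT x|lborel. green f x * harmonic_osc \<phi> x) = (LINT x|lborel. f x * \<phi> x)"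
proof -
  note Hr = harmonic_osc_rapid[OF \<phi>]
  obtain A where A: "\<And>x. norm (f x) \<le> A" using rapidly_decreasing_bounded[OF schwartz_rapid[OF f]] by blast
  obtain B where B: "\<And>x. norm (harmonic_osc \<phi> x) \<le> B" using rapidly_decreasing_bounded[OF Hr(1)] by blast
  note sq = schwartz_square_integrable[OF \<phi>] green_square_integrable[OF Hr(3) B] schwartz_square_integrable[OF f]
  note gm = green_measurable[OF Hr(2)]
  have "(LINT x|lborel. \<phi> x * gwave 0 k x) = (LINT x|lborel. green (harmonic_osc \<phi>) x * gwave 0 k x)" for k
    by (rule gwave_moment_eq_green[OF schwartz_measurable[OF \<phi>] integrable_jbracket_gauss(1)[OF sq(1)] Hr(3)])
       (rule integral_harmonic_osc_gwave[OF \<phi>, symmetric])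
  then have "(LINT x|lborel. (\<phi> x - green (harmonic_osc \<phi>) x) * gwave 0 k x) = 0" for k
    using square_integrable_mult_integrable[OF sq(1) schwartz_square_integrable[OF gwave_schwartz[of 0 k]]]
      square_integrable_mult_integrable[OF sq(2) schwartz_square_integrable[OF gwave_schwartz[of 0 k]]]
    by (simp add: left_diff_distrib)
  then have "(LINT x|lborel. (\<phi> x - green (harmonic_osc \<phi>) x) * f x) = 0"
    using integrable_jbracket_gauss(2)[OF sq(1)] integrable_jbracket_gauss(2)[OF sq(2)]
      square_integrable_mult_integrable[OF sq(1) sq(3)] square_integrable_mult_integrable[OF sq(2) sq(3)] gm schwartz_measurable[OF \<phi>]
    by (intro gwave_complete[OF _ _ schwartz_continuous[OF f] A]) (auto simp: left_diff_distrib)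
  then have "(LINT x|lborel. \<phi> x * f x) = (LINT x|lborel. green (harmonic_osc \<phi>) x * f x)"
    using square_integrable_mult_integrable[OF sq(1) sq(3)] square_integrable_mult_integrable[OF sq(2) sq(3)]
    by (simp add: left_diff_distrib)
  then show ?thesis
    using green_symmetric[OF schwartz_integrable[OF f] A Hr(3) B] by (simp add: mult.commute)
qed

lemma harmonic_L2_green:
  assumes f: "f \<in> schwartz"
  shows "harmonic_L2 (green f) f"
proof -
  obtain A where A: "\<And>x. norm (f x) \<le> A" using rapidly_decreasing_bounded[OF schwartz_rapid[OF f]] by blast
  show ?thesis
    unfolding harmonic_L2_def distr_of_def
    using green_square_integrable[OF schwartz_integrable[OF f] A] schwartz_square_integrable[OF f] weak_green[OF f]
    by auto
qed

text \<open>\<open>SOME\<close> leaves nothing known about \<open>harmonic_inverse f\<close> but the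
  weak equation, and that only because \<open>harmonic_L2_green\<close> provides a solution. Packets
  are admissible in this equation, so the two solutions have equal packet moments, and completeness
  gives equal pairings with \<open>g\<close>.\<close>

lemma distr_of_harmonic_inverse:
  assumes f: "f \<in> schwartz" and g: "g \<in> schwartz"
  shows "distr_of (harmonic_inverse f) g = (LINT x|lborel. green f x * g x)"
proof -
  let ?v = "harmonic_inverse f"
  have v: "harmonic_L2 ?v f"
    unfolding harmonic_inverse_def by (rule someI[of _ "green f"]) (rule harmonic_L2_green[OF f])
  have gr: "harmonic_L2 (green f) f" by (rule harmonic_L2_green[OF f])
  have sq: "square_integrable ?v" "square_integrable (green f)" "square_integrable g"
    using v gr schwartz_square_integrable[OF g] by (auto simp: harmonic_L2_def)
  have [measurable]: "?v \<in> borel_measurable borel" "green f \<in> borel_measurable borel"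
    using sq by (auto simp: square_integrable_def)
  obtain B where B: "\<And>x. norm (g x) \<le> B" using rapidly_decreasing_bounded[OF schwartz_rapid[OF g]] by blast
  have "(LINT x|lborel. ?v x * gwave 0 k x) = (LINT x|lborel. green f x * gwave 0 k x)" for k
  proof (rule gwave_moment_eq_green[OF _ integrable_jbracket_gauss(1)[OF sq(1)] schwartz_integrable[OF f]])
    show "(LINT x|lborel. ?v x * (gwave_pol k x * gwave 0 k x)) = (LINT x|lborel. f x * gwave 0 k x)" for k
      using v gwave_schwartz[of 0 k] by (auto simp: harmonic_L2_def distr_of_def harmonic_osc_gwave)
  qed measurable
  then have "(LINT x|lborel. (?v x - green f x) * gwave 0 k x) = 0" for k
    using square_integrable_mult_integrable[OF sq(1) schwartz_square_integrable[OF gwave_schwartz[of 0 k]]]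
      square_integrable_mult_integrable[OF sq(2) schwartz_square_integrable[OF gwave_schwartz[of 0 k]]]
    by (simp add: left_diff_distrib)
  then have "(LINT x|lborel. (?v x - green f x) * g x) = 0"
    using integrable_jbracket_gauss(2)[OF sq(1)] integrable_jbracket_gauss(2)[OF sq(2)]
      square_integrable_mult_integrable[OF sq(1) sq(3)] square_integrable_mult_integrable[OF sq(2) sq(3)]
    by (intro gwave_complete[OF _ _ schwartz_continuous[OF g] B]) (auto simp: left_diff_distrib)
  then show ?thesis
    using square_integrable_mult_integrable[OF sq(1) sq(3)] square_integrable_mult_integrable[OF sq(2) sq(3)]
    by (simp add: left_diff_distrib distr_of_def)
qed

section \<open>Cross-Wigner functions\<close>

lemma nn_integral_lborel_shift:
  fixes f :: "'a::euclidean_space \<Rightarrow> ennreal"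
  assumes [measurable]: "f \<in> borel_measurable borel"
  shows "(\<integral>\<^sup>+x. f (x + c) \<partial>lborel) = (\<integral>\<^sup>+x. f x \<partial>lborel)"
proof -
  have "(\<integral>\<^sup>+x. f x \<partial>lborel) = (\<integral>\<^sup>+x. f x \<partial>distr lborel borel ((+) c))"
    by (simp add: lborel_distr_plus)
  also have "\<dots> = (\<integral>\<^sup>+x. f (c + x) \<partial>lborel)"
    by (rule nn_integral_distr) auto
  finally show ?thesis by (simp add: add.commute)
qed

text \<open>On each fibre with fixed second component the shear is a translation.\<close>

lemma distr_lborel_shear:
  fixes L :: "'b::euclidean_space \<Rightarrow> 'a::euclidean_space"
  assumes [measurable]: "L \<in> borel_measurable borel"
  shows "distr lborel borel (\<lambda>p. (fst p + L (snd p), snd p)) = lborel"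
proof (rule measure_eqI)
  let ?S = "\<lambda>p. (fst p + L (snd p), snd p)"
  have [measurable]: "?S \<in> borel_measurable (borel :: ('a \<times> 'b) measure)" by measurable
  fix A assume "A \<in> sets (distr lborel borel ?S)"
  then have [measurable]: "A \<in> sets borel" by simp
  have m: "(\<lambda>p. indicator A (?S p) :: ennreal) \<in> borel_measurable borel" by measurable
  have "emeasure (distr lborel borel ?S) A = (\<integral>\<^sup>+p. indicator A p \<partial>distr lborel borel ?S)" by simp
  also have "\<dots> = (\<integral>\<^sup>+p. indicator A (?S p) \<partial>lborel)"
    by (rule nn_integral_distr) auto
  also have "\<dots> = (\<integral>\<^sup>+y. \<integral>\<^sup>+x. indicator A (?S (x, y)) \<partial>lborel \<partial>lborel)"
    using lborel_pair.nn_integral_snd[of "\<lambda>p. indicator A (?S p)"] m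
    by (simp add: lborel_prod split_def)
  also have "\<dots> = (\<integral>\<^sup>+y. \<integral>\<^sup>+x. indicator A (x, y) \<partial>lborel \<partial>lborel)"
  proof (rule nn_integral_cong)
    fix y
    have "(\<lambda>x. indicator A (x, y) :: ennreal) \<in> borel_measurable borel" by measurable
    from nn_integral_lborel_shift[OF this, of "L y"]
    show "(\<integral>\<^sup>+x. indicator A (?S (x, y)) \<partial>lborel) = (\<integral>\<^sup>+x. indicator A (x, y) \<partial>lborel)" by simp
  qed
  also have "\<dots> = (\<integral>\<^sup>+p. indicator A p \<partial>lborel)"
    using lborel_pair.nn_integral_snd[of "indicator A"]
    by (simp add: lborel_prod split_def)
  finally show "emeasure (distr lborel borel ?S) A = emeasure lborel A" by simp
qed simp

lemma distr_lborel_swap: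
  "distr lborel borel (\<lambda>p::'a::euclidean_space \<times> 'b::euclidean_space. (snd p, fst p)) = lborel"
proof -
  have "lborel \<Otimes>\<^sub>M lborel = distr (lborel \<Otimes>\<^sub>M lborel) (lborel \<Otimes>\<^sub>M lborel) (\<lambda>(x::'a, y::'b). (y, x))"
    by (rule lborel_pair.distr_pair_swap)
  also have "\<dots> = distr lborel borel (\<lambda>p::'a \<times> 'b. (snd p, fst p))"
    unfolding lborel_prod by (rule distr_cong) auto
  finally show ?thesis by (simp add: lborel_prod)
qed

text \<open>The substitution \<open>z = (1 - t) x + t y\<close>, \<open>w = x - y\<close> as a product of two shears and a swap.\<close>

lemma distr_lborel_symbol_coordinates:
  "distr lborel borel (\<lambda>q::'a::euclidean_space \<times> 'a. (fst q + t *\<^sub>R snd q, fst q - (1 - t) *\<^sub>R snd q)) = lborel"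
proof -
  let ?S1 = "\<lambda>p::'a \<times> 'a. (fst p + (- (1 - t) *\<^sub>R snd p), snd p)"
  let ?S2 = "\<lambda>p::'a \<times> 'a. (fst p + snd p, snd p)"
  let ?W = "\<lambda>p::'a \<times> 'a. (snd p, fst p)"
  have m: "?S2 \<in> measurable borel borel" "?W \<in> measurable borel borel" "?S1 \<in> measurable lborel borel"
    "?W \<circ> ?S1 \<in> measurable lborel borel"
    unfolding o_def by measurable
  have "lborel = distr lborel borel ?S2"
    by (rule distr_lborel_shear[symmetric]) measurable
  also have "\<dots> = distr (distr lborel borel ?W) borel ?S2"
    by (simp only: distr_lborel_swap)
  also have "\<dots> = distr (distr (distr lborel borel ?S1) borel ?W) borel ?S2"
    using distr_lborel_shear[of "\<lambda>w::'a. - (1 - t) *\<^sub>R w"] by simp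
  also have "\<dots> = distr (distr lborel borel (?W \<circ> ?S1)) borel ?S2"
    by (simp only: distr_distr[OF m(2,3)])
  also have "\<dots> = distr lborel borel (?S2 \<circ> (?W \<circ> ?S1))"
    by (simp only: distr_distr[OF m(1,4)])
  also have "?S2 \<circ> (?W \<circ> ?S1) = (\<lambda>q. (fst q + t *\<^sub>R snd q, fst q - (1 - t) *\<^sub>R snd q))"
    by (auto simp: fun_eq_iff algebra_simps)
  finally show ?thesis ..
qed

lemma integral_symbol_coordinates:
  fixes F :: "'a::euclidean_space \<times> 'a \<Rightarrow> complex"
  assumes [measurable]: "F \<in> borel_measurable borel"
  shows "(LINT p|lborel. F p) = (LINT q|lborel. F (fst q + t *\<^sub>R snd q, fst q - (1 - t) *\<^sub>R snd q))"
    and "integrable lborel F \<longleftrightarrow> integrable lborel (\<lambda>q. F (fst q + t *\<^sub>R snd q, fst q - (1 - t) *\<^sub>R snd q))"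
proof -
  let ?M = "\<lambda>q::'a \<times> 'a. (fst q + t *\<^sub>R snd q, fst q - (1 - t) *\<^sub>R snd q)"
  have m: "?M \<in> measurable lborel borel" by measurable
  have "(LINT p|lborel. F p) = (LINT p|distr lborel borel ?M. F p)"
    by (simp only: distr_lborel_symbol_coordinates)
  also have "\<dots> = (LINT q|lborel. F (?M q))"
    by (rule integral_distr[OF m]) simp
  finally show "(LINT p|lborel. F p) = (LINT q|lborel. F (?M q))" .
  have "integrable lborel F \<longleftrightarrow> integrable (distr lborel borel ?M) F"
    by (simp only: distr_lborel_symbol_coordinates)
  also have "\<dots> \<longleftrightarrow> integrable lborel (\<lambda>q. F (?M q))"
    by (rule integrable_distr_eq[OF m]) simp
  finally show "integrable lborel F \<longleftrightarrow> integrable lborel (\<lambda>q. F (?M q))" .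
qed

lemma borel_measurable_LINT:
  fixes F :: "'a::euclidean_space \<times> 'b::euclidean_space \<Rightarrow> complex"
  assumes F: "F \<in> borel_measurable borel"
  shows "(\<lambda>x. LINT y|lborel. F (x, y)) \<in> borel_measurable borel"
proof (rule lborel.borel_measurable_lebesgue_integral)
  have "F \<in> borel_measurable (lborel \<Otimes>\<^sub>M lborel)"
    using F by (simp add: lborel_prod)
  then show "(\<lambda>(x, y). F (x, y)) \<in> borel_measurable (borel \<Otimes>\<^sub>M lborel)"
    by (simp add: split_def cong: measurable_cong_sets sets_pair_measure_cong)
qed

text \<open>With z = (1 - t) x + t y and w = x - y one has x = z + t w and y = z - (1 - t) w, so
  formally \<open>Op t a f g\<close> is (2 pi)^(-d) times the integral of \<open>a\<close> against
  this function. The pairing is bilinear, hence there is no conjugate.\<close>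

definition cross_wigner :: "real \<Rightarrow> ('a::euclidean_space \<Rightarrow> complex) \<Rightarrow> ('a \<Rightarrow> complex) \<Rightarrow> 'a \<Rightarrow> 'a \<Rightarrow> complex" where
  "cross_wigner t f g z \<xi> = (LINT w|lborel. f (z - (1 - t) *\<^sub>R w) * g (z + t *\<^sub>R w) * iexp (w \<bullet> \<xi>))"

text \<open>Both \<open>z\<close> and \<open>w\<close> are linear combinations of the two arguments,
  so each of their weights is at most a constant times the product of the weights of the arguments.
  Decay of order 2n in \<open>f\<close> and \<open>g\<close> then pays for order n in
  \<open>z\<close> and order n in \<open>w\<close>.\<close>

lemma tensor_decay:
  fixes f g :: "'a::euclidean_space \<Rightarrow> complex"
  assumes f: "rapidly_decreasing f" and g: "rapidly_decreasing g"
  obtains C where "C \<ge> 0" "\<And>z w. norm (f (z - (1 - t) *\<^sub>R w) * g (z + t *\<^sub>R w)) \<le>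
    C * inverse (jbracket z ^ (2 * DIM('a))) * inverse (jbracket w ^ (2 * DIM('a)))"
proof -
  let ?n = "2 * DIM('a)"
  obtain A where A: "A \<ge> 0" "\<And>x. norm (f x) \<le> A * inverse (jbracket x ^ (2 * ?n))"
    using rapidly_decreasingE[OF f] by blast
  obtain B where B: "B \<ge> 0" "\<And>x. norm (g x) \<le> B * inverse (jbracket x ^ (2 * ?n))"
    using rapidly_decreasingE[OF g] by blast
  \<comment> \<open>One constant for both comparisons: its factors bound the weight of
    \<open>z\<close>, and \<open>K \<ge> 2\<close> suffices for \<open>w\<close>.\<close>
  define K where "K = 2 * (1 + \<bar>1 - t\<bar>) * (1 + \<bar>t\<bar>)"
  have "1 * 1 \<le> (1 + \<bar>1 - t\<bar>) * (1 + \<bar>t\<bar>)" by (intro mult_mono) auto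
  then have K2: "K \<ge> 2" unfolding K_def mult.assoc by linarith
  have "norm (f (z - (1 - t) *\<^sub>R w) * g (z + t *\<^sub>R w)) \<le>
     (A * B * K ^ (2 * ?n)) * inverse (jbracket z ^ ?n) * inverse (jbracket w ^ ?n)" for z w
  proof -
    define x y where "x = z + t *\<^sub>R w" and "y = z - (1 - t) *\<^sub>R w"
    have z: "z = (1 - t) *\<^sub>R x + t *\<^sub>R y" and w: "w = x + - y"
      by (simp_all add: x_def y_def algebra_simps)
    have pos: "jbracket x > 0" "jbracket y > 0" "jbracket z > 0" "jbracket w > 0"
      by (rule jbracket_pos)+
    have "jbracket z \<le> 2 * jbracket ((1 - t) *\<^sub>R x) * jbracket (t *\<^sub>R y)"
      unfolding z by (rule jbracket_add_le)
    also have "\<dots> \<le> 2 * ((1 + \<bar>1 - t\<bar>) * jbracket x) * ((1 + \<bar>t\<bar>) * jbracket y)"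
      by (intro mult_mono mult_left_mono jbracket_scaleR_le) (auto simp: less_imp_le[OF jbracket_pos])
    also have "\<dots> = K * (jbracket x * jbracket y)" by (simp add: K_def)
    finally have z1: "jbracket z \<le> K * (jbracket x * jbracket y)" .
    have "jbracket w \<le> 2 * (jbracket x * jbracket y)"
      unfolding w using jbracket_add_le[of x "- y"] by (simp add: mult.assoc)
    also have "\<dots> \<le> K * (jbracket x * jbracket y)"
      using K2 pos by (intro mult_right_mono) auto
    finally have w1: "jbracket w \<le> K * (jbracket x * jbracket y)" .
    have "jbracket z ^ ?n * jbracket w ^ ?n \<le> (K * (jbracket x * jbracket y)) ^ ?n * (K * (jbracket x * jbracket y)) ^ ?n"
      by (intro mult_mono power_mono z1 w1) (use pos K2 in auto)
    also have "\<dots> = K ^ (2 * ?n) * (jbracket x ^ (2 * ?n) * jbracket y ^ (2 * ?n))"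
    proof -
      have "(k * (a * b)) ^ n * (k * (a * b)) ^ n = k ^ (2 * n) * (a ^ (2 * n) * b ^ (2 * n))" for k a b :: real and n :: nat
        by (simp add: power_mult_distrib mult_2 power_add)
      then show ?thesis .
    qed
    finally have le: "jbracket z ^ ?n * jbracket w ^ ?n \<le> K ^ (2 * ?n) * (jbracket x ^ (2 * ?n) * jbracket y ^ (2 * ?n))" .
    have inv: "inverse b \<le> k * inverse a" if "a \<le> k * b" "a > 0" "b > 0" for a b k :: real
      using that by (simp add: field_simps)
    have le': "inverse (jbracket x ^ (2 * ?n) * jbracket y ^ (2 * ?n)) \<le> K ^ (2 * ?n) * inverse (jbracket z ^ ?n * jbracket w ^ ?n)"
      by (rule inv[OF le]) (use pos in auto)
    have "norm (f y * g x) \<le> (A * inverse (jbracket y ^ (2 * ?n))) * (B * inverse (jbracket x ^ (2 * ?n)))"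
      unfolding norm_mult by (intro mult_mono A B) (use A B pos in auto)
    also have "\<dots> = (A * B) * inverse (jbracket x ^ (2 * ?n) * jbracket y ^ (2 * ?n))"
      by (simp add: inverse_mult_distrib mult_ac)
    also have "\<dots> \<le> (A * B) * (K ^ (2 * ?n) * inverse (jbracket z ^ ?n * jbracket w ^ ?n))"
      by (intro mult_left_mono le') (use A B in auto)
    finally show ?thesis unfolding x_def y_def by (simp add: inverse_mult_distrib mult_ac)
  qed
  moreover have "A * B * K ^ (2 * ?n) \<ge> 0" using A B K2 by simp
  ultimately show thesis using that by blast
qed

lemma cross_wigner_decay0:
  fixes f g :: "'a::euclidean_space \<Rightarrow> complex"
  assumes f: "rapidly_decreasing f" and g: "rapidly_decreasing g"
    and [measurable]: "f \<in> borel_measurable borel" "g \<in> borel_measurable borel"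
  obtains C where "C \<ge> 0" "\<And>z \<xi>. norm (cross_wigner t f g z \<xi>) \<le> C * inverse (jbracket z ^ (2 * DIM('a)))"
proof -
  let ?n = "2 * DIM('a)"
  obtain C where C: "C \<ge> 0" "\<And>z w. norm (f (z - (1 - t) *\<^sub>R w) * g (z + t *\<^sub>R w)) \<le>
    C * inverse (jbracket z ^ ?n) * inverse (jbracket w ^ ?n)"
    by (rule tensor_decay[OF f g, where t = t]) blast
  let ?I = "LINT w|lborel. inverse (jbracket (w::'a) ^ ?n)"
  have ij: "integrable lborel (\<lambda>w::'a. inverse (jbracket w ^ ?n))" by (rule integrable_jbracket) simp
  have "norm (cross_wigner t f g z \<xi>) \<le> (C * ?I) * inverse (jbracket z ^ ?n)" for z \<xi>
  proof -
    have i: "integrable lborel (\<lambda>w::'a. (C * inverse (jbracket z ^ ?n)) * inverse (jbracket w ^ ?n))"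
      by (intro integrable_mult_right ij)
    have "norm (cross_wigner t f g z \<xi>) \<le> (LINT w|lborel. (C * inverse (jbracket z ^ ?n)) * inverse (jbracket (w::'a) ^ ?n))"
      unfolding cross_wigner_def
    proof (rule Bochner_Integration.integral_norm_bound_integral[OF _ i])
      show b: "norm (f (z - (1 - t) *\<^sub>R w) * g (z + t *\<^sub>R w) * iexp (w \<bullet> \<xi>)) \<le> (C * inverse (jbracket z ^ ?n)) * inverse (jbracket w ^ ?n)" for w
        using C(2)[of z w] by (simp add: norm_mult)
      show "integrable lborel (\<lambda>w. f (z - (1 - t) *\<^sub>R w) * g (z + t *\<^sub>R w) * iexp (w \<bullet> \<xi>))"
        by (rule Bochner_Integration.integrable_bound[OF i]) (measurable, use order_trans[OF b abs_ge_self] in auto)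
    qed
    also have "\<dots> = (C * ?I) * inverse (jbracket z ^ ?n)" by simp
    finally show ?thesis .
  qed
  moreover have "?I \<ge> 0" by (intro Bochner_Integration.integral_nonneg) (simp add: less_imp_le[OF jbracket_pos])
  ultimately show thesis using that[of "C * ?I"] C(1) by simp
qed

section \<open>Frequency decay of cross-Wigner functions\<close>

lemma has_vector_derivative_line_scaled:
  fixes f :: "'a::real_normed_vector \<Rightarrow> complex"
  assumes d: "\<And>x. ((\<lambda>s. f (x + s *\<^sub>R v)) has_vector_derivative f' x) (at 0)"
  shows "((\<lambda>s. f (x + c *\<^sub>R (s *\<^sub>R v))) has_vector_derivative of_real c * f' x) (at 0)"
proof -
  have "((\<lambda>s. c * s) has_vector_derivative c) (at 0)"
    by (auto intro!: derivative_eq_intros)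
  moreover have "((\<lambda>s. f (x + s *\<^sub>R v)) has_vector_derivative f' x) (at (c * 0))"
    using d[of x] by simp
  ultimately have "((\<lambda>s. f (x + s *\<^sub>R v)) \<circ> (\<lambda>s. c * s) has_vector_derivative c *\<^sub>R f' x) (at 0)"
    by (rule vector_diff_chain_at)
  then show ?thesis by (simp add: o_def scaleR_conv_of_real)
qed

text \<open>The factor \<open>\<i> * (\<xi> \<bullet> j)\<close> is a derivative of the exponential
  in \<open>w\<close>. Integration by parts puts it on \<open>f\<close> and \<open>g\<close>, whose
  arguments depend on \<open>w\<close> through the factors - (1 - t) and t.\<close>

lemma cross_wigner_by_parts:
  fixes f g f' g' :: "'a::euclidean_space \<Rightarrow> complex"
  assumes df: "\<And>x. ((\<lambda>s. f (x + s *\<^sub>R j)) has_vector_derivative f' x) (at 0)"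
    and dg: "\<And>x. ((\<lambda>s. g (x + s *\<^sub>R j)) has_vector_derivative g' x) (at 0)"
    and r: "rapidly_decreasing f" "rapidly_decreasing g" "rapidly_decreasing f'" "rapidly_decreasing g'"
    and m[measurable]: "f \<in> borel_measurable borel" "g \<in> borel_measurable borel"
       "f' \<in> borel_measurable borel" "g' \<in> borel_measurable borel"
    and j: "j \<in> Basis"
  shows "\<i> * complex_of_real (\<xi> \<bullet> j) * cross_wigner t f g z \<xi>
    = of_real (1 - t) * cross_wigner t f' g z \<xi> - of_real t * cross_wigner t f g' z \<xi>"
proof -
  let ?n = "2 * DIM('a)"
  let ?T = "\<lambda>f g w. f (z - (1 - t) *\<^sub>R w) * g (z + t *\<^sub>R w)" and ?e = "\<lambda>w. iexp (w \<bullet> \<xi>)"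
  let ?F' = "\<lambda>w. of_real (- (1 - t)) * ?T f' g w + of_real t * ?T f g' w"
  have bd: "\<exists>C. \<forall>w. norm (?T f g w) \<le> C * inverse (jbracket w ^ ?n)"
    if "rapidly_decreasing f" "rapidly_decreasing g" for f g :: "'a \<Rightarrow> complex"
    by (rule tensor_decay[OF that, where t = t]) blast
  obtain A where A: "\<And>w. norm (?T f g w) \<le> A * inverse (jbracket w ^ ?n)" using bd[OF r(1,2)] by blast
  obtain B where B: "\<And>w. norm (?T f' g w) \<le> B * inverse (jbracket w ^ ?n)" using bd[OF r(3,2)] by blast
  obtain C where C: "\<And>w. norm (?T f g' w) \<le> C * inverse (jbracket w ^ ?n)" using bd[OF r(1,4)] by blast
  have A0: "A \<ge> 0" using order_trans[OF norm_ge_zero A[of 0]] by (simp add: jbracket_def)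
  have B0: "B \<ge> 0" using order_trans[OF norm_ge_zero B[of 0]] by (simp add: jbracket_def)
  have C0: "C \<ge> 0" using order_trans[OF norm_ge_zero C[of 0]] by (simp add: jbracket_def)
  \<comment> \<open>Dominates all three products of the integration by parts; it may depend on
    \<xi>, which is fixed here.\<close>
  define M where "M = A * (1 + norm \<xi>) + (\<bar>1 - t\<bar> * B + \<bar>t\<bar> * C)"
  have I: "inverse (jbracket (w::'a) ^ ?n) \<ge> 0" for w using jbracket_pos[of w] by simp
  have nj: "norm j = 1" using j by simp
  have dF: "((\<lambda>s. ?T f g (w + s *\<^sub>R j)) has_vector_derivative ?F' w) (at 0)" for w
  proof -
    have 1: "((\<lambda>s. f ((z - (1 - t) *\<^sub>R w) + (- (1 - t)) *\<^sub>R (s *\<^sub>R j))) has_vector_derivative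
        of_real (- (1 - t)) * f' (z - (1 - t) *\<^sub>R w)) (at 0)"
      by (rule has_vector_derivative_line_scaled[OF df])
    have 2: "((\<lambda>s. g ((z + t *\<^sub>R w) + t *\<^sub>R (s *\<^sub>R j))) has_vector_derivative of_real t * g' (z + t *\<^sub>R w)) (at 0)"
      by (rule has_vector_derivative_line_scaled[OF dg])
    have e1: "(z - (1 - t) *\<^sub>R w) + (- (1 - t)) *\<^sub>R (s *\<^sub>R j) = z - (1 - t) *\<^sub>R (w + s *\<^sub>R j)" for s
      by (simp add: algebra_simps)
    have e2: "(z + t *\<^sub>R w) + t *\<^sub>R (s *\<^sub>R j) = z + t *\<^sub>R (w + s *\<^sub>R j)" for s
      by (simp only: scaleR_add_right add.assoc)
    have "((\<lambda>s. ?T f g (w + s *\<^sub>R j)) has_vector_derivative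
        f (z - (1 - t) *\<^sub>R (w + 0 *\<^sub>R j)) * (of_real t * g' (z + t *\<^sub>R w)) + (of_real (- (1 - t)) * f' (z - (1 - t) *\<^sub>R w)) * g (z + t *\<^sub>R (w + 0 *\<^sub>R j))) (at 0)"
      by (rule has_vector_derivative_mult[OF 1[unfolded e1] 2[unfolded e2]])
    then show ?thesis by (simp add: mult_ac add.commute)
  qed
  have de: "((\<lambda>s. ?e (w + s *\<^sub>R j)) has_vector_derivative \<i> * complex_of_real (\<xi> \<bullet> j) * ?e w) (at 0)" for w
  proof -
    have "((\<lambda>s. \<i> * complex_of_real (w \<bullet> \<xi> + s * (j \<bullet> \<xi>))) has_vector_derivative \<i> * complex_of_real (\<xi> \<bullet> j)) (at 0)"
      unfolding has_vector_derivative_complex_iff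
      by (auto intro!: derivative_eq_intros simp: inner_commute)
    from field_vector_diff_chain_at[OF this DERIV_exp]
    show ?thesis by (simp add: o_def inner_add_left)
  qed
  have MA: "A * inverse (jbracket w ^ ?n) \<le> M * inverse (jbracket w ^ ?n)" for w :: 'a
    using A0 B0 C0 I mult_nonneg_nonneg[OF A0 norm_ge_zero[of \<xi>]]
    by (intro mult_right_mono) (auto simp: M_def distrib_left)
  have b1: "norm (?T f g w * ?e w) \<le> M * inverse (jbracket w ^ ?n)" for w
    using order_trans[OF A MA, of w] by (simp add: norm_mult)
  have b2: "norm (?F' w * ?e w) \<le> M * inverse (jbracket w ^ ?n)" for w
  proof -
    have "norm (?F' w) \<le> \<bar>1 - t\<bar> * norm (?T f' g w) + \<bar>t\<bar> * norm (?T f g' w)"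
      using norm_triangle_ineq[of "of_real (- (1 - t)) * ?T f' g w" "of_real t * ?T f g' w"]
      unfolding norm_mult[of "of_real _"] norm_of_real by (simp add: abs_minus_commute)
    also have "\<dots> \<le> \<bar>1 - t\<bar> * (B * inverse (jbracket w ^ ?n)) + \<bar>t\<bar> * (C * inverse (jbracket w ^ ?n))"
      by (intro add_mono mult_left_mono B C abs_ge_zero)
    also have "\<dots> = (\<bar>1 - t\<bar> * B + \<bar>t\<bar> * C) * inverse (jbracket w ^ ?n)"
      by (simp add: distrib_right)
    also have "\<dots> \<le> M * inverse (jbracket w ^ ?n)"
      using A0 I by (intro mult_right_mono) (auto simp: M_def)
    finally show ?thesis unfolding norm_mult[of "?F' w"] by simp
  qed
  have b3: "norm (?T f g w * (\<i> * complex_of_real (\<xi> \<bullet> j) * ?e w)) \<le> M * inverse (jbracket w ^ ?n)" for w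
  proof -
    have "norm (?T f g w * (\<i> * complex_of_real (\<xi> \<bullet> j) * ?e w)) = norm (?T f g w) * \<bar>\<xi> \<bullet> j\<bar>"
      by (simp add: norm_mult)
    also have "\<dots> \<le> (A * inverse (jbracket w ^ ?n)) * (1 + norm \<xi>)"
      using Basis_le_norm[OF j, of \<xi>] A0 I by (intro mult_mono A) auto
    also have "\<dots> = A * (1 + norm \<xi>) * inverse (jbracket w ^ ?n)" by (simp add: mult_ac)
    also have "\<dots> \<le> M * inverse (jbracket w ^ ?n)"
      using B0 C0 I by (intro mult_right_mono) (auto simp: M_def)
    finally show ?thesis .
  qed
  have "(LINT w|lborel. ?F' w * ?e w) = - (LINT w|lborel. ?T f g w * (\<i> * complex_of_real (\<xi> \<bullet> j) * ?e w))"
    by (rule integral_by_parts_partial(3)[OF dF de nj _ _ _ _ b1 b2 b3]) measurable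
  also have "(LINT w|lborel. ?T f g w * (\<i> * complex_of_real (\<xi> \<bullet> j) * ?e w)) = \<i> * complex_of_real (\<xi> \<bullet> j) * cross_wigner t f g z \<xi>"
    unfolding cross_wigner_def by (subst integral_mult_right_zero[symmetric]) (simp add: mult_ac)
  finally have *: "(LINT w|lborel. ?F' w * ?e w) = - (\<i> * complex_of_real (\<xi> \<bullet> j) * cross_wigner t f g z \<xi>)" .
  have int: "integrable lborel (\<lambda>w. ?T f g w * ?e w)"
    if h: "f \<in> borel_measurable borel" "g \<in> borel_measurable borel" "rapidly_decreasing f" "rapidly_decreasing g" for f g :: "'a \<Rightarrow> complex"
  proof -
    note [measurable] = h(1,2)
    obtain A where A: "\<And>w. norm (?T f g w) \<le> A * inverse (jbracket w ^ ?n)" using bd[OF h(3,4)] by blast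
    show ?thesis
    proof (rule Bochner_Integration.integrable_bound)
      show "integrable lborel (\<lambda>w::'a. A * inverse (jbracket w ^ ?n))"
        by (intro integrable_mult_right integrable_jbracket) simp
      show "AE w in lborel. norm (?T f g w * ?e w) \<le> norm (A * inverse (jbracket w ^ ?n))"
        using order_trans[OF A abs_ge_self] by (intro AE_I2) (simp add: norm_mult)
    qed measurable
  qed
  have "(LINT w|lborel. ?F' w * ?e w) = (LINT w|lborel. of_real (- (1 - t)) * (?T f' g w * ?e w) + of_real t * (?T f g' w * ?e w))"
    by (simp add: algebra_simps)
  also have "\<dots> = of_real (- (1 - t)) * cross_wigner t f' g z \<xi> + of_real t * cross_wigner t f g' z \<xi>"
    unfolding cross_wigner_def
    by (subst Bochner_Integration.integral_add)
       (auto intro!: integrable_mult_right int r m)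
  finally show ?thesis using * by (simp add: algebra_simps)
qed

text \<open>Controls only derivatives that apply the directions of \<open>ps\<close> in list order,
  the last one innermost. \<open>part_schwartz_snoc\<close> strips that innermost direction after
  any number of derivatives in it.\<close>

definition part_schwartz :: "'a::euclidean_space list \<Rightarrow> ('a \<Rightarrow> complex) \<Rightarrow> bool" where
  "part_schwartz ps f \<longleftrightarrow> (\<forall>\<alpha>. foldr (\<lambda>i. partial_deriv i ^^ \<alpha> i) ps f differentiable_on UNIV \<and>
     rapidly_decreasing (foldr (\<lambda>i. partial_deriv i ^^ \<alpha> i) ps f))"

lemma schwartz_part_schwartz:
  assumes "f \<in> schwartz"
  shows "part_schwartz basis_enum f"
  unfolding part_schwartz_def mderiv_def[symmetric]
proof (intro allI conjI schwartz_mderiv_rapidly_decreasing[OF assms])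
  fix \<alpha>
  obtain vs where "mderiv \<alpha> f = foldr partial_deriv vs f" "vs \<in> lists Basis"
    by (rule mderiv_eq_foldr)
  then show "mderiv \<alpha> f differentiable_on UNIV"
    using assms smooth_foldr_differentiable by (auto simp: schwartz_def)
qed

lemma part_schwartz_0:
  assumes "part_schwartz ps f"
  shows "f differentiable_on UNIV" "rapidly_decreasing f" "f \<in> borel_measurable borel"
proof -
  have "foldr (\<lambda>i. partial_deriv i ^^ (0::nat)) bs f = f" for bs
    by (induction bs) auto
  then show "f differentiable_on UNIV" "rapidly_decreasing f"
    using spec[OF assms[unfolded part_schwartz_def], of "\<lambda>_. 0"] by auto
  then show "f \<in> borel_measurable borel"
    by (intro borel_measurable_continuous_onI differentiable_imp_continuous_on)
qed

lemma part_schwartz_snoc: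
  assumes f: "part_schwartz (ps @ [j]) f" and j: "j \<notin> set ps"
  shows "part_schwartz ps ((partial_deriv j ^^ n) f)"
  unfolding part_schwartz_def
proof
  fix \<alpha>
  let ?\<alpha> = "\<alpha>(j := n)"
  have "foldr (\<lambda>i. partial_deriv i ^^ ?\<alpha> i) (ps @ [j]) f = foldr (\<lambda>i. partial_deriv i ^^ ?\<alpha> i) ps ((partial_deriv j ^^ n) f)"
    by simp
  also have "\<dots> = foldr (\<lambda>i. partial_deriv i ^^ \<alpha> i) ps ((partial_deriv j ^^ n) f)"
    by (rule foldr_cong) (use j in auto)
  finally show "foldr (\<lambda>i. partial_deriv i ^^ \<alpha> i) ps ((partial_deriv j ^^ n) f) differentiable_on UNIV \<and>
     rapidly_decreasing (foldr (\<lambda>i. partial_deriv i ^^ \<alpha> i) ps ((partial_deriv j ^^ n) f))"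
    using f unfolding part_schwartz_def by metis
qed

text \<open>Differentiating along the coordinates in the reverse order of the enumeration
  keeps all derivatives in the form \<open>mderiv\<close>, so that no symmetry of mixed derivatives is needed.\<close>

lemma cross_wigner_decay:
  fixes f g :: "'a::euclidean_space \<Rightarrow> complex"
  assumes "distinct ps" "set ps \<subseteq> Basis" "part_schwartz ps f" "part_schwartz ps g"
  shows "\<exists>C\<ge>0. \<forall>z \<xi>. (\<Prod>j\<in>set ps. 1 + (\<xi> \<bullet> j)\<^sup>2) * norm (cross_wigner t f g z \<xi>) \<le> C * inverse (jbracket z ^ (2 * DIM('a)))"
  using assms
proof (induction ps arbitrary: f g rule: rev_induct)
  case Nil
  obtain C where "C \<ge> 0" "\<And>z \<xi>. norm (cross_wigner t f g z \<xi>) \<le> C * inverse (jbracket z ^ (2 * DIM('a)))"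
    using cross_wigner_decay0[OF part_schwartz_0(2)[OF Nil(3)] part_schwartz_0(2)[OF Nil(4)]
      part_schwartz_0(3)[OF Nil(3)] part_schwartz_0(3)[OF Nil(4)]] by blast
  then show ?case by auto
next
  case (snoc j ps)
  have j: "j \<in> Basis" "j \<notin> set ps" and ps: "distinct ps" "set ps \<subseteq> Basis" using snoc.prems by auto
  let ?D = "\<lambda>n f. (partial_deriv j ^^ n) f"
  have part: "part_schwartz ps (?D n f)" "part_schwartz ps (?D n g)" for n
    using part_schwartz_snoc[OF snoc.prems(3) j(2)] part_schwartz_snoc[OF snoc.prems(4) j(2)] by auto
  let ?V = "\<lambda>m n. cross_wigner t (?D m f) (?D n g)" and ?P = "\<lambda>\<xi>. \<Prod>j\<in>set ps. 1 + (\<xi> \<bullet> j)\<^sup>2"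
  let ?I = "\<lambda>z::'a. inverse (jbracket z ^ (2 * DIM('a)))"
  have "\<exists>C\<ge>0. \<forall>z \<xi>. ?P \<xi> * norm (?V m n z \<xi>) \<le> C * ?I z" for m n
    by (rule snoc.IH[OF ps part(1) part(2)])
  then obtain C where C: "\<And>m n. C m n \<ge> 0" "\<And>m n z \<xi>. ?P \<xi> * norm (?V m n z \<xi>) \<le> C m n * ?I z"
    by metis
  define K where "K = C 0 0 + ((1 - t)\<^sup>2 * C 2 0 + 2 * \<bar>(1 - t) * t\<bar> * C 1 1 + t\<^sup>2 * C 0 2)"
  have d: "((\<lambda>s. ?D n f (x + s *\<^sub>R j)) has_vector_derivative ?D (Suc n) f x) (at 0)"
      "((\<lambda>s. ?D n g (x + s *\<^sub>R j)) has_vector_derivative ?D (Suc n) g x) (at 0)" for n x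
    using differentiable_partial_deriv[OF part_schwartz_0(1)[OF part(1)[of n]], of x j]
      differentiable_partial_deriv[OF part_schwartz_0(1)[OF part(2)[of n]], of x j] by simp_all
  have ibp: "\<i> * complex_of_real (\<xi> \<bullet> j) * ?V m n z \<xi> = of_real (1 - t) * ?V (Suc m) n z \<xi> - of_real t * ?V m (Suc n) z \<xi>" for m n z \<xi>
    by (rule cross_wigner_by_parts[OF d(1) d(2) _ _ _ _ _ _ _ _ j(1)])
       (rule part_schwartz_0(2)[OF part(1)] part_schwartz_0(2)[OF part(2)] part_schwartz_0(3)[OF part(1)] part_schwartz_0(3)[OF part(2)])+
  have "(\<Prod>j\<in>set (ps @ [j]). 1 + (\<xi> \<bullet> j)\<^sup>2) * norm (cross_wigner t f g z \<xi>) \<le> K * ?I z" for z \<xi>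
  proof -
    let ?c = "\<i> * complex_of_real (\<xi> \<bullet> j)"
    have P0: "?P \<xi> \<ge> 0" by (intro prod_nonneg) auto
    \<comment> \<open>Two factors \<open>?c\<close> amount to \<open>(\<xi> \<bullet> j)^2\<close>
      in norm; adding the bound without them gives the factor
      \<open>1 + (\<xi> \<bullet> j)^2\<close> of the claim. Only derivatives of total order two in
      direction \<open>j\<close> appear.\<close>
    have "?c * (?c * ?V 0 0 z \<xi>) = of_real (1 - t) * (?c * ?V 1 0 z \<xi>) - of_real t * (?c * ?V 0 1 z \<xi>)"
      unfolding ibp[of \<xi> 0 0] by (simp add: algebra_simps)
    also have "\<dots> = of_real ((1 - t)\<^sup>2) * ?V 2 0 z \<xi> - of_real (2 * ((1 - t) * t)) * ?V 1 1 z \<xi> + of_real (t\<^sup>2) * ?V 0 2 z \<xi>"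
      unfolding ibp[of \<xi> 1 0] ibp[of \<xi> 0 1]
      by (simp add: algebra_simps power2_eq_square numeral_2_eq_2)
    finally have "norm (?c * (?c * ?V 0 0 z \<xi>)) \<le> (1 - t)\<^sup>2 * norm (?V 2 0 z \<xi>) + 2 * \<bar>(1 - t) * t\<bar> * norm (?V 1 1 z \<xi>) + t\<^sup>2 * norm (?V 0 2 z \<xi>)"
      using norm_triangle_ineq[of "of_real ((1 - t)\<^sup>2) * ?V 2 0 z \<xi> - of_real (2 * ((1 - t) * t)) * ?V 1 1 z \<xi>" "of_real (t\<^sup>2) * ?V 0 2 z \<xi>"]
        norm_triangle_ineq4[of "of_real ((1 - t)\<^sup>2) * ?V 2 0 z \<xi>" "of_real (2 * ((1 - t) * t)) * ?V 1 1 z \<xi>"]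
      unfolding norm_mult[of "of_real _"] norm_of_real by (simp add: abs_mult)
    moreover have "norm (?c * (?c * ?V 0 0 z \<xi>)) = (\<xi> \<bullet> j)\<^sup>2 * norm (?V 0 0 z \<xi>)"
      by (simp add: norm_mult power2_eq_square)
    ultimately have "(1 + (\<xi> \<bullet> j)\<^sup>2) * norm (?V 0 0 z \<xi>)
       \<le> norm (?V 0 0 z \<xi>) + ((1 - t)\<^sup>2 * norm (?V 2 0 z \<xi>) + 2 * \<bar>(1 - t) * t\<bar> * norm (?V 1 1 z \<xi>) + t\<^sup>2 * norm (?V 0 2 z \<xi>))"
      by (simp only: distrib_right mult_1)
    from mult_left_mono[OF this P0]
    have "?P \<xi> * ((1 + (\<xi> \<bullet> j)\<^sup>2) * norm (?V 0 0 z \<xi>))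
      \<le> ?P \<xi> * norm (?V 0 0 z \<xi>) + ((1 - t)\<^sup>2 * (?P \<xi> * norm (?V 2 0 z \<xi>)) + 2 * \<bar>(1 - t) * t\<bar> * (?P \<xi> * norm (?V 1 1 z \<xi>)) + t\<^sup>2 * (?P \<xi> * norm (?V 0 2 z \<xi>)))"
      by (simp only: distrib_left mult_ac)
    also have "\<dots> \<le> C 0 0 * ?I z + ((1 - t)\<^sup>2 * (C 2 0 * ?I z) + 2 * \<bar>(1 - t) * t\<bar> * (C 1 1 * ?I z) + t\<^sup>2 * (C 0 2 * ?I z))"
      by (intro add_mono mult_left_mono C(2)) auto
    also have "\<dots> = K * ?I z" by (simp only: K_def distrib_right mult.assoc)
    finally have "?P \<xi> * ((1 + (\<xi> \<bullet> j)\<^sup>2) * norm (?V 0 0 z \<xi>)) \<le> K * ?I z" .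
    moreover have "(\<Prod>j\<in>set (ps @ [j]). 1 + (\<xi> \<bullet> j)\<^sup>2) = ?P \<xi> * (1 + (\<xi> \<bullet> j)\<^sup>2)"
      using j(2) by (simp add: mult.commute)
    ultimately show ?thesis by (simp add: mult.assoc)
  qed
  moreover have "K \<ge> 0" unfolding K_def by (intro add_nonneg_nonneg mult_nonneg_nonneg C(1)) auto
  ultimately show ?case by blast
qed

section \<open>The symbol of the inverse\<close>

text \<open>With r = e^(-s) this is 4 r^2 (cosh^2 s + \<tau>^2 sinh^2 s). In the Weyl case \<tau> =
  0 the exponential in \<open>mehler_symbol\<close> becomes the familiar exp (- tanh s
  |X|^2).\<close>

definition sym_denom :: "real \<Rightarrow> real \<Rightarrow> real" where
  "sym_denom \<tau> r = (1 + r\<^sup>2)\<^sup>2 + (\<tau> * (1 - r\<^sup>2))\<^sup>2"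

text \<open>Up to the factor \<open>ds/dr\<close> with \<open>r = e\<^sup>-\<^sup>s\<close>, this is the symbol of \<open>e\<^sup>-\<^sup>s\<^sup>H\<close> for \<open>t = (1 + \<tau>) / 2\<close>.\<close>

definition mehler_symbol :: "real \<Rightarrow> real \<Rightarrow> 'a::euclidean_space \<times> 'a \<Rightarrow> complex" where
  "mehler_symbol \<tau> r X =
     complex_of_real (indicator {0<..<1} r * r ^ (DIM('a) - 1) * (2 / sqrt (sym_denom \<tau> r)) ^ DIM('a)
       * exp (- ((1 - r^4) / sym_denom \<tau> r) * (norm X)\<^sup>2))
     * iexp (2 * (\<tau> * (1 - r\<^sup>2)\<^sup>2 / sym_denom \<tau> r) * (fst X \<bullet> snd X))"

definition green_symbol :: "real \<Rightarrow> 'a::euclidean_space \<times> 'a \<Rightarrow> complex" where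
  "green_symbol \<tau> X = (LINT r|lborel. mehler_symbol \<tau> r X)"

lemma sym_denom_ge_1: "sym_denom \<tau> r \<ge> 1"
proof -
  have "1 \<le> (1 + r\<^sup>2)\<^sup>2" by (intro one_le_power) simp
  then show ?thesis unfolding sym_denom_def using zero_le_power2[of "\<tau> * (1 - r\<^sup>2)"] by linarith
qed

lemma mehler_symbol_measurable [measurable (raw)]:
  assumes [measurable]: "r \<in> borel_measurable M" "z \<in> borel_measurable M" "\<xi> \<in> borel_measurable M"
  shows "(\<lambda>p. mehler_symbol \<tau> (r p) (z p, \<xi> p)) \<in> borel_measurable M"
  unfolding mehler_symbol_def sym_denom_def norm_Pair by measurable

lemma mehler_symbol_weight_le:
  assumes "0 \<le> r" "r \<le> 1"
  shows "r ^ n * (2 / sqrt (sym_denom \<tau> r)) ^ d \<le> 2 ^ d"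
proof -
  have "sqrt (sym_denom \<tau> r) \<ge> 1" using sym_denom_ge_1 by simp
  then have "2 / sqrt (sym_denom \<tau> r) \<le> 2 / 1" by (intro frac_le) auto
  then have "(2 / sqrt (sym_denom \<tau> r)) ^ d \<le> 2 ^ d"
    by (intro power_mono) (use sym_denom_ge_1[of \<tau> r] in auto)
  moreover have "r ^ n \<le> 1" using assms by (intro power_le_one)
  ultimately show ?thesis
    using mult_mono[of "r ^ n" 1 "(2 / sqrt (sym_denom \<tau> r)) ^ d" "2 ^ d"] sym_denom_ge_1[of \<tau> r] by simp
qed

lemma norm_mehler_symbol_le:
  fixes X :: "'a::euclidean_space \<times> 'a"
  shows "norm (mehler_symbol \<tau> r X) \<le> indicator {0<..<1} r * (2 ^ DIM('a) * exp (- ((1 - r^4) / sym_denom \<tau> r) * (norm X)\<^sup>2))"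
proof (cases "r \<in> {0<..<1}")
  case True
  have "norm (mehler_symbol \<tau> r X) = (r ^ (DIM('a) - 1) * (2 / sqrt (sym_denom \<tau> r)) ^ DIM('a)) * exp (- ((1 - r^4) / sym_denom \<tau> r) * (norm X)\<^sup>2)"
    using True sym_denom_ge_1[of \<tau> r] by (simp add: mehler_symbol_def norm_mult abs_mult norm_power norm_divide)
  also have "\<dots> \<le> 2 ^ DIM('a) * exp (- ((1 - r^4) / sym_denom \<tau> r) * (norm X)\<^sup>2)"
    using True by (intro mult_right_mono mehler_symbol_weight_le) auto
  finally show ?thesis using True by simp
qed (simp add: mehler_symbol_def)

lemma norm_mehler_symbol_le': "norm (mehler_symbol \<tau> r (X::'a::euclidean_space \<times> 'a)) \<le> indicator {0<..<1} r * 2 ^ DIM('a)"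
proof (cases "r \<in> {0<..<1}")
  case True
  then have "r ^ 4 \<le> 1" by (intro power_le_one) auto
  then have "0 \<le> (1 - r^4) / sym_denom \<tau> r" using sym_denom_ge_1[of \<tau> r] by simp
  then have "0 \<le> (1 - r^4) / sym_denom \<tau> r * (norm X)\<^sup>2" by (rule mult_nonneg_nonneg) simp
  then have "exp (- ((1 - r^4) / sym_denom \<tau> r) * (norm X)\<^sup>2) \<le> 1" by simp
  then have e: "2 ^ DIM('a) * exp (- ((1 - r^4) / sym_denom \<tau> r) * (norm X)\<^sup>2) \<le> 2 ^ DIM('a) * 1"
    by (rule mult_left_mono) simp
  have "norm (mehler_symbol \<tau> r X) \<le> indicator {0<..<1} r * (2 ^ DIM('a) * exp (- ((1 - r^4) / sym_denom \<tau> r) * (norm X)\<^sup>2))"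
    by (rule norm_mehler_symbol_le)
  also have "\<dots> \<le> indicator {0<..<1} r * (2 ^ DIM('a) * 1)"
    by (rule mult_left_mono[OF e]) simp
  finally show ?thesis by simp
qed (simp add: mehler_symbol_def)

section \<open>From the symbol to the Mehler kernel\<close>

text \<open>The left side is the exponent left, up to sign, by the Gaussian integral of the symbol
  over \<xi>; the right side is that of the Mehler kernel. With a = 1 + r^2 and s = 1 - r^2 one has
  1 - r^4 = s a and N = a^2 + \<tau>^2 s^2, and the form in \<open>z\<close> and \<open>w\<close>
  collapses to one in x + y and x - y.\<close>

lemma mehler_exponent:
  fixes x y :: "'a::euclidean_space" and r t :: real
  assumes r: "0 < r" "r < 1"
  defines "\<tau> \<equiv> 2 * t - 1" and "z \<equiv> (1 - t) *\<^sub>R x + t *\<^sub>R y" and "w \<equiv> x - y"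
  defines "N \<equiv> sym_denom \<tau> r"
  defines "l \<equiv> (1 - r^4) / N" and "m \<equiv> \<tau> * (1 - r\<^sup>2)\<^sup>2 / N"
  shows "l * (norm z)\<^sup>2 + (norm (w + (2 * m) *\<^sub>R z))\<^sup>2 / (4 * l)
    = ((1 + r^4) * ((norm x)\<^sup>2 + (norm y)\<^sup>2) - 4 * r\<^sup>2 * (x \<bullet> y)) / (2 * (1 - r^4))"
proof -
  define a s where "a = 1 + r\<^sup>2" and "s = 1 - r\<^sup>2"
  have a: "a > 0" by (simp add: a_def add_pos_nonneg)
  have "r\<^sup>2 < 1" using r power_strict_mono[of r 1 2] by simp
  then have s: "s > 0" by (simp add: s_def)
  have N: "N = a\<^sup>2 + \<tau>\<^sup>2 * s\<^sup>2" by (simp add: N_def sym_denom_def a_def s_def power_mult_distrib)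
  have N0: "N > 0" using sym_denom_ge_1[of \<tau> r] by (simp add: N_def)
  have q: "1 - r^4 = s * a" by (simp add: a_def s_def algebra_simps power2_eq_square power4_eq_xxxx)
  have l: "l = s * a / N" by (simp add: l_def q)
  have m: "m = \<tau> * s\<^sup>2 / N" by (simp add: m_def s_def)
  have l0: "l > 0" using a s N0 by (simp add: l)
  define zz zw ww where "zz = z \<bullet> z" and "zw = z \<bullet> w" and "ww = w \<bullet> w"
  have "(norm (w + (2 * m) *\<^sub>R z))\<^sup>2 = ww + 4 * m * zw + 4 * m\<^sup>2 * zz"
    unfolding power2_norm_eq_inner zz_def zw_def ww_def
    by (simp add: inner_add_left inner_add_right inner_commute power2_eq_square algebra_simps)
  then have "l * (norm z)\<^sup>2 + (norm (w + (2 * m) *\<^sub>R z))\<^sup>2 / (4 * l)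
     = (l + m\<^sup>2 / l) * zz + m / l * zw + ww / (4 * l)"
    unfolding power2_norm_eq_inner zz_def[symmetric] using l0 by (simp add: field_simps)
  also have "l + m\<^sup>2 / l = s / a"
  proof -
    have "l + m\<^sup>2 / l = (s * a / N) + (\<tau>\<^sup>2 * s^3) / (N * a)"
      using a s N0 by (simp add: l m power2_eq_square power3_eq_cube)
    also have "\<dots> = s * (a\<^sup>2 + \<tau>\<^sup>2 * s\<^sup>2) / (N * a)"
      using a N0 by (simp add: field_simps power2_eq_square power3_eq_cube)
    also have "\<dots> = s / a" unfolding N[symmetric] using N0 by simp
    finally show ?thesis .
  qed
  also have "m / l = \<tau> * s / a"
    using a s N0 by (simp add: l m power2_eq_square)
  also have "ww / (4 * l) = (a / (4 * s) + \<tau>\<^sup>2 * s / (4 * a)) * ww"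
  proof -
    have "ww / (4 * l) = N * ww / (4 * (s * a))" using N0 by (simp add: l)
    also have "\<dots> = (a / (4 * s) + \<tau>\<^sup>2 * s / (4 * a)) * ww"
      unfolding N using a s by (simp add: field_simps power2_eq_square)
    finally show ?thesis .
  qed
  also have "s / a * zz + \<tau> * s / a * zw + (a / (4 * s) + \<tau>\<^sup>2 * s / (4 * a)) * ww
     = s / a * (zz + \<tau> * zw + \<tau>\<^sup>2 / 4 * ww) + a / (4 * s) * ww"
    by (simp add: algebra_simps)
  also have "zz + \<tau> * zw + \<tau>\<^sup>2 / 4 * ww = (z + (\<tau> / 2) *\<^sub>R w) \<bullet> (z + (\<tau> / 2) *\<^sub>R w)"
    unfolding zz_def zw_def ww_def
    by (simp add: inner_add_left inner_add_right inner_commute power2_eq_square algebra_simps)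
  \<comment> \<open>Since \<tau> = 2t - 1, this offset carries \<open>z\<close> to the midpoint of
    \<open>x\<close> and \<open>y\<close>.\<close>
  also have "z + (\<tau> / 2) *\<^sub>R w = (1 / 2) *\<^sub>R (x + y)"
  proof -
    have "z + (\<tau> / 2) *\<^sub>R w = ((1 - t) + \<tau> / 2) *\<^sub>R x + (t - \<tau> / 2) *\<^sub>R y"
      by (simp add: z_def w_def algebra_simps)
    also have "(1 - t) + \<tau> / 2 = 1 / 2" by (simp add: \<tau>_def field_simps)
    also have "t - \<tau> / 2 = 1 / 2" by (simp add: \<tau>_def field_simps)
    finally show ?thesis by (simp add: scaleR_add_right)
  qed
  also have "s / a * ((1 / 2) *\<^sub>R (x + y) \<bullet> (1 / 2) *\<^sub>R (x + y)) + a / (4 * s) * ww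
     = (s\<^sup>2 * ((x + y) \<bullet> (x + y)) + a\<^sup>2 * ww) / (4 * (s * a))"
  proof -
    have "(1 / 2) *\<^sub>R (x + y) \<bullet> (1 / 2) *\<^sub>R (x + y) = ((x + y) \<bullet> (x + y)) / 4"
      by (simp only: inner_scaleR_left inner_scaleR_right)
    moreover have "s / a * (u / 4) + a / (4 * s) * v = (s\<^sup>2 * u + a\<^sup>2 * v) / (4 * (s * a))" for u v
      using a s by (simp add: field_simps power2_eq_square)
    ultimately show ?thesis by (simp only:)
  qed
  also have "s\<^sup>2 * ((x + y) \<bullet> (x + y)) + a\<^sup>2 * ww = (s\<^sup>2 + a\<^sup>2) * (x \<bullet> x + y \<bullet> y) - 2 * (a\<^sup>2 - s\<^sup>2) * (x \<bullet> y)"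
    by (simp add: ww_def w_def inner_add_left inner_add_right inner_diff_left inner_diff_right inner_commute algebra_simps)
  also have "s\<^sup>2 + a\<^sup>2 = 2 * (1 + r^4)"
    by (simp add: a_def s_def power2_eq_square power4_eq_xxxx algebra_simps)
  also have "a\<^sup>2 - s\<^sup>2 = 4 * r\<^sup>2"
    by (simp add: a_def s_def power2_eq_square algebra_simps)
  also have "(2 * (1 + r^4) * (x \<bullet> x + y \<bullet> y) - 2 * (4 * r\<^sup>2) * (x \<bullet> y)) / (4 * (s * a))
     = ((1 + r^4) * (x \<bullet> x + y \<bullet> y) - 4 * r\<^sup>2 * (x \<bullet> y)) / (2 * (s * a))"
    using a s by (simp add: field_simps)
  finally show ?thesis
    unfolding q power2_norm_eq_inner by simp
qed

text \<open>The phase of the symbol is linear in \<xi> and only shifts the frequency from x - y to x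
  - y + 2 m z. The integral is thus an ordinary Gaussian one, and \<open>mehler_exponent\<close>
  identifies the result.\<close>

lemma mehler_symbol_fourier:
  fixes x y :: "'a::euclidean_space"
  shows "(LINT \<xi>|lborel. mehler_symbol (2 * t - 1) r ((1 - t) *\<^sub>R x + t *\<^sub>R y, \<xi>) * iexp ((x - y) \<bullet> \<xi>))
    = complex_of_real ((2 * pi) ^ DIM('a) * mehler r x y)"
proof (cases "r \<in> {0<..<1}")
  case True
  then have r: "0 < r" "r < 1" by auto
  define z N where "z = (1 - t) *\<^sub>R x + t *\<^sub>R y" and "N = sym_denom (2 * t - 1) r"
  define l m where "l = (1 - r^4) / N" and "m = (2 * t - 1) * (1 - r\<^sup>2)\<^sup>2 / N"
  have r4: "r ^ 4 < 1" using r power_strict_mono[of r 1 4] by simp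
  have N0: "N > 0" using sym_denom_ge_1[of "2 * t - 1" r] by (simp add: N_def)
  have l: "l > 0" using r4 N0 by (simp add: l_def)
  define W where "W = r ^ (DIM('a) - 1) * (2 / sqrt N) ^ DIM('a) * exp (- l * (norm z)\<^sup>2)"
  have eq: "mehler_symbol (2 * t - 1) r (z, \<xi>) * iexp ((x - y) \<bullet> \<xi>)
     = complex_of_real W * (exp (- l * (norm \<xi>)\<^sup>2) *\<^sub>R iexp ((x - y + (2 * m) *\<^sub>R z) \<bullet> \<xi>))" for \<xi>
  proof -
    have "exp (- l * (norm (z, \<xi>))\<^sup>2) = exp (- l * (norm z)\<^sup>2) * exp (- l * (norm \<xi>)\<^sup>2)"
      by (simp add: norm_Pair distrib_left flip: exp_add)
    moreover have "iexp (2 * m * (z \<bullet> \<xi>)) * iexp ((x - y) \<bullet> \<xi>) = iexp ((x - y + (2 * m) *\<^sub>R z) \<bullet> \<xi>)"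
      by (simp add: inner_add_left algebra_simps flip: exp_add)
    ultimately show ?thesis
      using True unfolding mehler_symbol_def N_def[symmetric] l_def[symmetric] m_def[symmetric] W_def
      by (simp add: scaleR_conv_of_real mult_ac)
  qed
  have "(LINT \<xi>|lborel. mehler_symbol (2 * t - 1) r (z, \<xi>) * iexp ((x - y) \<bullet> \<xi>))
     = complex_of_real W * (LINT \<xi>|lborel. exp (- l * (norm \<xi>)\<^sup>2) *\<^sub>R iexp ((x - y + (2 * m) *\<^sub>R z) \<bullet> \<xi>))"
    unfolding eq by (rule integral_mult_right_zero)
  also have "\<dots> = complex_of_real W * complex_of_real (sqrt (pi / l) ^ DIM('a) * exp (- (norm (x - y + (2 * m) *\<^sub>R z))\<^sup>2 / (4 * l)))"
    by (simp only: gaussian_fourier(2)[OF l])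
  also have "\<dots> = complex_of_real (W * (sqrt (pi / l) ^ DIM('a) * exp (- (norm (x - y + (2 * m) *\<^sub>R z))\<^sup>2 / (4 * l))))"
    by (simp only: of_real_mult)
  also have "W * (sqrt (pi / l) ^ DIM('a) * exp (- (norm (x - y + (2 * m) *\<^sub>R z))\<^sup>2 / (4 * l)))
     = r ^ (DIM('a) - 1) * ((2 / sqrt N) * sqrt (pi / l)) ^ DIM('a) * (exp (- l * (norm z)\<^sup>2) * exp (- (norm (x - y + (2 * m) *\<^sub>R z))\<^sup>2 / (4 * l)))"
    unfolding W_def power_mult_distrib by (simp only: mult_ac)
  also have "(2 / sqrt N) * sqrt (pi / l) = (2 * pi) * (1 / sqrt (pi * (1 - r^4)))"
  proof -
    have "(2 / sqrt N) * sqrt (pi / l) = 2 * sqrt (pi / (1 - r^4))"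
      using N0 r4 by (simp add: l_def real_sqrt_divide real_sqrt_mult)
    also have "pi / (1 - r^4) = (pi\<^sup>2) / (pi * (1 - r^4))"
      by (simp add: power2_eq_square)
    finally show ?thesis by (simp add: real_sqrt_divide)
  qed
  also have "exp (- l * (norm z)\<^sup>2) * exp (- (norm (x - y + (2 * m) *\<^sub>R z))\<^sup>2 / (4 * l))
     = exp (- ((1 + r^4) * ((norm x)\<^sup>2 + (norm y)\<^sup>2) - 4 * r\<^sup>2 * (x \<bullet> y)) / (2 * (1 - r^4)))"
  proof -
    have "- l * (norm z)\<^sup>2 + - (norm (x - y + (2 * m) *\<^sub>R z))\<^sup>2 / (4 * l)
      = - (l * (norm z)\<^sup>2 + (norm (x - y + (2 * m) *\<^sub>R z))\<^sup>2 / (4 * l))" by simp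
    also have "\<dots> = - (((1 + r^4) * ((norm x)\<^sup>2 + (norm y)\<^sup>2) - 4 * r\<^sup>2 * (x \<bullet> y)) / (2 * (1 - r^4)))"
      unfolding l_def m_def N_def z_def by (simp only: mehler_exponent[OF r])
    finally show ?thesis unfolding exp_add[symmetric] by (simp only: minus_divide_left)
  qed
  also have "r ^ (DIM('a) - 1) * ((2 * pi) * (1 / sqrt (pi * (1 - r^4)))) ^ DIM('a)
       * exp (- ((1 + r^4) * ((norm x)\<^sup>2 + (norm y)\<^sup>2) - 4 * r\<^sup>2 * (x \<bullet> y)) / (2 * (1 - r^4)))
     = (2 * pi) ^ DIM('a) * mehler r x y"
    using True unfolding mehler_def power_mult_distrib by (simp add: mult_ac)
  finally show ?thesis by (simp only: z_def)
qed (simp add: mehler_symbol_def mehler_def)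

lemma green_symbol_bounded: "norm (green_symbol \<tau> (X::'a::euclidean_space \<times> 'a)) \<le> 2 ^ DIM('a)"
proof -
  have m: "(\<lambda>r. mehler_symbol \<tau> r X) \<in> borel_measurable lborel"
    using mehler_symbol_measurable[of "\<lambda>r. r" lborel "\<lambda>_. fst X" "\<lambda>_. snd X" \<tau>] by simp
  have i: "integrable lborel (\<lambda>r::real. indicator {0<..<1} r * (2::real) ^ DIM('a))"
    by (intro integrable_mult_left integrable_indicator_unit)
  have "norm (green_symbol \<tau> X) \<le> (LINT r|lborel. indicator {0<..<1::real} r * 2 ^ DIM('a))"
    unfolding green_symbol_def
  proof (rule Bochner_Integration.integral_norm_bound_integral[OF _ i norm_mehler_symbol_le'])
    show "integrable lborel (\<lambda>r. mehler_symbol \<tau> r X)"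
      by (rule Bochner_Integration.integrable_bound[OF i m])
         (simp add: norm_mehler_symbol_le')
  qed
  then show ?thesis by simp
qed

text \<open>The \<open>r\<close>-integral inside the symbol is moved outside the one over
  \<open>p\<close> and then outside the one over \<xi>; at fixed \<open>r\<close> the integrals over
  \<xi> and \<open>p\<close> are exchanged to apply \<open>mehler_symbol_fourier\<close>. Absolute
  values in all variables at once would fail in dimension 2 and higher, because the Gaussian
  integral over \<xi> grows like (1 - r)^(-d/2).\<close>

lemma Op_green_symbol:
  fixes f g :: "'a::euclidean_space \<Rightarrow> complex"
  assumes f: "f \<in> schwartz" and g: "g \<in> schwartz"
  shows "Op t (green_symbol (2 * t - 1)) f g = (LINT x|lborel. green f x * g x)"
proof -
  note [measurable] = schwartz_measurable[OF f] schwartz_measurable[OF g]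
  let ?d = "DIM('a)" and ?\<tau> = "2 * t - 1"
  let ?H = "\<lambda>\<xi> p. f (snd p) * g (fst p) * iexp ((fst p - snd p) \<bullet> \<xi>)"
  let ?e = "\<lambda>r \<xi> p. mehler_symbol ?\<tau> r ((1 - t) *\<^sub>R fst p + t *\<^sub>R snd p, \<xi>)"
  let ?J = "\<lambda>r \<xi> p. ?e r \<xi> p * ?H \<xi> p"
  let ?A = "\<lambda>r \<xi>. LINT p|lborel. ?J r \<xi> p"
  have fg: "integrable lborel (\<lambda>p. norm (g (fst p)) * norm (f (snd p)))"
    by (intro integrable_tensor integrable_norm schwartz_integrable f g)
  have inner: "(LINT p|lborel. green_symbol ?\<tau> ((1 - t) *\<^sub>R fst p + t *\<^sub>R snd p, \<xi>) * f (snd p) * g (fst p) * iexp ((fst p - snd p) \<bullet> \<xi>))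
     = (LINT r|lborel. ?A r \<xi>)" for \<xi>
  proof -
    have int: "integrable lborel (\<lambda>q. ?J (fst q) \<xi> (snd q))"
    proof (rule Bochner_Integration.integrable_bound)
      show "integrable lborel (\<lambda>q. 2 ^ ?d * (indicator {0<..<1::real} (fst q) * (norm (g (fst (snd q))) * norm (f (snd (snd q))))))"
        by (intro integrable_mult_right integrable_tensor integrable_indicator_unit fg)
      show "(\<lambda>q. ?J (fst q) \<xi> (snd q)) \<in> borel_measurable lborel" by measurable
      show "AE q in lborel. norm (?J (fst q) \<xi> (snd q)) \<le> norm ((2::real) ^ ?d * (indicator {0<..<1} (fst q) * (norm (g (fst (snd q))) * norm (f (snd (snd q))))))"
      proof (rule AE_I2)
        fix q :: "real \<times> ('a \<times> 'a)"
        have "norm (?J (fst q) \<xi> (snd q)) \<le> (indicator {0<..<1} (fst q) * 2 ^ ?d) * (norm (g (fst (snd q))) * norm (f (snd (snd q))))"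
          unfolding norm_mult[of "mehler_symbol _ _ _"]
          by (intro mult_mono norm_mehler_symbol_le') (auto simp: norm_mult)
        then show "norm (?J (fst q) \<xi> (snd q)) \<le> norm ((2::real) ^ ?d * (indicator {0<..<1} (fst q) * (norm (g (fst (snd q))) * norm (f (snd (snd q))))))"
          by (simp add: abs_mult mult_ac)
      qed
    qed
    have "(LINT p|lborel. green_symbol ?\<tau> ((1 - t) *\<^sub>R fst p + t *\<^sub>R snd p, \<xi>) * f (snd p) * g (fst p) * iexp ((fst p - snd p) \<bullet> \<xi>))
      = (LINT p|lborel. LINT r|lborel. ?J r \<xi> p)"
      unfolding green_symbol_def by (simp only: mult.assoc integral_mult_left_zero)
    also have "\<dots> = (LINT r|lborel. ?A r \<xi>)"
      using lborel_Fubini(1,2)[OF int] by simp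
    finally show ?thesis .
  qed
  \<comment> \<open>Decay in \<xi> uniform in \<open>r\<close>, taken from the cross-Wigner
    function; the symbol contributes only its bound \<open>2 ^ ?d\<close>.\<close>
  have Abound: "\<exists>C\<ge>0. \<forall>r \<xi>. norm (?A r \<xi>) \<le> indicator {0<..<1} r * (C * (\<Prod>i\<in>Basis. inverse (1 + (\<xi> \<bullet> i)\<^sup>2)))"
  proof -
    obtain C where C: "C \<ge> 0" "\<And>z \<xi>. (\<Prod>j\<in>Basis. 1 + (\<xi> \<bullet> j)\<^sup>2) * norm (cross_wigner t f g z \<xi>) \<le> C * inverse (jbracket z ^ (2 * ?d))"
      using cross_wigner_decay[OF basis_enum(1) _ schwartz_part_schwartz[OF f] schwartz_part_schwartz[OF g], of t]
      unfolding basis_enum(2) by auto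
    let ?I = "LINT z|lborel. inverse (jbracket (z::'a) ^ (2 * ?d))"
    have I0: "?I \<ge> 0" by (intro Bochner_Integration.integral_nonneg) (simp add: less_imp_le[OF jbracket_pos])
    let ?P = "\<lambda>\<xi>::'a. \<Prod>i\<in>Basis. inverse (1 + (\<xi> \<bullet> i)\<^sup>2)"
    have Vb: "norm (cross_wigner t f g z \<xi>) \<le> (C * ?P \<xi>) * inverse (jbracket z ^ (2 * ?d))" for z \<xi>
    proof -
      have pos: "(\<Prod>j\<in>(Basis::'a set). 1 + (\<xi> \<bullet> j)\<^sup>2) > 0" by (intro prod_pos) (auto intro: add_pos_nonneg)
      have inv: "?P \<xi> = inverse (\<Prod>j\<in>(Basis::'a set). 1 + (\<xi> \<bullet> j)\<^sup>2)" using prod_inversef[of "\<lambda>j. 1 + (\<xi> \<bullet> j)\<^sup>2" "Basis :: 'a set"] by (simp only: o_def)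
      have "p * v \<le> c * i \<Longrightarrow> v \<le> (c * inverse p) * i" if "p > 0" for p v c i :: real
        using that by (simp add: field_simps)
      from this[OF pos C(2)] show ?thesis unfolding inv .
    qed
    have "norm (?A r \<xi>) \<le> indicator {0<..<1} r * ((2 ^ ?d * C * ?I) * ?P \<xi>)" for r \<xi>
    proof -
      let ?G = "\<lambda>q. ?J r \<xi> (fst q + t *\<^sub>R snd q, fst q - (1 - t) *\<^sub>R snd q)"
      have P0: "?P \<xi> \<ge> 0" by (intro prod_nonneg) (auto intro: less_imp_le add_pos_nonneg)
      have m: "(\<lambda>p. ?J r \<xi> p) \<in> borel_measurable borel" by measurable
      have intJ: "integrable lborel (\<lambda>p. ?J r \<xi> p)"
      proof (rule Bochner_Integration.integrable_bound[OF integrable_mult_right[OF fg, of "2 ^ ?d"]])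
        show "AE p in lborel. norm (?J r \<xi> p) \<le> norm ((2::real) ^ ?d * (norm (g (fst p)) * norm (f (snd p))))"
        proof (rule AE_I2)
          fix p :: "'a \<times> 'a"
          have "norm (?e r \<xi> p) \<le> 2 ^ ?d"
            by (rule order_trans[OF norm_mehler_symbol_le']) (simp add: indicator_def)
          then have "norm (?J r \<xi> p) \<le> 2 ^ ?d * (norm (g (fst p)) * norm (f (snd p)))"
            unfolding norm_mult[of "mehler_symbol _ _ _"]
            by (intro mult_mono) (auto simp: norm_mult)
          then show "norm (?J r \<xi> p) \<le> norm ((2::real) ^ ?d * (norm (g (fst p)) * norm (f (snd p))))"
            by (simp add: abs_mult)
        qed
      qed (use m in simp)
      have zc: "(1 - t) *\<^sub>R (z + t *\<^sub>R w) + t *\<^sub>R (z - (1 - t) *\<^sub>R w) = z" for z w :: 'a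
        by (simp add: algebra_simps)
      have wc: "(z + t *\<^sub>R w) - (z - (1 - t) *\<^sub>R w) = w" for z w :: 'a
        by (simp add: algebra_simps)
      have intG: "integrable lborel ?G" using intJ integral_symbol_coordinates(2)[OF m, of t] by simp
      have "?A r \<xi> = (LINT q|lborel. ?G q)" by (rule integral_symbol_coordinates(1)[OF m])
      also have "\<dots> = (LINT z|lborel. LINT w|lborel. ?G (z, w))" by (rule lborel_Fubini(1)[OF intG])
      also have "\<dots> = (LINT z|lborel. mehler_symbol ?\<tau> r (z, \<xi>) * cross_wigner t f g z \<xi>)"
        unfolding fst_conv snd_conv zc wc cross_wigner_def integral_mult_right_zero ..
      finally have A: "?A r \<xi> = (LINT z|lborel. mehler_symbol ?\<tau> r (z, \<xi>) * cross_wigner t f g z \<xi>)" .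
      have i: "integrable lborel (\<lambda>z::'a. (indicator {0<..<1} r * 2 ^ ?d) * ((C * ?P \<xi>) * inverse (jbracket z ^ (2 * ?d))))"
        by (intro integrable_mult_right integrable_jbracket) simp
      have b: "norm (mehler_symbol ?\<tau> r (z, \<xi>) * cross_wigner t f g z \<xi>)
          \<le> (indicator {0<..<1} r * 2 ^ ?d) * ((C * ?P \<xi>) * inverse (jbracket z ^ (2 * ?d)))" for z
        unfolding norm_mult[of "mehler_symbol _ _ _"] by (intro mult_mono norm_mehler_symbol_le' Vb) auto
      have "integrable lborel (\<lambda>z. LINT w|lborel. ?G (z, w))" by (rule lborel_Fubini(3)[OF intG])
      then have i2: "integrable lborel (\<lambda>z. mehler_symbol ?\<tau> r (z, \<xi>) * cross_wigner t f g z \<xi>)"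
        unfolding fst_conv snd_conv zc wc cross_wigner_def integral_mult_right_zero .
      have "norm (?A r \<xi>) \<le> (LINT z|lborel. (indicator {0<..<1} r * 2 ^ ?d) * ((C * ?P \<xi>) * inverse (jbracket (z::'a) ^ (2 * ?d))))"
        unfolding A by (rule Bochner_Integration.integral_norm_bound_integral[OF i2 i b])
      then show ?thesis by (simp add: mult_ac)
    qed
    moreover have "2 ^ ?d * C * ?I \<ge> 0" using C(1) I0 by simp
    ultimately show ?thesis by blast
  qed
  have Aint: "integrable lborel (\<lambda>q. ?A (snd q) (fst q))"
  proof -
    obtain C where C: "C \<ge> 0" "\<And>r \<xi>. norm (?A r \<xi>) \<le> indicator {0<..<1} r * (C * (\<Prod>i\<in>Basis. inverse (1 + (\<xi> \<bullet> i)\<^sup>2)))"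
      using Abound by blast
    have F: "(\<lambda>u. ?J (snd (fst u)) (fst (fst u)) (snd u)) \<in> borel_measurable (borel :: (('a \<times> real) \<times> ('a \<times> 'a)) measure)"
      by measurable
    show ?thesis
    proof (rule Bochner_Integration.integrable_bound)
      show "integrable lborel (\<lambda>q. C * ((\<Prod>i\<in>(Basis::'a set). inverse (1 + (fst q \<bullet> i)\<^sup>2)) * indicator {0<..<1::real} (snd q)))"
        by (intro integrable_mult_right integrable_tensor integrable_indicator_unit integrable_prod_inverse)
      show "(\<lambda>q. ?A (snd q) (fst q)) \<in> borel_measurable lborel"
        using borel_measurable_LINT[OF F] by simp
      show "AE q in lborel. norm (?A (snd q) (fst q)) \<le> norm (C * ((\<Prod>i\<in>(Basis::'a set). inverse (1 + (fst q \<bullet> i)\<^sup>2)) * indicator {0<..<1::real} (snd q)))"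
        using order_trans[OF C(2) abs_ge_self] by (intro AE_I2) (simp only: real_norm_def mult_ac)
    qed
  qed
  \<comment> \<open>For fixed \<open>r < 1\<close> the symbol does have a Gaussian factor in \<xi>,
    which permits this exchange.\<close>
  have fix_r: "(LINT \<xi>|lborel. ?A r \<xi>) = of_real ((2 * pi) ^ ?d) * (LINT y|lborel. LINT x|lborel. complex_of_real (mehler r x y) * f y * g x)" for r
  proof (cases "r \<in> {0<..<1}")
    case True
    have r4: "r ^ 4 < 1" using True power_strict_mono[of r 1 4] by simp
    define l where "l = (1 - r^4) / sym_denom ?\<tau> r"
    have l: "l > 0" using r4 sym_denom_ge_1[of ?\<tau> r] by (simp add: l_def)
    have int: "integrable lborel (\<lambda>q. ?J r (fst q) (snd q))"
    proof (rule Bochner_Integration.integrable_bound)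
      show "integrable lborel (\<lambda>q::'a \<times> ('a \<times> 'a). 2 ^ ?d * (exp (- l * (norm (fst q))\<^sup>2) * (norm (g (fst (snd q))) * norm (f (snd (snd q))))))"
        by (intro integrable_mult_right integrable_tensor gaussian_integral(1)[OF l] fg)
      show "(\<lambda>q. ?J r (fst q) (snd q)) \<in> borel_measurable lborel" by measurable
      show "AE q in lborel. norm (?J r (fst q) (snd q)) \<le> norm ((2::real) ^ ?d * (exp (- l * (norm (fst q))\<^sup>2) * (norm (g (fst (snd q))) * norm (f (snd (snd q))))))"
      proof (rule AE_I2)
        fix q :: "'a \<times> ('a \<times> 'a)"
        let ?z = "(1 - t) *\<^sub>R fst (snd q) + t *\<^sub>R snd (snd q)"
        have "norm (?e r (fst q) (snd q)) \<le> 2 ^ ?d * exp (- l * (norm (?z, fst q))\<^sup>2)"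
          using norm_mehler_symbol_le[of ?\<tau> r "(?z, fst q)"] True by (simp add: l_def)
        also have "\<dots> \<le> 2 ^ ?d * exp (- l * (norm (fst q))\<^sup>2)"
          using l by (simp add: norm_Pair)
        finally have "norm (?J r (fst q) (snd q)) \<le> (2 ^ ?d * exp (- l * (norm (fst q))\<^sup>2)) * (norm (g (fst (snd q))) * norm (f (snd (snd q))))"
          unfolding norm_mult[of "mehler_symbol _ _ _"]
          by (intro mult_mono) (auto simp: norm_mult)
        then show "norm (?J r (fst q) (snd q)) \<le> norm ((2::real) ^ ?d * (exp (- l * (norm (fst q))\<^sup>2) * (norm (g (fst (snd q))) * norm (f (snd (snd q))))))"
          by (simp add: abs_mult mult.assoc)
      qed
    qed
    have J\<xi>: "(LINT \<xi>|lborel. ?J r \<xi> p) = of_real ((2 * pi) ^ ?d) * (complex_of_real (mehler r (fst p) (snd p)) * f (snd p) * g (fst p))" for p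
    proof -
      have "(LINT \<xi>|lborel. ?J r \<xi> p) = f (snd p) * g (fst p) * (LINT \<xi>|lborel. ?e r \<xi> p * iexp ((fst p - snd p) \<bullet> \<xi>))"
        by (subst integral_mult_right_zero[symmetric]) (simp add: mult_ac)
      then show ?thesis unfolding mehler_symbol_fourier by (simp add: mult_ac)
    qed
    have "(LINT \<xi>|lborel. ?A r \<xi>) = (LINT p|lborel. LINT \<xi>|lborel. ?J r \<xi> p)"
      using lborel_Fubini(1,2)[OF int] by simp
    also have "\<dots> = (LINT y|lborel. LINT x|lborel. of_real ((2 * pi) ^ ?d) * (complex_of_real (mehler r x y) * f y * g x))"
    proof -
      have "integrable lborel (\<lambda>p. of_real ((2 * pi) ^ ?d) * (complex_of_real (mehler r (fst p) (snd p)) * f (snd p) * g (fst p)))"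
        using lborel_Fubini(4)[OF int] unfolding fst_conv snd_conv J\<xi> .
      from lborel_Fubini(2)[OF this] show ?thesis
        unfolding fst_conv snd_conv J\<xi> .
    qed
    also have "\<dots> = of_real ((2 * pi) ^ ?d) * (LINT y|lborel. LINT x|lborel. complex_of_real (mehler r x y) * f y * g x)"
      unfolding integral_mult_right_zero ..
    finally show ?thesis .
  qed (simp add: mehler_symbol_def mehler_def)
  have "(LINT \<xi>|lborel. LINT r|lborel. ?A r \<xi>) = (LINT r|lborel. LINT \<xi>|lborel. ?A r \<xi>)"
    using lborel_Fubini(1,2)[OF Aint] by simp
  also have "\<dots> = of_real ((2 * pi) ^ ?d) * (LINT r|lborel. LINT y|lborel. LINT x|lborel. complex_of_real (mehler r x y) * f y * g x)"
    unfolding fix_r integral_mult_right_zero ..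
  also have "(LINT r|lborel. LINT y|lborel. LINT x|lborel. complex_of_real (mehler r x y) * f y * g x) = (LINT x|lborel. green f x * g x)"
  proof -
    obtain B where B: "\<And>x. norm (g x) \<le> B" using rapidly_decreasing_bounded[OF schwartz_rapid[OF g]] by blast
    have 2: "(LINT x|lborel. complex_of_real (mehler r x y) * f y * g x) = f y * (LINT x|lborel. complex_of_real (mehler r x y) * g x)" for r y
      by (subst integral_mult_right_zero[symmetric]) (simp add: mult_ac)
    have "(LINT x|lborel. green f x * g x) = (LINT q|lborel. f (snd q) * (LINT x|lborel. complex_of_real (mehler (fst q) x (snd q)) * g x))"
      by (rule integral_green(2)[OF schwartz_integrable[OF f] schwartz_measurable[OF g] B])
    also have "\<dots> = (LINT r|lborel. LINT y|lborel. f y * (LINT x|lborel. complex_of_real (mehler r x y) * g x))"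
      using lborel_Fubini(1)[OF integral_green(3)[OF schwartz_integrable[OF f] schwartz_measurable[OF g] B]] by simp
    finally show ?thesis unfolding 2 by simp
  qed
  finally have main: "(LINT \<xi>|lborel. LINT r|lborel. ?A r \<xi>) = of_real ((2 * pi) ^ ?d) * (LINT x|lborel. green f x * g x)" .
  have one: "complex_of_real (1 / (2 * pi) ^ ?d) * complex_of_real ((2 * pi) ^ ?d) = 1"
    unfolding of_real_mult[symmetric] by simp
  have "Op t (green_symbol ?\<tau>) f g = complex_of_real (1 / (2 * pi) ^ ?d) * (of_real ((2 * pi) ^ ?d) * (LINT x|lborel. green f x * g x))"
    unfolding Op_def inner main ..
  then show ?thesis
    by (simp only: mult.assoc[symmetric] one mult_1)
qed

section \<open>Uniqueness of symbols\<close>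

lemma jbracket_power_le_exp:
  assumes c: "c > 0"
  obtains K where "K > 0" "\<And>x. jbracket x ^ N * exp (- c * (norm x)\<^sup>2) \<le> K * exp (- (c / 2) * (norm x)\<^sup>2)"
proof -
  \<comment> \<open>Each factor \<open>jbracket x\<close> is traded for exp (\<delta> |x|^2) at the
    price 1 / \<delta>, and N \<delta> \<le> c / 2 leaves half of the Gaussian. The cap at 1 gives
    \<delta> (1 + |x|^2) \<le> 1 + \<delta> |x|^2.\<close>
  define \<delta> where "\<delta> = min 1 (c / (2 * (real N + 1)))"
  have \<delta>: "\<delta> > 0" "\<delta> \<le> 1" using c by (auto simp: \<delta>_def)
  have "real N * \<delta> \<le> real N * (c / (2 * (real N + 1)))" by (intro mult_left_mono) (auto simp: \<delta>_def)
  also have "\<dots> = (c / 2) * (real N / (real N + 1))" by (simp add: field_simps)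
  also have "\<dots> \<le> (c / 2) * 1" using c by (intro mult_left_mono) (auto simp: field_simps)
  finally have N\<delta>: "real N * \<delta> \<le> c / 2" by simp
  have "jbracket x ^ N * exp (- c * (norm x)\<^sup>2) \<le> (1 / \<delta>) ^ N * exp (- (c / 2) * (norm x)\<^sup>2)" for x
  proof -
    let ?u = "(norm x)\<^sup>2"
    have "jbracket x \<le> jbracket x * jbracket x"
      using mult_left_mono[OF jbracket_ge_1[of x], of "jbracket x"] jbracket_pos[of x] by simp
    also have "\<dots> = 1 + ?u" by (simp add: jbracket_sq flip: power2_eq_square)
    also have "\<dots> \<le> (1 / \<delta>) * exp (\<delta> * ?u)"
    proof -
      have "\<delta> * (1 + ?u) \<le> 1 + \<delta> * ?u" using \<delta> by (simp add: distrib_left)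
      also have "\<dots> \<le> exp (\<delta> * ?u)" by (rule exp_ge_add_one_self)
      finally show ?thesis using \<delta> by (simp add: field_simps)
    qed
    finally have "jbracket x ^ N \<le> ((1 / \<delta>) * exp (\<delta> * ?u)) ^ N"
      using jbracket_pos[of x] by (intro power_mono) auto
    also have "\<dots> = (1 / \<delta>) ^ N * exp (real N * (\<delta> * ?u))"
      by (simp only: power_mult_distrib exp_of_nat_mult)
    also have "\<dots> \<le> (1 / \<delta>) ^ N * exp (c / 2 * ?u)"
    proof -
      have "real N * (\<delta> * ?u) \<le> c / 2 * ?u"
        using mult_right_mono[OF N\<delta>, of ?u] by (simp add: mult.assoc)
      then show ?thesis using \<delta> by (intro mult_left_mono) auto
    qed
    finally have "jbracket x ^ N * exp (- c * ?u) \<le> ((1 / \<delta>) ^ N * exp (c / 2 * ?u)) * exp (- c * ?u)"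
      by (intro mult_right_mono) auto
    also have "\<dots> = (1 / \<delta>) ^ N * exp (c / 2 * ?u + - c * ?u)"
      by (simp only: exp_add mult.assoc)
    also have "c / 2 * ?u + - c * ?u = - (c / 2) * ?u" by (simp add: algebra_simps)
    finally show ?thesis .
  qed
  then show thesis by (rule that[rotated]) (use \<delta> in simp)
qed

lemma polynomial_growth_gauss:
  fixes a :: "'a::euclidean_space \<Rightarrow> complex"
  assumes a: "\<And>x. norm (a x) \<le> C * jbracket x ^ N" and [measurable]: "a \<in> borel_measurable borel" and c: "c > 0"
  shows "integrable lborel (\<lambda>x. a x * complex_of_real (exp (- c * (norm x)\<^sup>2)))"
    and "\<exists>B. \<forall>x. norm (a x * complex_of_real (exp (- c * (norm x)\<^sup>2))) \<le> B"
proof -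
  obtain K where K: "K > 0" "\<And>x::'a. jbracket x ^ N * exp (- c * (norm x)\<^sup>2) \<le> K * exp (- (c / 2) * (norm x)\<^sup>2)"
    using jbracket_power_le_exp[OF c] by blast
  have C0: "C \<ge> 0" using order_trans[OF norm_ge_zero a[of 0]] by (simp add: jbracket_def)
  have b: "norm (a x * complex_of_real (exp (- c * (norm x)\<^sup>2))) \<le> C * (K * exp (- (c / 2) * (norm x)\<^sup>2))" for x
  proof -
    have "norm (a x * complex_of_real (exp (- c * (norm x)\<^sup>2))) \<le> (C * jbracket x ^ N) * exp (- c * (norm x)\<^sup>2)"
      unfolding norm_mult using a[of x] by (intro mult_mono) (auto intro: order_trans[OF norm_ge_zero])
    also have "\<dots> \<le> C * (K * exp (- (c / 2) * (norm x)\<^sup>2))"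
      unfolding mult.assoc by (rule mult_left_mono[OF K(2) C0])
    finally show ?thesis .
  qed
  show "integrable lborel (\<lambda>x. a x * complex_of_real (exp (- c * (norm x)\<^sup>2)))"
  proof (rule Bochner_Integration.integrable_bound)
    show "integrable lborel (\<lambda>x::'a. C * (K * exp (- (c / 2) * (norm x)\<^sup>2)))"
      by (intro integrable_mult_right gaussian_integral(1)) (use c in simp)
    show "AE x in lborel. norm (a x * complex_of_real (exp (- c * (norm x)\<^sup>2))) \<le> norm (C * (K * exp (- (c / 2) * (norm x)\<^sup>2)))"
      using order_trans[OF b abs_ge_self] by (intro AE_I2) (simp only: real_norm_def)
  qed measurable
  have "C * (K * exp (- (c / 2) * (norm x)\<^sup>2)) \<le> C * (K * 1)" for x :: 'a
    using C0 K(1) c by (intro mult_left_mono) auto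
  then show "\<exists>B. \<forall>x. norm (a x * complex_of_real (exp (- c * (norm x)\<^sup>2))) \<le> B"
    using order_trans[OF b] by blast
qed

lemma jbracket_Pair_le: "jbracket (z, \<xi>) \<le> 2 * jbracket z * jbracket \<xi>"
  using jbracket_add_le[of "(z, 0)" "(0, \<xi>)"] by (simp add: jbracket_def norm_Pair)

text \<open>The frequency pair \<open>(s, v)\<close> of the cross-Wigner function of two Gaussians is arbitrary,
  although its Gaussian factor does not depend on it.\<close>

lemma cross_wigner_gwave:
  fixes s v z \<xi> :: "'a::euclidean_space" and t :: real
  defines "A \<equiv> t\<^sup>2 + (1 - t)\<^sup>2" and "\<tau> \<equiv> 2 * t - 1"
  defines "f \<equiv> gwave ((t * \<tau> - A) *\<^sub>R v) (t *\<^sub>R s)" and "g \<equiv> gwave (((1 - t) * \<tau> + A) *\<^sub>R v) ((1 - t) *\<^sub>R s)"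
  shows "integrable lborel (\<lambda>w. norm (f (z - (1 - t) *\<^sub>R w) * g (z + t *\<^sub>R w)))"
    and "(LINT w|lborel. norm (f (z - (1 - t) *\<^sub>R w) * g (z + t *\<^sub>R w)))
      = (sqrt (2 * pi / A) ^ DIM('a) * exp (A * (norm v)\<^sup>2 / 2)) * exp (- (1 / (2 * A)) * (norm z)\<^sup>2)"
    and "cross_wigner t f g z \<xi> = complex_of_real (sqrt (2 * pi / A) ^ DIM('a) * exp (A * (norm v)\<^sup>2 / 2))
       * (complex_of_real (exp (- (1 / (2 * A)) * (norm (z, \<xi>))\<^sup>2)) * iexp (- (\<tau> / A) * (z \<bullet> \<xi>)) * iexp ((s, v) \<bullet> (z, \<xi>)))"
proof -
  have A2: "2 * A = \<tau>\<^sup>2 + 1" by (simp add: A_def \<tau>_def power2_eq_square algebra_simps)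
  have A: "A > 0" using A2 zero_le_power2[of \<tau>] by linarith
  \<comment> \<open>The exponent in \<open>w\<close> is R - (A / 2) |w|^2 + m . w. The multiples of
    \<open>A\<close> in the two centres produce A v in \<open>m\<close>, hence the frequency
    \<open>v\<close> in \<xi>. The multiples of \<tau> produce \<tau> (v . z) in \<open>R\<close>,
    which cancels the cross term of |m|^2 / (2A).\<close>
  define m where "m = A *\<^sub>R v - \<tau> *\<^sub>R z"
  define R where "R = - (norm z)\<^sup>2 + \<tau> * (v \<bullet> z)"
  have c: "A / 2 > 0" using A by simp
  have ex: "((t * \<tau> - A) *\<^sub>R v) \<bullet> (z - (1 - t) *\<^sub>R w) - (norm (z - (1 - t) *\<^sub>R w))\<^sup>2 / 2
     + ((((1 - t) * \<tau> + A) *\<^sub>R v) \<bullet> (z + t *\<^sub>R w) - (norm (z + t *\<^sub>R w))\<^sup>2 / 2)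
     = R + (- (A / 2) * (norm w)\<^sup>2 + m \<bullet> w)" for w
    unfolding power2_norm_eq_inner R_def m_def
    by (simp add: inner_add_left inner_add_right inner_diff_left inner_diff_right inner_commute A_def \<tau>_def
        power2_eq_square algebra_simps) (simp add: field_simps)
  have im: "(t *\<^sub>R s) \<bullet> (z - (1 - t) *\<^sub>R w) + ((1 - t) *\<^sub>R s) \<bullet> (z + t *\<^sub>R w) = s \<bullet> z" for w
    by (simp add: inner_add_right inner_diff_right algebra_simps)
  have fg: "f (z - (1 - t) *\<^sub>R w) * g (z + t *\<^sub>R w)
     = (complex_of_real (exp R) * iexp (s \<bullet> z)) * complex_of_real (exp (- (A / 2) * (norm w)\<^sup>2 + m \<bullet> w))" for w
  proof -
    have "f (z - (1 - t) *\<^sub>R w) * g (z + t *\<^sub>R w)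
      = complex_of_real (exp (((t * \<tau> - A) *\<^sub>R v) \<bullet> (z - (1 - t) *\<^sub>R w) - (norm (z - (1 - t) *\<^sub>R w))\<^sup>2 / 2)
          * exp (((((1 - t) * \<tau> + A) *\<^sub>R v) \<bullet> (z + t *\<^sub>R w) - (norm (z + t *\<^sub>R w))\<^sup>2 / 2)))
        * (iexp ((t *\<^sub>R s) \<bullet> (z - (1 - t) *\<^sub>R w)) * iexp (((1 - t) *\<^sub>R s) \<bullet> (z + t *\<^sub>R w)))"
      unfolding f_def g_def gwave_def of_real_mult by (simp only: mult_ac)
    also have "iexp ((t *\<^sub>R s) \<bullet> (z - (1 - t) *\<^sub>R w)) * iexp (((1 - t) *\<^sub>R s) \<bullet> (z + t *\<^sub>R w)) = iexp (s \<bullet> z)"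
      unfolding exp_add[symmetric] distrib_left[symmetric] of_real_add[symmetric] im ..
    finally show ?thesis
      unfolding exp_add[symmetric] ex unfolding exp_add of_real_mult by (simp only: mult_ac)
  qed
  have m2: "(norm m)\<^sup>2 = A\<^sup>2 * (norm v)\<^sup>2 - 2 * A * \<tau> * (v \<bullet> z) + \<tau>\<^sup>2 * (norm z)\<^sup>2"
    unfolding power2_norm_eq_inner m_def
    by (simp add: inner_diff_left inner_diff_right inner_commute power2_eq_square algebra_simps)
  \<comment> \<open>The identity 2A = \<tau>^2 + 1 turns the coefficient of |z|^2 into - 1 / (2A),
    the same as that of |\<xi>|^2, so the Gaussian is radial in the pair.\<close>
  have Rm: "R + (norm m)\<^sup>2 / (2 * A) = A * (norm v)\<^sup>2 / 2 + - (1 / (2 * A)) * (norm z)\<^sup>2"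
  proof -
    have "(norm m)\<^sup>2 / (2 * A) = A * (norm v)\<^sup>2 / 2 - \<tau> * (v \<bullet> z) + \<tau>\<^sup>2 / (2 * A) * (norm z)\<^sup>2"
      unfolding m2 using A by (simp add: field_simps power2_eq_square)
    moreover have "\<tau>\<^sup>2 / (2 * A) = 1 - 1 / (2 * A)"
      using A A2 by (simp add: field_simps)
    ultimately show ?thesis unfolding R_def by (simp add: left_diff_distrib)
  qed
  have nfg: "norm (f (z - (1 - t) *\<^sub>R w) * g (z + t *\<^sub>R w)) = exp R * exp (- (A / 2) * (norm w)\<^sup>2 + m \<bullet> w)" for w
    unfolding fg by (simp add: norm_mult)
  have G0: "integrable lborel (\<lambda>w. exp (- (A / 2) * (norm w)\<^sup>2 + m \<bullet> w))"
    "(LINT w|lborel. exp (- (A / 2) * (norm w)\<^sup>2 + m \<bullet> w)) = sqrt (2 * pi / A) ^ DIM('a) * exp ((norm m)\<^sup>2 / (2 * A))"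
  proof -
    note G = gaussian_fourier_linear[OF c, of m 0]
    have eq: "exp (- (A / 2) * (norm w)\<^sup>2 + m \<bullet> w) *\<^sub>R iexp (0 \<bullet> w) = complex_of_real (exp (- (A / 2) * (norm w)\<^sup>2 + m \<bullet> w))" for w
      by (simp add: scaleR_conv_of_real)
    show "integrable lborel (\<lambda>w. exp (- (A / 2) * (norm w)\<^sup>2 + m \<bullet> w))"
      using G(1) unfolding eq by (simp only: complex_of_real_integrable_eq)
    have "complex_of_real (LINT w|lborel. exp (- (A / 2) * (norm w)\<^sup>2 + m \<bullet> w)) = complex_of_real (sqrt (2 * pi / A) ^ DIM('a) * exp ((norm m)\<^sup>2 / (2 * A)))"
      using G(2) unfolding eq integral_complex_of_real by (simp add: mult.commute)
    then show "(LINT w|lborel. exp (- (A / 2) * (norm w)\<^sup>2 + m \<bullet> w)) = sqrt (2 * pi / A) ^ DIM('a) * exp ((norm m)\<^sup>2 / (2 * A))"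
      by (simp only: of_real_eq_iff)
  qed
  show "integrable lborel (\<lambda>w. norm (f (z - (1 - t) *\<^sub>R w) * g (z + t *\<^sub>R w)))"
    unfolding nfg by (intro integrable_mult_right G0(1))
  have "(LINT w|lborel. norm (f (z - (1 - t) *\<^sub>R w) * g (z + t *\<^sub>R w)))
      = exp R * (sqrt (2 * pi / A) ^ DIM('a) * exp ((norm m)\<^sup>2 / (2 * A)))"
    unfolding nfg integral_mult_right_zero G0(2) ..
  also have "\<dots> = sqrt (2 * pi / A) ^ DIM('a) * exp (R + (norm m)\<^sup>2 / (2 * A))"
    unfolding exp_add by (simp only: mult_ac)
  also have "\<dots> = (sqrt (2 * pi / A) ^ DIM('a) * exp (A * (norm v)\<^sup>2 / 2)) * exp (- (1 / (2 * A)) * (norm z)\<^sup>2)"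
    unfolding Rm exp_add by (simp only: mult_ac)
  finally show "(LINT w|lborel. norm (f (z - (1 - t) *\<^sub>R w) * g (z + t *\<^sub>R w)))
      = (sqrt (2 * pi / A) ^ DIM('a) * exp (A * (norm v)\<^sup>2 / 2)) * exp (- (1 / (2 * A)) * (norm z)\<^sup>2)" .
  have "cross_wigner t f g z \<xi> = (complex_of_real (exp R) * iexp (s \<bullet> z)) * (LINT w|lborel. exp (- (A / 2) * (norm w)\<^sup>2 + m \<bullet> w) *\<^sub>R iexp (\<xi> \<bullet> w))"
    unfolding cross_wigner_def fg mult.assoc integral_mult_right_zero scaleR_conv_of_real inner_commute[of \<xi>] ..
  also have "\<dots> = (complex_of_real (exp R) * iexp (s \<bullet> z)) * (complex_of_real (sqrt (pi / (A / 2)) ^ DIM('a) * exp (((norm m)\<^sup>2 - (norm \<xi>)\<^sup>2) / (4 * (A / 2)))) * iexp (\<xi> \<bullet> m / (2 * (A / 2))))"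
    by (simp only: gaussian_fourier_linear(2)[OF c])
  also have "\<dots> = complex_of_real (sqrt (pi / (A / 2)) ^ DIM('a) * (exp R * exp (((norm m)\<^sup>2 - (norm \<xi>)\<^sup>2) / (4 * (A / 2)))))
      * (iexp (s \<bullet> z) * iexp (\<xi> \<bullet> m / (2 * (A / 2))))"
    by (simp only: of_real_mult mult_ac)
  also have "exp R * exp (((norm m)\<^sup>2 - (norm \<xi>)\<^sup>2) / (4 * (A / 2))) = exp (A * (norm v)\<^sup>2 / 2) * exp (- (1 / (2 * A)) * (norm (z, \<xi>))\<^sup>2)"
  proof -
    have "R + ((norm m)\<^sup>2 - (norm \<xi>)\<^sup>2) / (4 * (A / 2)) = (R + (norm m)\<^sup>2 / (2 * A)) - (norm \<xi>)\<^sup>2 / (2 * A)"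
      by (simp add: diff_divide_distrib)
    also have "\<dots> = A * (norm v)\<^sup>2 / 2 + - (1 / (2 * A)) * (norm (z, \<xi>))\<^sup>2"
      unfolding Rm by (simp add: norm_Pair distrib_left add_divide_distrib)
    finally show ?thesis unfolding exp_add[symmetric] by simp
  qed
  also have "iexp (s \<bullet> z) * iexp (\<xi> \<bullet> m / (2 * (A / 2))) = iexp (- (\<tau> / A) * (z \<bullet> \<xi>)) * iexp ((s, v) \<bullet> (z, \<xi>))"
  proof -
    have "s \<bullet> z + \<xi> \<bullet> m / (2 * (A / 2)) = - (\<tau> / A) * (z \<bullet> \<xi>) + (s, v) \<bullet> (z, \<xi>)"
      unfolding m_def using A by (simp add: inner_diff_right inner_commute field_simps)
    then show ?thesis unfolding exp_add[symmetric] distrib_left[symmetric] of_real_add[symmetric] by (simp only:)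
  qed
  finally show "cross_wigner t f g z \<xi> = complex_of_real (sqrt (2 * pi / A) ^ DIM('a) * exp (A * (norm v)\<^sup>2 / 2))
       * (complex_of_real (exp (- (1 / (2 * A)) * (norm (z, \<xi>))\<^sup>2)) * iexp (- (\<tau> / A) * (z \<bullet> \<xi>)) * iexp ((s, v) \<bullet> (z, \<xi>)))"
    by (simp add: mult_ac)
qed

text \<open>On these packets \<open>Op t a\<close> evaluates, up to a nonzero factor, the Fourier
  transform at (s, v) of \<open>a\<close> times a Gaussian and a unimodular chirp. The Gaussian
  makes polynomial growth of \<open>a\<close> sufficient for absolute convergence, in
  \<open>z\<close> at each \<xi> and in the pair.\<close>

lemma Op_gwave:
  fixes a :: "'a::euclidean_space \<times> 'a \<Rightarrow> complex" and s v :: 'a and t :: real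
  defines "A \<equiv> t\<^sup>2 + (1 - t)\<^sup>2" and "\<tau> \<equiv> 2 * t - 1"
  assumes [measurable]: "a \<in> borel_measurable borel" and growth: "\<And>X. norm (a X) \<le> C * jbracket X ^ N"
  shows "Op t a (gwave ((t * \<tau> - A) *\<^sub>R v) (t *\<^sub>R s)) (gwave (((1 - t) * \<tau> + A) *\<^sub>R v) ((1 - t) *\<^sub>R s))
    = complex_of_real (1 / (2 * pi) ^ DIM('a) * (sqrt (2 * pi / A) ^ DIM('a) * exp (A * (norm v)\<^sup>2 / 2)))
      * (LINT X|lborel. (a X * complex_of_real (exp (- (1 / (2 * A)) * (norm X)\<^sup>2)) * iexp (- (\<tau> / A) * (fst X \<bullet> snd X))) * iexp ((s, v) \<bullet> X))"
proof -
  define f where "f = gwave ((t * \<tau> - A) *\<^sub>R v) (t *\<^sub>R s)"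
  define g where "g = gwave (((1 - t) * \<tau> + A) *\<^sub>R v) ((1 - t) *\<^sub>R s)"
  have [measurable]: "f \<in> borel_measurable borel" "g \<in> borel_measurable borel"
    unfolding f_def g_def by measurable
  define c0 where "c0 = sqrt (2 * pi / A) ^ DIM('a) * exp (A * (norm v)\<^sup>2 / 2)"
  note W = cross_wigner_gwave[of t v s, folded A_def \<tau>_def, folded f_def g_def, folded c0_def]
  have "2 * A = \<tau>\<^sup>2 + 1" by (simp add: A_def \<tau>_def power2_eq_square algebra_simps)
  then have A: "A > 0" using zero_le_power2[of \<tau>] by linarith
  then have cA: "1 / (2 * A) > 0" by simp
  let ?h = "\<lambda>X. a X * complex_of_real (exp (- (1 / (2 * A)) * (norm X)\<^sup>2)) * iexp (- (\<tau> / A) * (fst X \<bullet> snd X)) * iexp ((s, v) \<bullet> X)"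
  have inth: "integrable lborel ?h"
  proof (rule Bochner_Integration.integrable_bound[OF polynomial_growth_gauss(1)[OF growth _ cA]])
    show "AE x in lborel. norm (?h x) \<le> norm (a x * complex_of_real (exp (- (1 / (2 * A)) * (norm x)\<^sup>2)))"
      by (intro AE_I2) (simp add: norm_mult)
  qed measurable
  have C0: "C \<ge> 0" using order_trans[OF norm_ge_zero growth[of 0]] by (simp add: jbracket_def)
  have inner: "(LINT p|lborel. a ((1 - t) *\<^sub>R fst p + t *\<^sub>R snd p, \<xi>) * f (snd p) * g (fst p) * iexp ((fst p - snd p) \<bullet> \<xi>))
     = (LINT z|lborel. complex_of_real c0 * ?h (z, \<xi>))" for \<xi>
  proof -
    let ?F = "\<lambda>p. a ((1 - t) *\<^sub>R fst p + t *\<^sub>R snd p, \<xi>) * f (snd p) * g (fst p) * iexp ((fst p - snd p) \<bullet> \<xi>)"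
    let ?G = "\<lambda>q. a (fst q, \<xi>) * (f (fst q - (1 - t) *\<^sub>R snd q) * g (fst q + t *\<^sub>R snd q) * iexp (snd q \<bullet> \<xi>))"
    have zc: "(1 - t) *\<^sub>R (z + t *\<^sub>R w) + t *\<^sub>R (z - (1 - t) *\<^sub>R w) = z" for z w :: 'a
      by (simp add: algebra_simps)
    have wc: "(z + t *\<^sub>R w) - (z - (1 - t) *\<^sub>R w) = w" for z w :: 'a
      by (simp add: algebra_simps)
    have m: "?F \<in> borel_measurable borel" by measurable
    have mG: "?G \<in> borel_measurable borel" by measurable
    have F: "(LINT p|lborel. ?F p) = (LINT q|lborel. ?G q)"
      using integral_symbol_coordinates(1)[OF m, of t] unfolding fst_conv snd_conv zc wc by (simp only: mult.assoc)
    have gz: "norm (a (z, \<xi>)) \<le> (C * (2 * jbracket \<xi>) ^ N) * jbracket z ^ N" for z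
    proof -
      have "jbracket (z, \<xi>) ^ N \<le> (2 * jbracket z * jbracket \<xi>) ^ N"
        by (intro power_mono jbracket_Pair_le less_imp_le[OF jbracket_pos])
      also have "\<dots> = (2 * jbracket \<xi>) ^ N * jbracket z ^ N" by (simp add: power_mult_distrib mult_ac)
      finally show ?thesis using order_trans[OF growth mult_left_mono[OF _ C0]] by (simp add: mult.assoc)
    qed
    have iz: "integrable lborel (\<lambda>z. c0 * norm (a (z, \<xi>) * complex_of_real (exp (- (1 / (2 * A)) * (norm z)\<^sup>2))))"
      by (intro integrable_mult_right integrable_norm polynomial_growth_gauss(1)[OF gz _ cA]) measurable
    have nG: "norm (?G (z, w)) = norm (a (z, \<xi>)) * norm (f (z - (1 - t) *\<^sub>R w) * g (z + t *\<^sub>R w))" for z w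
      by (simp add: norm_mult)
    have "integrable lborel ?G"
    proof (rule lborel_integrable_fstI[OF mG _ iz])
      fix z
      have "integrable lborel (\<lambda>w. norm (?G (z, w)))"
        unfolding nG by (intro integrable_mult_right W(1))
      moreover have "(\<lambda>w. ?G (z, w)) \<in> borel_measurable lborel"
        unfolding fst_conv snd_conv by measurable
      ultimately show "integrable lborel (\<lambda>w. ?G (z, w))"
        by (rule integrable_norm_cancel)
      have "(LINT w|lborel. norm (?G (z, w))) = norm (a (z, \<xi>)) * (c0 * exp (- (1 / (2 * A)) * (norm z)\<^sup>2))"
        unfolding nG integral_mult_right_zero W(2) ..
      also have "\<dots> = c0 * norm (a (z, \<xi>) * complex_of_real (exp (- (1 / (2 * A)) * (norm z)\<^sup>2)))"
        by (simp add: norm_mult)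
      finally show "(LINT w|lborel. norm (?G (z, w))) \<le> c0 * norm (a (z, \<xi>) * complex_of_real (exp (- (1 / (2 * A)) * (norm z)\<^sup>2)))"
        by (rule eq_refl)
    qed
    then have "(LINT q|lborel. ?G q) = (LINT z|lborel. LINT w|lborel. ?G (z, w))"
      by (rule lborel_Fubini(1))
    also have "\<dots> = (LINT z|lborel. a (z, \<xi>) * cross_wigner t f g z \<xi>)"
      unfolding fst_conv snd_conv integral_mult_right_zero cross_wigner_def ..
    also have "\<dots> = (LINT z|lborel. complex_of_real c0 * ?h (z, \<xi>))"
      unfolding W(3) fst_conv snd_conv by (simp only: mult_ac)
    finally show ?thesis using F by simp
  qed
  have outer: "(LINT \<xi>|lborel. LINT z|lborel. complex_of_real c0 * ?h (z, \<xi>)) = complex_of_real c0 * (LINT X|lborel. ?h X)"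
    unfolding integral_mult_right_zero lborel_Fubini(2)[OF inth] ..
  have "Op t a f g = complex_of_real (1 / (2 * pi) ^ DIM('a)) * (complex_of_real c0 * (LINT X|lborel. ?h X))"
    unfolding Op_def inner outer ..
  also have "\<dots> = complex_of_real (1 / (2 * pi) ^ DIM('a) * c0) * (LINT X|lborel. ?h X)"
    unfolding of_real_mult[of "1 / (2 * pi) ^ DIM('a)" c0] by (rule mult.assoc[symmetric])
  finally show ?thesis
    unfolding f_def g_def c0_def .
qed

text \<open>A nonempty open set is not negligible.\<close>

lemma continuous_AE_zero:
  fixes D :: "'a::euclidean_space \<Rightarrow> complex"
  assumes c: "continuous_on UNIV D" and z: "AE x in lborel. D x = 0"
  shows "D x = 0"
proof (rule ccontr)
  assume "D x \<noteq> 0"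
  have o: "open {x. D x \<noteq> 0}"
    using c by (intro open_Collect_neq) auto
  then have "\<not> negligible {x. D x \<noteq> 0}"
    using \<open>D x \<noteq> 0\<close> by (intro open_not_negligible) auto
  moreover have "AE x in lebesgue. D x = 0" using z by (rule AE_completion)
  then have "{x \<in> space lebesgue. \<not> D x = 0} \<in> null_sets lebesgue"
    using o by (subst AE_iff_null[symmetric]) (auto simp: AE_iff_null)
  then have "negligible {x. D x \<noteq> 0}" by (simp add: negligible_iff_null_sets)
  ultimately show False by blast
qed

text \<open>By \<open>Op_gwave\<close> the Fourier transform of \<open>?D\<close> vanishes, where
  \<open>?D\<close> is the difference of the symbols times Gaussian and chirp. Testing
  \<open>?D\<close> against its own conjugate, which is continuous and bounded, shows that it is 0
  almost everywhere, hence everywhere; Gaussian and chirp have no zeros.\<close>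

lemma symbol_unique:
  fixes a b :: "'a::euclidean_space \<times> 'a \<Rightarrow> complex"
  assumes a: "continuous_on UNIV a" "polynomial_growth a" and b: "continuous_on UNIV b" "polynomial_growth b"
    and eq: "\<And>f g. f \<in> schwartz \<Longrightarrow> g \<in> schwartz \<Longrightarrow> Op t a f g = Op t b f g"
  shows "a = b"
proof -
  define A \<tau> where "A = t\<^sup>2 + (1 - t)\<^sup>2" and "\<tau> = 2 * t - 1"
  have "2 * A = \<tau>\<^sup>2 + 1" by (simp add: A_def \<tau>_def power2_eq_square algebra_simps)
  then have A: "A > 0" using zero_le_power2[of \<tau>] by linarith
  then have cA: "1 / (2 * A) > 0" by simp
  have [measurable]: "a \<in> borel_measurable borel" "b \<in> borel_measurable borel"
    using a b by (auto intro: borel_measurable_continuous_onI)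
  obtain Ca Na where ga: "\<And>X. norm (a X) \<le> Ca * jbracket X ^ Na" using a(2) by (auto simp: polynomial_growth_def)
  obtain Cb Nb where gb: "\<And>X. norm (b X) \<le> Cb * jbracket X ^ Nb" using b(2) by (auto simp: polynomial_growth_def)
  let ?e = "\<lambda>X::'a \<times> 'a. complex_of_real (exp (- (1 / (2 * A)) * (norm X)\<^sup>2))" and ?i = "\<lambda>X::'a \<times> 'a. iexp (- (\<tau> / A) * (fst X \<bullet> snd X))"
  let ?h = "\<lambda>a X. a X * ?e X * ?i X"
  have int: "integrable lborel (?h u)" if "u \<in> borel_measurable borel" "integrable lborel (\<lambda>X. u X * ?e X)" for u
    by (rule Bochner_Integration.integrable_bound[OF that(2)]) (use that(1) in measurable, simp add: norm_mult)
  have ia: "integrable lborel (?h a)" by (rule int[OF _ polynomial_growth_gauss(1)[OF ga _ cA]]) measurable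
  have ib: "integrable lborel (?h b)" by (rule int[OF _ polynomial_growth_gauss(1)[OF gb _ cA]]) measurable
  let ?D = "\<lambda>X. ?h a X - ?h b X"
  have FT: "(LINT X|lborel. ?D X * iexp (k \<bullet> X)) = 0" for k
  proof -
    obtain s v where k: "k = (s, v)" by (cases k)
    have "(LINT X|lborel. ?h a X * iexp ((s, v) \<bullet> X)) = (LINT X|lborel. ?h b X * iexp ((s, v) \<bullet> X))"
    proof -
      let ?c = "complex_of_real (1 / (2 * pi) ^ DIM('a) * (sqrt (2 * pi / A) ^ DIM('a) * exp (A * (norm v)\<^sup>2 / 2)))"
      have "?c * (LINT X|lborel. ?h a X * iexp ((s, v) \<bullet> X)) = ?c * (LINT X|lborel. ?h b X * iexp ((s, v) \<bullet> X))"
        using eq[OF gwave_schwartz gwave_schwartz, of "(t * \<tau> - A) *\<^sub>R v" "t *\<^sub>R s" "((1 - t) * \<tau> + A) *\<^sub>R v" "(1 - t) *\<^sub>R s"]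
        unfolding A_def \<tau>_def by (subst (asm) Op_gwave[OF _ ga], measurable, subst (asm) Op_gwave[OF _ gb], measurable)
      moreover have "?c \<noteq> 0" using A by simp
      ultimately show ?thesis by simp
    qed
    moreover have "integrable lborel (\<lambda>X. ?h a X * iexp (k \<bullet> X))"
      by (rule Bochner_Integration.integrable_bound[OF ia]) (measurable, simp add: norm_mult)
    moreover have "integrable lborel (\<lambda>X. ?h b X * iexp (k \<bullet> X))"
      by (rule Bochner_Integration.integrable_bound[OF ib]) (measurable, simp add: norm_mult)
    ultimately show ?thesis unfolding k by (simp add: left_diff_distrib)
  qed
  have cD: "continuous_on UNIV ?D"
    by (intro continuous_intros a b) (use A in auto)
  obtain Ba where Ba: "\<And>x. norm (a x * ?e x) \<le> Ba" using polynomial_growth_gauss(2)[OF ga _ cA] by auto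
  obtain Bb where Bb: "\<And>x. norm (b x * ?e x) \<le> Bb" using polynomial_growth_gauss(2)[OF gb _ cA] by auto
  have DB: "norm (?D x) \<le> Ba + Bb" for x
    using norm_triangle_ineq4[of "?h a x" "?h b x"] Ba[of x] Bb[of x] by (simp add: norm_mult)
  have iD: "integrable lborel ?D" using ia ib by (rule Bochner_Integration.integrable_diff)
  have z: "(LINT x|lborel. ?D x * cnj (?D x)) = 0"
    by (rule fourier_uniqueness[OF iD FT, of _ "Ba + Bb"]) (use cD DB in \<open>auto intro!: continuous_intros simp del: complex_cnj_diff complex_cnj_mult\<close>)
  have n2: "?D x * cnj (?D x) = complex_of_real ((norm (?D x))\<^sup>2)" for x
    by (rule complex_norm_square[symmetric])
  have "complex_of_real (LINT x|lborel. (norm (?D x))\<^sup>2) = (LINT x|lborel. ?D x * cnj (?D x))"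
    unfolding n2 by (rule integral_complex_of_real[symmetric])
  then have "complex_of_real (LINT x|lborel. (norm (?D x))\<^sup>2) = 0"
    unfolding z .
  then have int0: "(LINT x|lborel. (norm (?D x))\<^sup>2) = 0" by (simp only: of_real_eq_0_iff)
  have i2: "integrable lborel (\<lambda>x. (norm (?D x))\<^sup>2)"
  proof (rule Bochner_Integration.integrable_bound)
    show "integrable lborel (\<lambda>x. (Ba + Bb) * norm (?D x))" by (intro integrable_mult_right integrable_norm iD)
    show "AE x in lborel. norm ((norm (?D x))\<^sup>2) \<le> norm ((Ba + Bb) * norm (?D x))"
    proof (rule AE_I2)
      fix x
      have "(norm (?D x))\<^sup>2 \<le> (Ba + Bb) * norm (?D x)"
        unfolding power2_eq_square[of "norm (?D x)"] by (rule mult_right_mono[OF DB norm_ge_zero])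
      then show "norm ((norm (?D x))\<^sup>2) \<le> norm ((Ba + Bb) * norm (?D x))" by simp
    qed
  qed (use iD in \<open>auto dest: borel_measurable_integrable\<close>)
  have "AE x in lborel. (norm (?D x))\<^sup>2 = 0"
    using int0 integral_nonneg_eq_0_iff_AE[OF i2] by simp
  then have "AE x in lborel. ?D x = 0" by simp
  from continuous_AE_zero[OF cD this] have "?D X = 0" for X .
  then show "a = b" by (auto simp: fun_eq_iff)
qed

section \<open>Derivative estimates\<close>

definition sym_lam :: "real \<Rightarrow> real \<Rightarrow> real" where "sym_lam \<tau> r = (1 - r^4) / sym_denom \<tau> r"

definition sym_mu :: "real \<Rightarrow> real \<Rightarrow> real" where "sym_mu \<tau> r = \<tau> * (1 - r\<^sup>2)\<^sup>2 / sym_denom \<tau> r"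

definition sym_weight :: "nat \<Rightarrow> real \<Rightarrow> real \<Rightarrow> real" where
  "sym_weight d \<tau> r = r ^ (d - 1) * (2 / sqrt (sym_denom \<tau> r)) ^ d"

text \<open>Real and imaginary parts of - lam Z . Z + 2 i mu (z . \<zeta>) at the complex point Z =
  (z, \<zeta>) = X + i Y, with bilinear products and with lam, mu for \<open>sym_lam\<close>,
  \<open>sym_mu\<close>. At Y = 0 it is the exponent of \<open>mehler_symbol\<close>.\<close>

definition ext_exponent :: "real \<Rightarrow> real \<Rightarrow> 'a::euclidean_space \<times> 'a \<Rightarrow> 'a \<times> 'a \<Rightarrow> complex" where
  "ext_exponent \<tau> r X Y =
     complex_of_real (- sym_lam \<tau> r * (X \<bullet> X - Y \<bullet> Y) - 2 * sym_mu \<tau> r * (fst X \<bullet> snd Y + fst Y \<bullet> snd X))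
     + \<i> * complex_of_real (- 2 * sym_lam \<tau> r * (X \<bullet> Y) + 2 * sym_mu \<tau> r * (fst X \<bullet> snd X - fst Y \<bullet> snd Y))"

text \<open>The closed interval replaces the open one because weight and exponent are continuous up
  to both ends; continuity and the Leibniz rule for parameter integrals over a compact interval then
  apply.\<close>

definition green_symbol_ext :: "real \<Rightarrow> 'a::euclidean_space \<times> 'a \<Rightarrow> 'a \<times> 'a \<Rightarrow> complex" where
  "green_symbol_ext \<tau> X Y = integral (cbox 0 1) (\<lambda>r. complex_of_real (sym_weight DIM('a) \<tau> r) * exp (ext_exponent \<tau> r X Y))"

section \<open>The entire extension of the symbol\<close>

lemma sym_denom_continuous [continuous_intros]:
  "continuous_on S f \<Longrightarrow> continuous_on S (\<lambda>x. sym_denom \<tau> (f x))"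
  unfolding sym_denom_def by (intro continuous_intros)

lemma sym_denom_neq_0 [simp]: "sym_denom \<tau> r \<noteq> 0"
  using sym_denom_ge_1[of \<tau> r] by auto

lemma sym_lam_continuous [continuous_intros]:
  "continuous_on S f \<Longrightarrow> continuous_on S (\<lambda>x. sym_lam \<tau> (f x))"
  unfolding sym_lam_def by (intro continuous_intros) auto

lemma sym_mu_continuous [continuous_intros]:
  "continuous_on S f \<Longrightarrow> continuous_on S (\<lambda>x. sym_mu \<tau> (f x))"
  unfolding sym_mu_def by (intro continuous_intros) auto

lemma sym_weight_continuous [continuous_intros]:
  "continuous_on S f \<Longrightarrow> continuous_on S (\<lambda>x. sym_weight d \<tau> (f x))"
  unfolding sym_weight_def by (intro continuous_intros) auto

lemma ext_exponent_continuous [continuous_intros]: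
  assumes "continuous_on S f" "continuous_on S g" "continuous_on S h"
  shows "continuous_on S (\<lambda>x. ext_exponent \<tau> (f x) (g x) (h x))"
  unfolding ext_exponent_def by (intro continuous_intros assms)

text \<open>On each complex line the exponent is a quadratic polynomial in \<open>w\<close> whose
  coefficients depend continuously on \<open>r\<close>, so the integral can be differentiated under
  the integral sign.\<close>

lemma entire_ext_green_symbol: "entire_ext (green_symbol_ext \<tau> :: 'a::euclidean_space \<times> 'a \<Rightarrow> _)"
  unfolding entire_ext_def
proof (intro conjI ballI allI)
  let ?f = "\<lambda>r (X::'a \<times> 'a) Y. complex_of_real (sym_weight DIM('a) \<tau> r) * exp (ext_exponent \<tau> r X Y)"
  show "continuous_on UNIV (\<lambda>p. green_symbol_ext \<tau> (fst p) (snd p :: 'a \<times> 'a))"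
    unfolding green_symbol_ext_def
    by (rule integral_continuous_on_param) (auto simp: split_def intro!: continuous_intros)
  fix v X Y :: "'a \<times> 'a"
  define c1 where "c1 r = Complex (- 2 * sym_lam \<tau> r * (X \<bullet> v) - 2 * sym_mu \<tau> r * (fst Y \<bullet> snd v + fst v \<bullet> snd Y))
     (- 2 * sym_lam \<tau> r * (Y \<bullet> v) + 2 * sym_mu \<tau> r * (fst X \<bullet> snd v + fst v \<bullet> snd X))" for r
  define c2 where "c2 r = Complex (- sym_lam \<tau> r * (v \<bullet> v)) (2 * sym_mu \<tau> r * (fst v \<bullet> snd v))" for r
  have E: "ext_exponent \<tau> r (X + Re w *\<^sub>R v) (Y + Im w *\<^sub>R v) = ext_exponent \<tau> r X Y + c1 r * w + c2 r * w\<^sup>2" for r w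
  proof -
    have i: "(X + a *\<^sub>R v) \<bullet> (X + a *\<^sub>R v) = X \<bullet> X + 2 * a * (X \<bullet> v) + a\<^sup>2 * (v \<bullet> v)"
      "(Y + a *\<^sub>R v) \<bullet> (Y + a *\<^sub>R v) = Y \<bullet> Y + 2 * a * (Y \<bullet> v) + a\<^sup>2 * (v \<bullet> v)"
      "(X + a *\<^sub>R v) \<bullet> (Y + b *\<^sub>R v) = X \<bullet> Y + b * (X \<bullet> v) + a * (Y \<bullet> v) + a * b * (v \<bullet> v)" for a b
      by (simp_all add: inner_add_left inner_add_right inner_commute[of v X] inner_commute[of v Y]
          power2_eq_square distrib_left del: inner_prod_def)
    have j: "fst (U + a *\<^sub>R v) \<bullet> snd (V + b *\<^sub>R v) = fst U \<bullet> snd V + b * (fst U \<bullet> snd v) + a * (fst v \<bullet> snd V) + a * b * (fst v \<bullet> snd v)" for U V a b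
      by (simp add: inner_add_left inner_add_right algebra_simps)
    have re: "- l * ((xx + 2 * a * xv + a\<^sup>2 * vv) - (yy + 2 * b * yv + b\<^sup>2 * vv))
         - 2 * m * ((p + b * p1 + a * p2 + a * b * p3) + (q + a * q1 + b * q2 + b * a * p3))
       = (- l * (xx - yy) - 2 * m * (p + q)) + ((- 2 * l * xv - 2 * m * (q1 + p2)) * a - (- 2 * l * yv + 2 * m * (p1 + q2)) * b)
         + (- l * vv * (a\<^sup>2 - b\<^sup>2) - 2 * m * p3 * (2 * a * b))"
      for l m a b xx xv vv yy yv p p1 p2 p3 q q1 q2 :: real
      by algebra
    have im: "- 2 * l * (xy + b * xv + a * yv + a * b * vv)
         + 2 * m * ((p + a * p1 + a * p2 + a * a * p3) - (q + b * q1 + b * q2 + b * b * p3))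
       = (- 2 * l * xy + 2 * m * (p - q)) + ((- 2 * l * xv - 2 * m * (q1 + q2)) * b + (- 2 * l * yv + 2 * m * (p1 + p2)) * a)
         + (- l * vv * (2 * a * b) + 2 * m * p3 * (a\<^sup>2 - b\<^sup>2))"
      for l m a b xy xv vv yv p p1 p2 p3 q q1 q2 :: real
      by algebra
    have cw: "Complex A B * w = Complex (A * Re w - B * Im w) (A * Im w + B * Re w)"
      "Complex A B * w\<^sup>2 = Complex (A * ((Re w)\<^sup>2 - (Im w)\<^sup>2) - B * (2 * Re w * Im w)) (A * (2 * Re w * Im w) + B * ((Re w)\<^sup>2 - (Im w)\<^sup>2))" for A B
      by (simp_all add: complex_eq_iff power2_eq_square)
    have ce: "complex_of_real A + \<i> * complex_of_real B = Complex A B" for A B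
      by (simp add: complex_eq_iff)
    show ?thesis
      unfolding ext_exponent_def i j c1_def c2_def ce cw re im complex_add by (simp only: add_ac)
  qed
  have c1: "continuous_on S (\<lambda>x. c1 (g x))" "continuous_on S (\<lambda>x. c2 (g x))"
    if "continuous_on S g" for S and g :: "complex \<times> real \<Rightarrow> real"
    unfolding c1_def c2_def Complex_eq by (intro continuous_intros that)+
  have "(\<lambda>w. integral (cbox 0 1) (\<lambda>r. ?f r (X + Re w *\<^sub>R v) (Y + Im w *\<^sub>R v))) field_differentiable at w within UNIV" for w
  proof (rule leibniz_rule_field_differentiable)
    fix w :: complex and r :: real
    show "((\<lambda>w. ?f r (X + Re w *\<^sub>R v) (Y + Im w *\<^sub>R v)) has_field_derivative
       complex_of_real (sym_weight DIM('a) \<tau> r) * (exp (ext_exponent \<tau> r X Y + c1 r * w + c2 r * w\<^sup>2) * (c1 r + c2 r * (2 * w)))) (at w within UNIV)"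
      unfolding E by (auto intro!: derivative_eq_intros)
  next
    show "continuous_on (UNIV \<times> cbox 0 1) (\<lambda>(w, r). complex_of_real (sym_weight DIM('a) \<tau> r) * (exp (ext_exponent \<tau> r X Y + c1 r * w + c2 r * w\<^sup>2) * (c1 r + c2 r * (2 * w))))"
      unfolding split_def by (intro continuous_intros c1)
  next
    fix w
    show "(\<lambda>r. ?f r (X + Re w *\<^sub>R v) (Y + Im w *\<^sub>R v)) integrable_on cbox 0 1"
      by (intro integrable_continuous continuous_intros)
  qed auto
  then show "(\<lambda>w. green_symbol_ext \<tau> (X + Re w *\<^sub>R v) (Y + Im w *\<^sub>R v)) holomorphic_on UNIV"
    unfolding green_symbol_ext_def by (simp add: holomorphic_on_def)
qed

lemma green_symbol_ext_real: "green_symbol_ext \<tau> X 0 = green_symbol \<tau> (X :: 'a::euclidean_space \<times> 'a)"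
proof -
  let ?f = "\<lambda>r. complex_of_real (sym_weight DIM('a) \<tau> r) * exp (ext_exponent \<tau> r X 0)"
  have cont: "continuous_on {0..1} ?f" by (intro continuous_intros)
  have "green_symbol_ext \<tau> X 0 = (LINT r|lborel. indicator {0..1} r *\<^sub>R ?f r)"
    using set_borel_integral_eq_integral(2)[OF borel_integrable_atLeastAtMost'[OF cont]]
    by (simp add: green_symbol_ext_def set_lebesgue_integral_def cbox_interval)
  also have "\<dots> = (LINT r|lborel. mehler_symbol \<tau> r X)"
  proof (rule integral_cong_AE)
    have "AE r in lborel. r \<noteq> (0::real)" "AE r in lborel. r \<noteq> (1::real)"
      by (rule AE_lborel_singleton)+
    then show "AE r in lborel. indicator {0..1} r *\<^sub>R ?f r = mehler_symbol \<tau> r X"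
    proof eventually_elim
      case (elim r)
      have "exp (ext_exponent \<tau> r X 0) = complex_of_real (exp (- sym_lam \<tau> r * (norm X)\<^sup>2)) * iexp (2 * sym_mu \<tau> r * (fst X \<bullet> snd X))"
        unfolding ext_exponent_def exp_add exp_of_real power2_norm_eq_inner by simp
      then show ?case
        using elim unfolding mehler_symbol_def sym_lam_def sym_mu_def sym_weight_def
        by (auto simp: indicator_def)
    qed
    show "(\<lambda>r. indicator {0..1} r *\<^sub>R ?f r) \<in> borel_measurable lborel"
      using borel_integrable_atLeastAtMost'[OF cont] by (auto simp: set_integrable_def dest: borel_measurable_integrable)
    show "(\<lambda>r. mehler_symbol \<tau> r X) \<in> borel_measurable lborel"
      using mehler_symbol_measurable[of "\<lambda>r. r" lborel "\<lambda>_. fst X" "\<lambda>_. snd X" \<tau>] by simp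
  qed
  finally show ?thesis by (simp add: green_symbol_def)
qed

section \<open>Bounds on the extension\<close>

text \<open>What makes the estimates uniform in \<open>r\<close>: the first bound gives decay at
  rate 1 - r, the second limits growth in imaginary directions, the third controls the mixed term.
  It is plausible near \<open>r = 1\<close>, where \<open>sym_mu\<close> has the factor (1 - r)^2
  and \<open>sym_lam\<close> only 1 - r.\<close>

lemma sym_lam_bounds:
  assumes r: "0 \<le> r" "r \<le> 1"
  shows "(1 - r) / (4 + \<tau>\<^sup>2) \<le> sym_lam \<tau> r" "sym_lam \<tau> r \<le> 1" "(sym_mu \<tau> r)\<^sup>2 \<le> sym_lam \<tau> r"
proof -
  define a s N where "a = 1 + r\<^sup>2" and "s = 1 - r\<^sup>2" and "N = sym_denom \<tau> r"
  have r2: "r\<^sup>2 \<le> 1" using r by (intro power_le_one)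
  have a: "1 \<le> a" "a \<le> 2" and s: "0 \<le> s" "s \<le> 1" "s \<le> a" using r2 by (auto simp: a_def s_def)
  have N: "N = a\<^sup>2 + \<tau>\<^sup>2 * s\<^sup>2" by (simp add: N_def sym_denom_def a_def s_def power_mult_distrib)
  have N1: "N \<ge> 1" using sym_denom_ge_1[of \<tau> r] by (simp add: N_def)
  have q: "1 - r^4 = s * a" by (simp add: a_def s_def algebra_simps power2_eq_square power4_eq_xxxx)
  have lam: "sym_lam \<tau> r = s * a / N" by (simp add: sym_lam_def q N_def)
  have mu: "sym_mu \<tau> r = \<tau> * s\<^sup>2 / N" by (simp add: sym_mu_def s_def N_def)
  have a2: "a\<^sup>2 \<le> 4" using power_mono[of a 2 2] a by simp
  have s2: "s\<^sup>2 \<le> 1" using s by (simp add: power_le_one)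
  have Nle: "N \<le> 4 + \<tau>\<^sup>2"
    unfolding N using a2 mult_left_mono[OF s2, of "\<tau>\<^sup>2"] by simp
  have "1 - r \<le> s" unfolding s_def using r by (simp add: power2_eq_square mult_left_le)
  also have "\<dots> \<le> s * a" using a s by (simp add: mult_left_mono[of 1 a s, simplified])
  finally have "1 - r \<le> s * a" .
  then show "(1 - r) / (4 + \<tau>\<^sup>2) \<le> sym_lam \<tau> r"
    unfolding lam using N1 Nle r by (intro frac_le) auto
  have "s * a \<le> a * a" using a s by (intro mult_right_mono) auto
  also have "\<dots> \<le> N" by (simp add: N power2_eq_square)
  finally show "sym_lam \<tau> r \<le> 1" unfolding lam using N1 by simp
  have "(sym_mu \<tau> r)\<^sup>2 = (\<tau>\<^sup>2 * s\<^sup>2) * (s * s) / (N * N)"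
    by (simp add: mu power2_eq_square)
  also have "\<dots> \<le> N * (s * a) / (N * N)"
  proof (rule divide_right_mono, rule mult_mono)
    show "\<tau>\<^sup>2 * s\<^sup>2 \<le> N" by (simp add: N)
    show "s * s \<le> s * a" using s by (simp add: mult_left_mono)
  qed (use N1 s a in auto)
  also have "\<dots> = sym_lam \<tau> r" using N1 by (simp add: lam)
  finally show "(sym_mu \<tau> r)\<^sup>2 \<le> sym_lam \<tau> r" .
qed

text \<open>The mixed term is at most 2 (|m| |X|) |Y| \<le> m^2 |X|^2 / 2 + 2 |Y|^2, and m^2 \<le> l
  spends half of the decay in \<open>X\<close>. The 3 is this 2 plus 1 from l |Y|^2 \<le>
  |Y|^2.\<close>

lemma Re_ext_exponent_le:
  fixes X Y :: "'a::euclidean_space \<times> 'a"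
  assumes r: "0 \<le> r" "r \<le> 1"
  shows "Re (ext_exponent \<tau> r X Y) \<le> - (sym_lam \<tau> r / 2) * (norm X)\<^sup>2 + 3 * (norm Y)\<^sup>2"
proof -
  define l m where "l = sym_lam \<tau> r" and "m = sym_mu \<tau> r"
  have lm: "m\<^sup>2 \<le> l" "l \<le> 1" using sym_lam_bounds[OF r] by (auto simp: l_def m_def)
  let ?p = "fst X \<bullet> snd Y + fst Y \<bullet> snd X"
  have "?p = X \<bullet> (snd Y, fst Y)" by (simp add: inner_prod_def inner_commute)
  moreover have "norm (snd Y, fst Y) = norm Y" by (simp add: norm_prod_def add.commute)
  ultimately have p: "\<bar>?p\<bar> \<le> norm X * norm Y" using Cauchy_Schwarz_ineq2[of X "(snd Y, fst Y)"] by simp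
  have "- (2 * m * ?p) \<le> 2 * (\<bar>m\<bar> * norm X) * norm Y"
  proof -
    have "- (2 * m * ?p) \<le> 2 * (\<bar>m\<bar> * \<bar>?p\<bar>)"
      using abs_ge_minus_self[of "m * ?p"] by (simp add: abs_mult)
    also have "\<dots> \<le> 2 * (\<bar>m\<bar> * (norm X * norm Y))" by (intro mult_left_mono p) auto
    finally show ?thesis by (simp add: mult.assoc)
  qed
  also have "\<dots> \<le> (\<bar>m\<bar> * norm X)\<^sup>2 / 2 + 2 * (norm Y)\<^sup>2"
    using zero_le_power2[of "\<bar>m\<bar> * norm X - 2 * norm Y"] by (simp add: power2_diff power_mult_distrib)
  also have "(\<bar>m\<bar> * norm X)\<^sup>2 \<le> l * (norm X)\<^sup>2"
    unfolding power_mult_distrib power2_abs by (intro mult_right_mono lm) auto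
  finally have 1: "- (2 * m * ?p) \<le> l * (norm X)\<^sup>2 / 2 + 2 * (norm Y)\<^sup>2" by simp
  have 2: "l * (norm Y)\<^sup>2 \<le> (norm Y)\<^sup>2"
    using mult_right_mono[OF lm(2), of "(norm Y)\<^sup>2"] by simp
  have "Re (ext_exponent \<tau> r X Y) = - l * (norm X)\<^sup>2 + l * (norm Y)\<^sup>2 - 2 * m * ?p"
    by (simp add: ext_exponent_def l_def m_def power2_norm_eq_inner algebra_simps)
  with 1 2 show ?thesis unfolding l_def[symmetric] by simp
qed

text \<open>The integral is at most 1 and, for positive \<beta>, at most 1 / \<beta>; the stated
  quotient covers both regimes without a singularity at 0.\<close>

lemma integral_exp_decay_le:
  fixes \<beta> :: real
  assumes "\<beta> \<ge> 0"
  shows "integral {0..1} (\<lambda>r. exp (- \<beta> * (1 - r))) \<le> 2 / (1 + \<beta>)"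
proof (cases "\<beta> \<le> 1")
  case True
  have "integral {0..1} (\<lambda>r. exp (- \<beta> * (1 - r))) \<le> integral {0..1} (\<lambda>r::real. 1)"
    by (intro integral_le integrable_continuous_real continuous_intros) (use assms in auto)
  also have "\<dots> \<le> 2 / (1 + \<beta>)" using True assms by simp
  finally show ?thesis .
next
  case False
  have "((\<lambda>r. exp (- \<beta> * (1 - r))) has_integral exp (- \<beta> * (1 - 1)) / \<beta> - exp (- \<beta> * (1 - 0)) / \<beta>) {0..1}"
    using False by (intro fundamental_theorem_of_calculus)
      (auto intro!: derivative_eq_intros simp flip: has_real_derivative_iff_has_vector_derivative)
  then have "integral {0..1} (\<lambda>r. exp (- \<beta> * (1 - r))) = exp (- \<beta> * (1 - 1)) / \<beta> - exp (- \<beta> * (1 - 0)) / \<beta>"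
    by (rule integral_unique)
  also have "\<dots> \<le> 1 / \<beta>" using False by simp
  also have "\<dots> \<le> 2 / (1 + \<beta>)" using False by (simp add: field_simps)
  finally show ?thesis .
qed

text \<open>The Gaussian decays in X' while the claim is about X: passing between them costs half of
  |X|^2 and a multiple of \<rho>^2. The \<open>r\<close>-integral with \<beta> proportional to |X|^2
  then produces the factor (jbracket X)^(-2).\<close>

lemma norm_green_symbol_ext_le:
  fixes X X' Y' :: "'a::euclidean_space \<times> 'a"
  assumes near: "norm (X' - X) \<le> \<rho>" "norm Y' \<le> \<rho>"
  shows "norm (green_symbol_ext \<tau> X' Y') \<le> 2 ^ DIM('a) * (8 * (4 + \<tau>\<^sup>2)) * exp (4 * \<rho>\<^sup>2) / (jbracket X)\<^sup>2"
proof -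
  define c where "c = 1 / (4 + \<tau>\<^sup>2)"
  \<comment> \<open>The quarter is the product of two halves, one lost in
    \<open>Re_ext_exponent_le\<close> and one in passing from X' to X.\<close>
  define \<beta> where "\<beta> = c / 4 * (norm X)\<^sup>2"
  have "4 + \<tau>\<^sup>2 \<ge> 4" by simp
  then have "0 < 4 + \<tau>\<^sup>2" "1 \<le> 4 + \<tau>\<^sup>2" by linarith+
  then have c: "0 < c" "c \<le> 1"
    unfolding c_def by (auto intro: divide_pos_pos simp only: divide_le_eq_1_pos zero_less_one)
  have \<beta>: "\<beta> \<ge> 0" using c by (simp add: \<beta>_def)
  have \<rho>: "\<rho> \<ge> 0" using order_trans[OF norm_ge_zero near(2)] .
  have "norm X \<le> norm X' + \<rho>"
    using norm_triangle_sub[of X X'] near(1) by (simp add: norm_minus_commute)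
  then have "(norm X)\<^sup>2 \<le> (norm X' + \<rho>)\<^sup>2" by (intro power_mono) auto
  also have "\<dots> \<le> 2 * (norm X')\<^sup>2 + 2 * \<rho>\<^sup>2"
    using sum_squares_bound[of "norm X'" \<rho>] by (simp add: power2_sum)
  finally have XX: "(norm X)\<^sup>2 / 2 - \<rho>\<^sup>2 \<le> (norm X')\<^sup>2" by simp
  have YY: "(norm Y')\<^sup>2 \<le> \<rho>\<^sup>2" using near(2) by (intro power_mono) auto
  let ?f = "\<lambda>r. complex_of_real (sym_weight DIM('a) \<tau> r) * exp (ext_exponent \<tau> r X' Y')"
  have b: "norm (?f r) \<le> 2 ^ DIM('a) * exp (4 * \<rho>\<^sup>2) * exp (- \<beta> * (1 - r))" if "r \<in> cbox 0 1" for r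
  proof -
    have r: "0 \<le> r" "r \<le> 1" using that by auto
    \<comment> \<open>A lower bound for \<open>sym_lam\<close> that is also at most 1: the loss k
      \<rho>^2 / 2 stays below \<rho>^2 and, added to 3 \<rho>^2, gives the 4 in the claim.\<close>
    define k where "k = c * (1 - r)"
    have k: "0 \<le> k" "k \<le> 1" unfolding k_def using c r by (auto intro: mult_le_one)
    have kl: "k \<le> sym_lam \<tau> r" using sym_lam_bounds(1)[OF r] by (simp add: k_def c_def)
    have "sym_weight DIM('a) \<tau> r \<ge> 0" using r sym_denom_ge_1[of \<tau> r] by (simp add: sym_weight_def)
    moreover have "sym_weight DIM('a) \<tau> r \<le> 2 ^ DIM('a)"
      unfolding sym_weight_def by (rule mehler_symbol_weight_le[OF r])
    ultimately have w: "norm (complex_of_real (sym_weight DIM('a) \<tau> r)) \<le> 2 ^ DIM('a)" by simp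
    have "Re (ext_exponent \<tau> r X' Y') \<le> - (sym_lam \<tau> r / 2) * (norm X')\<^sup>2 + 3 * (norm Y')\<^sup>2"
      by (rule Re_ext_exponent_le[OF r])
    also have "\<dots> \<le> - (k / 2) * (norm X')\<^sup>2 + 3 * \<rho>\<^sup>2"
      using YY kl by (intro add_mono mult_right_mono) auto
    also have "\<dots> \<le> - (k / 2) * ((norm X)\<^sup>2 / 2 - \<rho>\<^sup>2) + 3 * \<rho>\<^sup>2"
      using mult_left_mono[OF XX, of "k / 2"] k by simp
    also have "\<dots> \<le> 4 * \<rho>\<^sup>2 + - \<beta> * (1 - r)"
    proof -
      have "- (k / 2) * ((norm X)\<^sup>2 / 2 - \<rho>\<^sup>2) = - \<beta> * (1 - r) + k * \<rho>\<^sup>2 / 2"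
        by (simp add: \<beta>_def k_def algebra_simps)
      then show ?thesis
        using mult_right_mono[OF k(2), of "\<rho>\<^sup>2"] zero_le_power2[of \<rho>] by linarith
    qed
    finally have "norm (exp (ext_exponent \<tau> r X' Y')) \<le> exp (4 * \<rho>\<^sup>2) * exp (- \<beta> * (1 - r))"
      unfolding norm_exp_eq_Re exp_add[symmetric] by simp
    from mult_mono[OF w this] show ?thesis unfolding norm_mult by (simp add: mult.assoc)
  qed
  have ci: "(\<lambda>r. 2 ^ DIM('a) * exp (4 * \<rho>\<^sup>2) * exp (- \<beta> * (1 - r))) integrable_on cbox 0 1"
    by (intro integrable_continuous continuous_intros)
  have "norm (green_symbol_ext \<tau> X' Y') \<le> integral (cbox 0 1) (\<lambda>r. 2 ^ DIM('a) * exp (4 * \<rho>\<^sup>2) * exp (- \<beta> * (1 - r)))"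
    unfolding green_symbol_ext_def
    by (rule integral_norm_bound_integral[OF _ ci b]) (intro integrable_continuous continuous_intros)
  also have "\<dots> = 2 ^ DIM('a) * exp (4 * \<rho>\<^sup>2) * integral {0..1} (\<lambda>r. exp (- \<beta> * (1 - r)))"
    by (simp add: cbox_interval)
  also have "\<dots> \<le> 2 ^ DIM('a) * exp (4 * \<rho>\<^sup>2) * (2 / (1 + \<beta>))"
    by (intro mult_left_mono integral_exp_decay_le \<beta>) auto
  also have "2 / (1 + \<beta>) \<le> 8 * (4 + \<tau>\<^sup>2) / (jbracket X)\<^sup>2"
  proof -
    have "c / 4 * (jbracket X)\<^sup>2 \<le> 1 + \<beta>" using c by (simp add: jbracket_sq \<beta>_def distrib_left)
    moreover have "0 < c / 4 * (jbracket X)\<^sup>2" using c jbracket_pos[of X] by simp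
    ultimately have "2 / (1 + \<beta>) \<le> 2 / (c / 4 * (jbracket X)\<^sup>2)" by (intro divide_left_mono) auto
    also have "\<dots> = 8 * (4 + \<tau>\<^sup>2) / (jbracket X)\<^sup>2" by (simp add: c_def)
    finally show ?thesis .
  qed
  finally show ?thesis by (simp add: mult_ac mult_left_mono)
qed

section \<open>Factorials and the derivative bound\<close>

text \<open>One term of the exponential series at n is at most the whole sum.\<close>

lemma power_self_le_exp_fact: "real n ^ n \<le> exp (real n) * fact n"
proof -
  have "(\<Sum>k\<in>{n}. real n ^ k /\<^sub>R fact k) \<le> (\<Sum>k. real n ^ k /\<^sub>R fact k)"
    by (rule sum_le_suminf[OF summable_exp_generic]) auto
  then have "real n ^ n / fact n \<le> exp (real n)" by (simp add: exp_def divide_inverse mult.commute)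
  then show ?thesis by (simp add: field_simps)
qed

text \<open>Adding an index multiplies by a binomial coefficient, which is at most 2 to the current
  total. Each element of \<open>S\<close> thus contributes one power of 2 with the total as
  exponent.\<close>

lemma fact_sum_le:
  fixes \<alpha> :: "'b \<Rightarrow> nat"
  assumes "finite S"
  shows "fact (\<Sum>i\<in>S. \<alpha> i) \<le> (2 ^ card S) ^ (\<Sum>i\<in>S. \<alpha> i) * (\<Prod>i\<in>S. fact (\<alpha> i) :: nat)"
  using assms
proof (induction S rule: finite_induct)
  case (insert j S)
  let ?a = "\<alpha> j" and ?m = "\<Sum>i\<in>S. \<alpha> i" and ?P = "\<Prod>i\<in>S. fact (\<alpha> i) :: nat"
  have "fact (?a + ?m) = fact ?a * fact ?m * ((?a + ?m) choose ?a)"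
    using binomial_fact_lemma[of ?a "?a + ?m"] by simp
  also have "\<dots> \<le> fact ?a * ((2 ^ card S) ^ ?m * ?P) * 2 ^ (?a + ?m)"
    by (intro mult_mono insert.IH binomial_le_pow2) auto
  also have "\<dots> = (2 ^ card S) ^ ?m * 2 ^ (?a + ?m) * (fact ?a * ?P)" by (simp only: mult_ac)
  also have "\<dots> \<le> (2 ^ card S) ^ (?a + ?m) * 2 ^ (?a + ?m) * (fact ?a * ?P)"
    by (intro mult_right_mono power_increasing) auto
  also have "\<dots> = (2 ^ card (insert j S)) ^ (?a + ?m) * (fact ?a * ?P)"
    using insert.hyps by (simp add: power_mult_distrib)
  finally show ?case using insert.hyps by simp
qed simp

lemma norm_mderiv_green_symbol_le:
  fixes X :: "'a::euclidean_space \<times> 'a"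
  shows "norm (mderiv \<alpha> (green_symbol \<tau>) X) \<le> 2 ^ DIM('a) * (8 * (4 + \<tau>\<^sup>2))
    * (exp 5 * 2 ^ DIM('a \<times> 'a)) ^ mindex_order \<alpha> * sqrt (real (mindex_fact \<alpha>)) * inverse ((jbracket X)\<^sup>2)"
proof -
  let ?B = "2 ^ DIM('a) * (8 * (4 + \<tau>\<^sup>2))" and ?D = "DIM('a \<times> 'a)"
  define n where "n = mindex_order \<alpha>"
  obtain vs where vs: "mderiv \<alpha> (green_symbol \<tau> :: 'a \<times> 'a \<Rightarrow> complex) = foldr partial_deriv vs (green_symbol \<tau>)"
    "vs \<in> lists Basis" "length vs = n"
    unfolding n_def by (rule mderiv_eq_foldr)
  let ?\<Phi> = "green_symbol_ext \<tau> :: 'a \<times> 'a \<Rightarrow> 'a \<times> 'a \<Rightarrow> complex"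
  have gs: "green_symbol \<tau> = (\<lambda>X. ?\<Phi> X 0)" by (simp add: green_symbol_ext_real fun_eq_iff)
  \<comment> \<open>The \<open>n\<close> circles reach distance at most sqrt n, so the growth of the
    extension costs exp (4n), which is geometric in \<open>n\<close>. The maximum keeps \<rho>
    positive when \<open>n = 0\<close>.\<close>
  define \<rho> where "\<rho> = 1 / sqrt (real (max n 1))"
  have \<rho>: "\<rho> > 0" by (simp add: \<rho>_def)
  have nr: "real n * \<rho> \<le> sqrt (real n)"
    by (cases "n = 0") (auto simp: \<rho>_def real_div_sqrt)
  have "norm (foldr cderiv vs ?\<Phi> X 0) \<le> (?B * exp (4 * real n) / (jbracket X)\<^sup>2) / \<rho> ^ length vs"
  proof (rule norm_foldr_cderiv_le[OF entire_ext_green_symbol \<rho> vs(2)])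
    fix X' Y' :: "'a \<times> 'a" assume "norm (X' - X) \<le> length vs * \<rho>" "norm (Y' - 0) \<le> length vs * \<rho>"
    then have "norm (X' - X) \<le> sqrt (real n)" "norm Y' \<le> sqrt (real n)" using nr by (auto simp: vs(3))
    from norm_green_symbol_ext_le[OF this, of \<tau>]
    show "norm (?\<Phi> X' Y') \<le> ?B * exp (4 * real n) / (jbracket X)\<^sup>2" by simp
  qed
  also have "\<dots> = ?B * exp (4 * real n) * (1 / \<rho>) ^ n * inverse ((jbracket X)\<^sup>2)"
    by (simp add: vs(3) power_divide divide_inverse mult_ac power_inverse)
  also have "\<dots> \<le> ?B * exp (4 * real n) * (exp (real n) * (2 ^ ?D) ^ n * sqrt (real (mindex_fact \<alpha>))) * inverse ((jbracket X)\<^sup>2)"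
  proof (intro mult_right_mono mult_left_mono)
    have "(1 / \<rho>) ^ n = sqrt (real n ^ n)"
      by (cases "n = 0") (auto simp: \<rho>_def real_sqrt_power)
    also have "\<dots> \<le> sqrt (exp (real n) * ((2 ^ ?D) ^ n * real (mindex_fact \<alpha>)))"
    proof (rule real_sqrt_le_mono)
      have "real (fact n) \<le> real ((2 ^ ?D) ^ n * mindex_fact \<alpha>)"
        unfolding n_def mindex_order_def mindex_fact_def
        by (intro of_nat_mono fact_sum_le[of "Basis :: ('a \<times> 'a) set" \<alpha>]) simp
      then have "exp (real n) * fact n \<le> exp (real n) * ((2 ^ ?D) ^ n * real (mindex_fact \<alpha>))"
        by (intro mult_left_mono) auto
      with power_self_le_exp_fact[of n] show "real n ^ n \<le> exp (real n) * ((2 ^ ?D) ^ n * real (mindex_fact \<alpha>))"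
        by (rule order_trans)
    qed
    also have "\<dots> = sqrt (exp (real n)) * (sqrt ((2 ^ ?D) ^ n) * sqrt (real (mindex_fact \<alpha>)))"
      by (simp only: real_sqrt_mult)
    also have "\<dots> \<le> exp (real n) * ((2 ^ ?D) ^ n * sqrt (real (mindex_fact \<alpha>)))"
    proof -
      \<comment> \<open>Square roots of numbers at least 1 are dropped, except that of
        \<open>mindex_fact \<alpha>\<close>. Hence the \<open>exp 5\<close> in the final base: 4
        from the growth of the extension and 1 from here.\<close>
      have sq: "sqrt y \<le> y" if "y \<ge> 1" for y :: real
        using that by (intro real_le_lsqrt) (auto simp: power2_eq_square intro: mult_left_mono[of 1, simplified])
      show ?thesis by (intro mult_mono sq mult_nonneg_nonneg) auto
    qed
    finally show "(1 / \<rho>) ^ n \<le> exp (real n) * (2 ^ ?D) ^ n * sqrt (real (mindex_fact \<alpha>))" by (simp add: mult.assoc)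
  qed (use jbracket_pos[of X] in auto)
  also have "\<dots> = ?B * (exp (4 * real n) * exp (real n) * (2 ^ ?D) ^ n) * sqrt (real (mindex_fact \<alpha>)) * inverse ((jbracket X)\<^sup>2)"
    by (simp only: mult_ac)
  also have "exp (4 * real n) * exp (real n) * (2 ^ ?D) ^ n = (exp 5 * 2 ^ ?D) ^ n"
    by (simp add: power_mult_distrib mult.commute flip: exp_add exp_of_nat_mult)
  finally show ?thesis
    unfolding vs(1) unfolding gs entire_ext_foldr_partial_deriv[OF entire_ext_green_symbol vs(2)] n_def .
qed

section \<open>Identification of the symbol and conclusion\<close>

lemma is_t_symbol_green_symbol: "is_t_symbol t (green_symbol (2 * t - 1) :: 'a::euclidean_space \<times> 'a \<Rightarrow> complex) harmonic_inverse"
  unfolding is_t_symbol_def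
proof (intro conjI ballI)
  let ?b = "green_symbol (2 * t - 1) :: 'a \<times> 'a \<Rightarrow> complex"
  have "?b = (\<lambda>X. green_symbol_ext (2 * t - 1) X 0)" by (simp add: green_symbol_ext_real fun_eq_iff)
  then show "smooth ?b" using entire_ext_smooth[OF entire_ext_green_symbol[of "2 * t - 1"]] by simp
  show "polynomial_growth ?b"
    unfolding polynomial_growth_def using green_symbol_bounded by (intro exI[of _ "2 ^ DIM('a)"] exI[of _ 0]) auto
  show "Op t ?b f g = distr_of (harmonic_inverse f) g" if "f \<in> schwartz" "g \<in> schwartz" for f g
    using Op_green_symbol[OF that] distr_of_harmonic_inverse[OF that] by simp
qed

lemma smooth_continuous: "smooth f \<Longrightarrow> continuous_on UNIV f"
  using smooth_foldr_differentiable[of f "[]"] by (simp add: differentiable_imp_continuous_on)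

text \<open>\<open>THE\<close> requires existence and uniqueness. A competitor is smooth and of
  polynomial growth by \<open>is_t_symbol\<close>, which is what \<open>symbol_unique\<close> asks
  for.\<close>

lemma harmonic_inverse_symbol_eq:
  "harmonic_inverse_symbol t = (green_symbol (2 * t - 1) :: 'a::euclidean_space \<times> 'a \<Rightarrow> complex)"
  unfolding harmonic_inverse_symbol_def
proof (rule the_equality)
  show "is_t_symbol t (green_symbol (2 * t - 1) :: 'a \<times> 'a \<Rightarrow> complex) harmonic_inverse"
    by (rule is_t_symbol_green_symbol)
  fix b :: "'a \<times> 'a \<Rightarrow> complex" assume b: "is_t_symbol t b harmonic_inverse"
  show "b = green_symbol (2 * t - 1)"
    using b is_t_symbol_green_symbol[where t = t and 'a = 'a] unfolding is_t_symbol_def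
    by (intro symbol_unique[where t = t]) (auto intro: smooth_continuous)
qed

theorem proposition3:
  fixes t :: real
  shows "\<exists>C::real. C > 0 \<and>
    (\<forall>(x :: real ^ 'n) (\<xi> :: real ^ 'n) (\<alpha> :: (real ^ 'n) \<times> (real ^ 'n) \<Rightarrow> nat).
       norm (mderiv \<alpha> (harmonic_inverse_symbol t) (x, \<xi>))
         \<le> C ^ (mindex_order \<alpha> + 1) * sqrt (real (mindex_fact \<alpha>)) * jbracket (x, \<xi>) powi (-2))"
proof -
  define B :: real where "B = 2 ^ DIM(real ^ 'n) * (8 * (4 + (2 * t - 1)\<^sup>2))"
  define L :: real where "L = exp 5 * 2 ^ DIM((real ^ 'n) \<times> (real ^ 'n))"
  have "1 * 1 \<le> (2::real) ^ DIM(real ^ 'n) * (8 * (4 + (2 * t - 1)\<^sup>2))"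
    using zero_le_power2[of "2 * t - 1"] by (intro mult_mono) auto
  then have B: "B \<ge> 1" by (simp only: B_def mult_1)
  have L: "L > 0" by (simp add: L_def)
  have "norm (mderiv \<alpha> (harmonic_inverse_symbol t) (x, \<xi>))
      \<le> (B * max 1 L) ^ (mindex_order \<alpha> + 1) * sqrt (real (mindex_fact \<alpha>)) * jbracket (x, \<xi>) powi (-2)"
    for x \<xi> :: "real ^ 'n" and \<alpha>
  proof -
    let ?n = "mindex_order \<alpha>"
    have "norm (mderiv \<alpha> (harmonic_inverse_symbol t) (x, \<xi>))
        \<le> B * L ^ ?n * sqrt (real (mindex_fact \<alpha>)) * inverse ((jbracket (x, \<xi>))\<^sup>2)"
      unfolding harmonic_inverse_symbol_eq B_def L_def by (rule norm_mderiv_green_symbol_le)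
    \<comment> \<open>Since \<open>B\<close> and \<open>max 1 L\<close> are at least 1, both can be
      raised to the common exponent \<open>?n + 1\<close> and merged into one constant.\<close>
    also have "B * L ^ ?n \<le> B ^ (?n + 1) * max 1 L ^ (?n + 1)"
    proof (rule mult_mono)
      show "B \<le> B ^ (?n + 1)" using B by (simp add: mult_left_mono[of 1, simplified])
      have "L ^ ?n \<le> max 1 L ^ ?n" using L by (intro power_mono) auto
      also have "\<dots> \<le> max 1 L ^ (?n + 1)" by (intro power_increasing) auto
      finally show "L ^ ?n \<le> max 1 L ^ (?n + 1)" .
    qed (use B L in auto)
    also have "B ^ (?n + 1) * max 1 L ^ (?n + 1) = (B * max 1 L) ^ (?n + 1)" by (rule power_mult_distrib[symmetric])
    also have "inverse ((jbracket (x, \<xi>))\<^sup>2) = jbracket (x, \<xi>) powi (-2)"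
      by (simp add: power_int_minus)
    finally show ?thesis using jbracket_pos[of "(x, \<xi>)"] by (simp add: mult_right_mono)
  qed
  moreover have "B * max 1 L > 0" using B by simp
  ultimately show ?thesis by blast
qed

end
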